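(* Let $a,b\in\mathbb R$ and $T>0$ be fixed. Let $(Z_t)_{t\ge0}$ be the one-dimensional linear process given by the stochastic differential equation $$\mathrm dZ_t=\big(q(t)Z_t+r(t)\big)\,\mathrm dt+\sigma(t)\,\mathrm dB_t,\qquad t\ge0,$$ with initial condition $Z_0=a$, and assume that $\sigma(t)\ne0$ for all $t\ge0$. Let $n\in\mathbb N$ and $0<t_1<t_2<\dots<t_n<T$. Then the conditional distribution of $(Z_{t_1},\dots,Z_{t_n})$ given $Z_T=b$ equals the distribution of $(U_{t_1},\dots,U_{t_n})$, where $(U_t)_{t\in[0,T]}$ is the linear process bridge from $a$ to $b$ over $[0,T]$ derived from $(Z_t)_{t\ge0}$.
   Context: $q,\sigma,r:\mathbb R_+\to\mathbb R$ are continuous functions, $(B_t)_{t\ge0}$ is a standard Wiener process, and $\bar q(t):=\int_0^tq(u)\,\mathrm du$. For $0\le s\le t$ and $x\in\mathbb R$, $$m_x(s,t):=e^{\bar q(t)-\bar q(s)}x+\int_s^te^{\bar q(t)-\bar q(u)}r(u)\,\mathrm du,\qquad \gamma(s,t):=\int_s^te^{2(\bar q(t)-\bar q(u))}\sigma^2(u)\,\mathrm du.$$ For $0\le s\le t<T$, $$n_{a,b}(s,t):=\frac{\gamma(s,t)}{\gamma(s,T)}\,e^{\bar q(T)-\bar q(t)}\left(b-\int_t^Te^{\bar q(T)-\bar q(u)}r(u)\,\mathrm du\right)+\frac{\gamma(t,T)}{\gamma(s,T)}\,m_a(s,t).$$ The linear process bridge from $a$ to $b$ over $[0,T]$ derived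 from $Z$ is the almost surely continuous process $(U_t)_{t\in[0,T]}$ with $$U_t=n_{a,b}(0,t)+\int_0^t\frac{\gamma(t,T)}{\gamma(s,T)}\,e^{\bar q(t)-\bar q(s)}\sigma(s)\,\mathrm dB_s,\quad t\in[0,T),\qquad U_T=b.$$ Conditional distributions of jointly Gauss vectors are understood in the usual sense: for jointly Gauss $(\mathbf X,W)$ with $W$ real-valued and $\mathrm{Var}(W)>0$, the regular conditional distribution of $\mathbf X$ given $W=w$ is the version that is Gauss with mean $\mathsf E\mathbf X+\mathrm{Cov}(\mathbf X,W)\mathrm{Var}(W)^{-1}(w-\mathsf EW)$ and covariance matrix $\mathrm{Cov}(\mathbf X,\mathbf X)-\mathrm{Cov}(\mathbf X,W)\mathrm{Var}(W)^{-1}\mathrm{Cov}(\mathbf X,W)^\top$. *)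

theory Defs
  imports "HOL-Probability.Probability"
begin

subsection \<open>Wiener process and stochastic integrals of deterministic functions\<close>

definition wiener_process :: "'w measure \<Rightarrow> (real \<Rightarrow> 'w \<Rightarrow> real) \<Rightarrow> bool" where
  "wiener_process M B \<longleftrightarrow>
     prob_space M \<and>
     (\<forall>t\<ge>0. B t \<in> borel_measurable M) \<and>
     (AE \<omega> in M. B 0 \<omega> = 0) \<and>
     (\<forall>n. \<forall>p :: nat \<Rightarrow> real. 0 \<le> p 0 \<and> (\<forall>k<n. p k \<le> p (Suc k)) \<longrightarrow>
        prob_space.indep_vars M (\<lambda>_. borel) (\<lambda>k \<omega>. B (p (Suc k)) \<omega> - B (p k) \<omega>) {..<n}) \<and>
     (\<forall>s t. 0 \<le> s \<and> s < t \<longrightarrow>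
        distributed M lborel (\<lambda>\<omega>. B t \<omega> - B s \<omega>) (normal_density 0 (sqrt (t - s)))) \<and>
     (AE \<omega> in M. continuous_on {0..} (\<lambda>t. B t \<omega>))"

definition step_function :: "nat \<Rightarrow> (nat \<Rightarrow> real) \<Rightarrow> (nat \<Rightarrow> real) \<Rightarrow> real \<Rightarrow> real" where
  "step_function N p c u = (\<Sum>k<N. c k * indicator {p k<..p (Suc k)} u)"

definition step_integral ::
    "(real \<Rightarrow> 'w \<Rightarrow> real) \<Rightarrow> nat \<Rightarrow> (nat \<Rightarrow> real) \<Rightarrow> (nat \<Rightarrow> real) \<Rightarrow> 'w \<Rightarrow> real" where
  "step_integral B N p c \<omega> = (\<Sum>k<N. c k * (B (p (Suc k)) \<omega> - B (p k) \<omega>))"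

text \<open>
  \<open>is_wiener_integral M B f t X\<close>: the random variable \<open>X\<close> is a version of the stochastic integral
  of the deterministic function \<open>f\<close> over \<open>[0,t]\<close> with respect to \<open>B\<close>, i.e. the \<open>L\<^sup>2\<close>-limit of the
  integrals of step functions which approximate \<open>f\<close> in \<open>L\<^sup>2([0,t])\<close>. By the Ito isometry, this
  determines \<open>X\<close> up to almost sure equality. Nonnegative integrals are used so that a
  non-integrable square counts as infinite, not as zero.
\<close>

definition is_wiener_integral ::
    "'w measure \<Rightarrow> (real \<Rightarrow> 'w \<Rightarrow> real) \<Rightarrow> (real \<Rightarrow> real) \<Rightarrow> real \<Rightarrow> ('w \<Rightarrow> real) \<Rightarrow> bool" where
  "is_wiener_integral M B f t X \<longleftrightarrow>
     X \<in> borel_measurable M \<and>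
     (\<exists>(N :: nat \<Rightarrow> nat) (p :: nat \<Rightarrow> nat \<Rightarrow> real) (c :: nat \<Rightarrow> nat \<Rightarrow> real).
        (\<forall>j. p j 0 = 0 \<and> p j (N j) = t \<and> (\<forall>k<N j. p j k \<le> p j (Suc k))) \<and>
        (\<lambda>j. \<integral>\<^sup>+u\<in>{0..t}. ennreal ((f u - step_function (N j) (p j) (c j) u)\<^sup>2) \<partial>lborel)
          \<longlonglongrightarrow> 0 \<and>
        (\<lambda>j. \<integral>\<^sup>+\<omega>. ennreal ((X \<omega> - step_integral B (N j) (p j) (c j) \<omega>)\<^sup>2) \<partial>M)
          \<longlonglongrightarrow> 0)"

subsection \<open>Linear processes and their bridges\<close>

definition qbar :: "(real \<Rightarrow> real) \<Rightarrow> real \<Rightarrow> real" where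
  "qbar q t = integral {0..t} q"

definition mean_fun ::
    "(real \<Rightarrow> real) \<Rightarrow> (real \<Rightarrow> real) \<Rightarrow> real \<Rightarrow> real \<Rightarrow> real \<Rightarrow> real" where
  "mean_fun q r x s t =
     exp (qbar q t - qbar q s) * x + integral {s..t} (\<lambda>u. exp (qbar q t - qbar q u) * r u)"

definition gamma_fun ::
    "(real \<Rightarrow> real) \<Rightarrow> (real \<Rightarrow> real) \<Rightarrow> real \<Rightarrow> real \<Rightarrow> real" where
  "gamma_fun q \<sigma> s t = integral {s..t} (\<lambda>u. exp (2 * (qbar q t - qbar q u)) * (\<sigma> u)\<^sup>2)"

definition bridge_mean ::
    "(real \<Rightarrow> real) \<Rightarrow> (real \<Rightarrow> real) \<Rightarrow> (real \<Rightarrow> real) \<Rightarrow> real \<Rightarrow> real \<Rightarrow> real \<Rightarrow> real \<Rightarrow> real \<Rightarrow> real"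
  where
  "bridge_mean q \<sigma> r T a b s t =
     gamma_fun q \<sigma> s t / gamma_fun q \<sigma> s T * exp (qbar q T - qbar q t)
       * (b - integral {t..T} (\<lambda>u. exp (qbar q T - qbar q u) * r u))
     + gamma_fun q \<sigma> t T / gamma_fun q \<sigma> s T * mean_fun q r a s t"

text \<open>
  The stochastic differential equation is meant in its integral form. Since the integrand of the
  stochastic integral is deterministic, adaptedness of \<open>Z\<close> is not needed to make sense of
  the equation and is not required.
\<close>

definition linear_process ::
    "'w measure \<Rightarrow> (real \<Rightarrow> 'w \<Rightarrow> real) \<Rightarrow> (real \<Rightarrow> real) \<Rightarrow> (real \<Rightarrow> real) \<Rightarrow> (real \<Rightarrow> real) \<Rightarrow> real
      \<Rightarrow> (real \<Rightarrow> 'w \<Rightarrow> real) \<Rightarrow> bool" where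
  "linear_process M B q \<sigma> r a Z \<longleftrightarrow>
     (\<forall>t\<ge>0. Z t \<in> borel_measurable M) \<and>
     (AE \<omega> in M. continuous_on {0..} (\<lambda>t. Z t \<omega>)) \<and>
     (AE \<omega> in M. Z 0 \<omega> = a) \<and>
     (\<forall>t\<ge>0. \<exists>J. is_wiener_integral M B \<sigma> t J \<and>
        (AE \<omega> in M. Z t \<omega> = Z 0 \<omega> + integral {0..t} (\<lambda>u. q u * Z u \<omega> + r u) + J \<omega>))"

definition linear_process_bridge ::
    "'w measure \<Rightarrow> (real \<Rightarrow> 'w \<Rightarrow> real) \<Rightarrow> (real \<Rightarrow> real) \<Rightarrow> (real \<Rightarrow> real) \<Rightarrow> (real \<Rightarrow> real)
      \<Rightarrow> real \<Rightarrow> real \<Rightarrow> real \<Rightarrow> (real \<Rightarrow> 'w \<Rightarrow> real) \<Rightarrow> bool" where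
  "linear_process_bridge M B q \<sigma> r T a b U \<longleftrightarrow>
     (\<forall>t\<in>{0..T}. U t \<in> borel_measurable M) \<and>
     (AE \<omega> in M. continuous_on {0..T} (\<lambda>t. U t \<omega>)) \<and>
     (\<forall>t\<in>{0..<T}. \<exists>J.
        is_wiener_integral M B
          (\<lambda>s. gamma_fun q \<sigma> t T / gamma_fun q \<sigma> s T * exp (qbar q t - qbar q s) * \<sigma> s) t J \<and>
        (AE \<omega> in M. U t \<omega> = bridge_mean q \<sigma> r T a b 0 t + J \<omega>)) \<and>
     (AE \<omega> in M. U T \<omega> = b)"

subsection \<open>Gauss vectors and their conditional distributions\<close>

definition random_vector :: "'i set \<Rightarrow> ('i \<Rightarrow> 'w \<Rightarrow> real) \<Rightarrow> 'w \<Rightarrow> 'i \<Rightarrow> real" where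
  "random_vector I X \<omega> = (\<lambda>i\<in>I. X i \<omega>)"

definition law :: "'w measure \<Rightarrow> 'i set \<Rightarrow> ('i \<Rightarrow> 'w \<Rightarrow> real) \<Rightarrow> ('i \<Rightarrow> real) measure" where
  "law M I X = distr M (Pi\<^sub>M I (\<lambda>_. borel)) (random_vector I X)"

text \<open>The one-dimensional normal distribution with mean \<open>\<mu>\<close> and variance \<open>v\<close>.\<close>

definition normal_law :: "real \<Rightarrow> real \<Rightarrow> real measure" where
  "normal_law \<mu> v =
     (if v > 0 then density lborel (\<lambda>x. ennreal (normal_density \<mu> (sqrt v) x)) else return borel \<mu>)"

text \<open>
  \<open>N\<close> is the (possibly degenerate) Gauss distribution on the space of vectors indexed by \<open>I\<close> with
  mean vector \<open>m\<close> and covariance matrix \<open>C\<close>: every linear functional is normally distributed with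
  the appropriate mean and variance.
\<close>

definition gauss_law ::
    "'i set \<Rightarrow> ('i \<Rightarrow> real) \<Rightarrow> ('i \<Rightarrow> 'i \<Rightarrow> real) \<Rightarrow> ('i \<Rightarrow> real) measure \<Rightarrow> bool" where
  "gauss_law I m C N \<longleftrightarrow>
     sets N = sets (Pi\<^sub>M I (\<lambda>_. borel)) \<and>
     (\<forall>i\<in>I. \<forall>j\<in>I. C i j = C j i) \<and>
     (\<forall>z :: 'i \<Rightarrow> real.
        (\<Sum>i\<in>I. \<Sum>j\<in>I. z i * C i j * z j) \<ge> 0 \<and>
        distr N borel (\<lambda>x. \<Sum>i\<in>I. z i * x i)
          = normal_law (\<Sum>i\<in>I. z i * m i) (\<Sum>i\<in>I. \<Sum>j\<in>I. z i * C i j * z j))"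

definition gauss_vector :: "'w measure \<Rightarrow> 'i set \<Rightarrow> ('i \<Rightarrow> 'w \<Rightarrow> real) \<Rightarrow> bool" where
  "gauss_vector M I X \<longleftrightarrow>
     (\<forall>i\<in>I. X i \<in> borel_measurable M) \<and> (\<exists>m C. gauss_law I m C (law M I X))"

text \<open>The vector \<open>(X, W)\<close> is indexed by \<open>option\<close>, with \<open>W\<close> at the index \<open>None\<close>.\<close>

definition jointly_gauss ::
    "'w measure \<Rightarrow> 'i set \<Rightarrow> ('i \<Rightarrow> 'w \<Rightarrow> real) \<Rightarrow> ('w \<Rightarrow> real) \<Rightarrow> bool" where
  "jointly_gauss M I X W \<longleftrightarrow> gauss_vector M (insert None (Some ` I)) (case_option W X)"

definition mean :: "'w measure \<Rightarrow> ('w \<Rightarrow> real) \<Rightarrow> real" where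
  "mean M X = (\<integral>\<omega>. X \<omega> \<partial>M)"

definition covariance :: "'w measure \<Rightarrow> ('w \<Rightarrow> real) \<Rightarrow> ('w \<Rightarrow> real) \<Rightarrow> real" where
  "covariance M X Y = (\<integral>\<omega>. (X \<omega> - mean M X) * (Y \<omega> - mean M Y) \<partial>M)"

definition regular_cond_distr ::
    "'w measure \<Rightarrow> 'i set \<Rightarrow> ('i \<Rightarrow> 'w \<Rightarrow> real) \<Rightarrow> ('w \<Rightarrow> real) \<Rightarrow> (real \<Rightarrow> ('i \<Rightarrow> real) measure) \<Rightarrow> bool"
  where
  "regular_cond_distr M I X W \<kappa> \<longleftrightarrow>
     \<kappa> \<in> borel \<rightarrow>\<^sub>M prob_algebra (Pi\<^sub>M I (\<lambda>_. borel)) \<and>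
     (\<forall>A\<in>sets (Pi\<^sub>M I (\<lambda>_. borel)). \<forall>D\<in>sets borel.
        emeasure M {\<omega> \<in> space M. random_vector I X \<omega> \<in> A \<and> W \<omega> \<in> D}
          = (\<integral>\<^sup>+w\<in>D. emeasure (\<kappa> w) A \<partial>distr M borel W))"

text \<open>
  \<open>\<kappa> w\<close> is the conditional distribution of \<open>X\<close> given \<open>W = w\<close>, for jointly Gauss \<open>(X, W)\<close> with
  \<open>Var(W) > 0\<close>. Prescribing the Gauss law for every \<open>w\<close> (and not just for almost every \<open>w\<close>)
  singles out one version of the regular conditional distribution, so that its value at a given
  point \<open>w\<close> is meaningful.
\<close>

definition gauss_cond_distr ::
    "'w measure \<Rightarrow> 'i set \<Rightarrow> ('i \<Rightarrow> 'w \<Rightarrow> real) \<Rightarrow> ('w \<Rightarrow> real) \<Rightarrow> (real \<Rightarrow> ('i \<Rightarrow> real) measure) \<Rightarrow> bool"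
  where
  "gauss_cond_distr M I X W \<kappa> \<longleftrightarrow>
     jointly_gauss M I X W \<and>
     covariance M W W > 0 \<and>
     regular_cond_distr M I X W \<kappa> \<and>
     (\<forall>w. gauss_law I
        (\<lambda>i. mean M (X i) + covariance M (X i) W / covariance M W W * (w - mean M W))
        (\<lambda>i j. covariance M (X i) (X j)
           - covariance M (X i) W / covariance M W W * covariance M (X j) W)
        (\<kappa> w))"

end

theory Submission
  imports Defs
begin

text \<open>
  Both processes are linear in the Wiener process, so all laws in question are Gauss laws, and these
  are determined by mean and covariance (Cramer--Wold). By variation of constants,
  \<open>Z t = m\<^sub>a(0,t) + \<integral>\<^sub>0\<^sup>t e\<^bsup>qbar t - qbar u\<^esup> \<sigma> u dB u\<close>. In terms of the
  clock \<open>H t = \<integral>\<^sub>0\<^sup>t e\<^bsup>- 2 qbar u\<^esup> \<sigma>\<^sup>2 u du\<close> the covariance of \<open>Z\<close> is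
  \<open>e\<^bsup>qbar s + qbar t\<^esup> H (min s t)\<close>, so regression on \<open>Z T\<close> gives the conditional covariance
  \<open>e\<^bsup>qbar s + qbar t\<^esup> (H (min s t) - H s H t / H T)\<close>. The bridge has the same covariance, because
  \<open>H' / (H T - H)\<^sup>2\<close> has the primitive \<open>1 / (H T - H)\<close>.
\<close>

text \<open>Laws are identified by characteristic functions on the real line, so every comparison of
  vectors is brought down to linear functionals. For this, each integral over \<open>[0,t]\<close>
  is read as an integral over the whole line of a kernel extended by zero: a linear combination of
  variables at different times is then again one Wiener integral, and covariances become L2 inner
  products of kernels. Functionals may have variance zero, which excludes an argument by densities.
  A conditional law at the single point \<open>b\<close> is meaningful only for a fixed version. The
  version is constructed explicitly, by replacing the conditioning variable with the number
  \<open>w\<close> in the regression; what has to be proved is that uncorrelated residuals are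
  independent of that variable. The equation for \<open>Z\<close> contains the time integral of a
  random path, so its solution formula calls for an exchange of time integration and stochastic
  integration. This exchange is made for finite sums over grid points, where it is trivial, and then
  carried to the limit.\<close>

subsection \<open>Uniqueness of laws on finite products\<close>

text \<open>Reduces to Levy's uniqueness theorem for probability measures by normalising: the total
  mass is the value of \<open>char\<close> at 0, hence common to both measures. Mass zero cannot be
  normalised and is treated apart.\<close>

lemma finite_measure_eqI_char:
  fixes M N :: "real measure"
  assumes M: "finite_measure M" and N: "finite_measure N"
    and S[simp, measurable_cong]: "sets M = sets borel" "sets N = sets borel"
    and char: "char M = char N"
  shows "M = N"
proof -
  interpret M: finite_measure M by fact
  interpret N: finite_measure N by fact
  have [simp]: "space M = UNIV" "space N = UNIV"
    using S[THEN sets_eq_imp_space_eq] by auto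
  define c where "c = measure M UNIV"
  have c: "measure N UNIV = c"
    using fun_cong[OF char, of 0] by (simp add: char_def c_def)
  have *: "real_distribution (density K (\<lambda>_. ennreal (1 / c))) \<and>
      char (density K (\<lambda>_. ennreal (1 / c))) = (\<lambda>t. char K t / c)"
    if K: "finite_measure K" "sets K = sets borel" "measure K UNIV = c" "c > 0" for K :: "real measure"
  proof
    interpret K: finite_measure K by fact
    have [simp]: "space K = UNIV" using K(2) by (auto dest: sets_eq_imp_space_eq)
    note K(2)[measurable_cong]
    have "emeasure K UNIV = ennreal c" using K(3) K.emeasure_eq_measure by simp
    then show "real_distribution (density K (\<lambda>_. ennreal (1 / c)))"
      using K(2,4)
      by (auto simp: real_distribution_def real_distribution_axioms_def emeasure_density
          ennreal_mult[symmetric] intro!: prob_spaceI)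
    show "char (density K (\<lambda>_. ennreal (1 / c))) = (\<lambda>t. char K t / c)"
      using K(4) unfolding char_def
      by (subst integral_density) (auto simp: scaleR_conv_of_real fun_eq_iff)
  qed
  show ?thesis
  proof (cases "c = 0")
    case True
    then have "emeasure M A = 0" "emeasure N A = 0" for A
      using M.finite_measure_mono[of A UNIV] N.finite_measure_mono[of A UNIV] c
      by (auto simp: c_def M.emeasure_eq_measure N.emeasure_eq_measure measure_le_0_iff)
    then show ?thesis by (intro measure_eqI) auto
  next
    case False
    then have pos: "c > 0" by (simp add: c_def measure_nonneg order.strict_iff_order)
    have eq: "density M (\<lambda>_. ennreal (1 / c)) = density N (\<lambda>_. ennreal (1 / c))"
      using *[OF M _ c_def[symmetric] pos] *[OF N _ c pos] char by (intro Levy_uniqueness) auto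
    have "emeasure M A = emeasure N A" if "A \<in> sets borel" for A
    proof -
      have "ennreal (1 / c) * emeasure M A = ennreal (1 / c) * emeasure N A"
        using arg_cong[OF eq, of "\<lambda>K. emeasure K A"] that by (simp add: emeasure_density nn_integral_cmult_indicator)
      then show ?thesis using pos by (simp add: ennreal_mult_cancel_left)
    qed
    then show ?thesis by (intro measure_eqI) auto
  qed
qed

text \<open>
  Replaces the coordinates one at a time by indicators: for the coordinate \<open>k\<close> the measure with
  density \<open>\<Prod> 1\<^sub>D (1 + cos \<dots>)\<close> is nonnegative, and its characteristic function is
  given by integrals of the previous stage.
\<close>

lemma cramer_wold_step:
  fixes N1 N2 :: "('i \<Rightarrow> real) measure"
  assumes I: "finite I" and P: "prob_space N1" "prob_space N2"
    and S: "sets N1 = sets (Pi\<^sub>M I (\<lambda>_. borel))" "sets N2 = sets (Pi\<^sub>M I (\<lambda>_. borel))"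
    and eq: "\<And>z. distr N1 borel (\<lambda>x. \<Sum>i\<in>I. z i * x i) = distr N2 borel (\<lambda>x. \<Sum>i\<in>I. z i * x i)"
    and K: "K \<subseteq> I" and D: "\<And>k. k \<in> K \<Longrightarrow> D k \<in> sets borel"
  shows "(\<integral>x. (\<Prod>k\<in>K. indicator (D k) (x k)) * cos ((\<Sum>i\<in>I - K. z i * x i) + \<phi>) \<partial>N1) =
         (\<integral>x. (\<Prod>k\<in>K. indicator (D k) (x k)) * cos ((\<Sum>i\<in>I - K. z i * x i) + \<phi>) \<partial>N2)"
  using finite_subset[OF K I] K D
proof (induction K arbitrary: z \<phi> rule: finite_induct)
  case empty
  note S[measurable_cong]
  have *: "(\<integral>x. cos ((\<Sum>i\<in>I. z i * x i) + \<phi>) \<partial>N) =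
      (\<integral>y. cos (y + \<phi>) \<partial>distr N borel (\<lambda>x. \<Sum>i\<in>I. z i * x i))"
    if [measurable_cong]: "sets N = sets (Pi\<^sub>M I (\<lambda>_. borel))" for N :: "('i \<Rightarrow> real) measure"
    by (subst integral_distr) auto
  show ?case by (simp add: *[OF S(1)] *[OF S(2)] eq)
next
  case (insert k K)
  define J where "J = I - insert k K"
  have J: "I - K = insert k J" "k \<notin> J" "finite J" "J \<subseteq> I"
    using insert.prems insert.hyps I by (auto simp: J_def)
  have k: "k \<in> I" and KI: "K \<subseteq> I" using insert.prems by auto
  have Dk[measurable]: "D k \<in> sets borel" and DK[measurable]: "\<And>l. l \<in> K \<Longrightarrow> D l \<in> sets borel"
    using insert.prems by auto
  define p where "p x = (\<Prod>l\<in>K. indicator (D l) (x l) :: real)" for x :: "'i \<Rightarrow> real"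
  define \<theta> where "\<theta> x = (\<Sum>i\<in>J. z i * x i)" for x :: "'i \<Rightarrow> real"
  have p01: "0 \<le> p x" "p x \<le> 1" for x
    unfolding p_def by (auto intro!: prod_nonneg prod_le_1)
  have meas[measurable]: "p \<in> borel_measurable (Pi\<^sub>M I (\<lambda>_. borel))"
      "\<theta> \<in> borel_measurable (Pi\<^sub>M I (\<lambda>_. borel))" "(\<lambda>x. x k) \<in> borel_measurable (Pi\<^sub>M I (\<lambda>_. borel))"
  proof -
    have "(\<lambda>x. x l) \<in> borel_measurable (Pi\<^sub>M I (\<lambda>_. borel))" if "l \<in> I" for l using that by simp
    note [measurable] = this
    show "p \<in> borel_measurable (Pi\<^sub>M I (\<lambda>_. borel))"
      unfolding p_def[abs_def] using KI DK
      by (intro borel_measurable_prod measurable_compose[of "\<lambda>x. x _" _ borel, OF _ borel_measurable_indicator]) auto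
    show "\<theta> \<in> borel_measurable (Pi\<^sub>M I (\<lambda>_. borel))"
      unfolding \<theta>_def[abs_def] using J by (intro borel_measurable_sum) auto
    show "(\<lambda>x. x k) \<in> borel_measurable (Pi\<^sub>M I (\<lambda>_. borel))" using k by simp
  qed
  \<comment> \<open>The induction hypothesis is taken with weight \<open>s\<close> on the new
    coordinate and \<open>e\<close> times the old weights on the others. Only
    \<open>e = 0, 1, -1\<close> occur below: the product formula for cosines splits
    \<open>h \<phi> x * cos (s * x k + \<psi>)\<close> into three such terms.\<close>
  have IH: "(\<integral>x. p x * cos (s * x k + e * \<theta> x + \<phi>) \<partial>N1) = (\<integral>x. p x * cos (s * x k + e * \<theta> x + \<phi>) \<partial>N2)" for s e \<phi>
  proof -
    define w where "w i = (if i = k then s else e * z i)" for i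
    have "(\<Sum>i\<in>J. w i * x i) = e * \<theta> x" for x :: "'i \<Rightarrow> real"
      unfolding \<theta>_def sum_distrib_left using J(2) by (intro sum.cong) (auto simp: w_def)
    then have "(\<Sum>i\<in>I - K. w i * x i) = s * x k + e * \<theta> x" for x :: "'i \<Rightarrow> real"
      using J by (simp add: w_def)
    then show ?thesis using insert.IH[OF KI DK, of w \<phi>] by (simp add: p_def)
  qed
  have int: "integrable N f" if "prob_space N" "sets N = sets (Pi\<^sub>M I (\<lambda>_. borel))"
      "f \<in> borel_measurable (Pi\<^sub>M I (\<lambda>_. borel))" "\<And>x. \<bar>f x\<bar> \<le> 3" for N and f :: "('i \<Rightarrow> real) \<Rightarrow> real"
  proof -
    interpret prob_space N by fact
    note that(2)[measurable_cong]
    show ?thesis using that by (intro integrable_const_bound[where B=3]) auto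
  qed
  define h where "h \<phi> x = p x * (1 + cos (\<theta> x + \<phi>))" for \<phi> x
  have h0: "0 \<le> h \<phi> x" for \<phi> x
  proof -
    have "0 \<le> 1 + cos (\<theta> x + \<phi>)" using cos_ge_minus_one[of "\<theta> x + \<phi>"] by linarith
    then show ?thesis using p01[of x] by (simp add: h_def)
  qed
  have h2: "h \<phi> x \<le> 2" for \<phi> x
    using mult_mono[of "p x" 1 "1 + cos (\<theta> x + \<phi>)" 2] p01[of x] cos_le_one[of "\<theta> x + \<phi>"] cos_ge_minus_one[of "\<theta> x + \<phi>"]
    by (auto simp: h_def)
  have habs: "\<bar>h \<phi> x\<bar> \<le> 3" for \<phi> x
    using h0[of \<phi> x] h2[of \<phi> x] by linarith
  have [measurable]: "h \<phi> \<in> borel_measurable (Pi\<^sub>M I (\<lambda>_. borel))" for \<phi>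
    unfolding h_def[abs_def] by measurable
  have pcos_bd: "\<bar>p x * cos y\<bar> \<le> 1" for x y
    using mult_mono[of "\<bar>p x\<bar>" 1 "\<bar>cos y\<bar>" 1] p01[of x] by (simp add: abs_mult)
  have hcos: "(\<integral>x. h \<phi> x * cos (s * x k + \<psi>) \<partial>N1) = (\<integral>x. h \<phi> x * cos (s * x k + \<psi>) \<partial>N2)" for \<phi> \<psi> s
  proof -
    have e: "h \<phi> x * cos (s * x k + \<psi>) = p x * cos (s * x k + 0 * \<theta> x + \<psi>)
        + (1/2) * (p x * cos (s * x k + 1 * \<theta> x + (\<phi> + \<psi>)))
        + (1/2) * (p x * cos (s * x k + (- 1) * \<theta> x + (\<psi> - \<phi>)))" for x
    proof -
      have "cos (s * x k + \<psi>) * cos (\<theta> x + \<phi>) =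
        (cos (s * x k + 1 * \<theta> x + (\<phi> + \<psi>)) + cos (s * x k + (- 1) * \<theta> x + (\<psi> - \<phi>))) / 2"
        by (subst cos_times_cos) (simp add: algebra_simps)
      moreover have "h \<phi> x * cos (s * x k + \<psi>) =
          p x * cos (s * x k + \<psi>) + p x * (cos (s * x k + \<psi>) * cos (\<theta> x + \<phi>))"
        unfolding h_def by (simp add: ring_distribs)
      ultimately show ?thesis by (simp add: field_simps)
    qed
    have "(\<integral>x. h \<phi> x * cos (s * x k + \<psi>) \<partial>N) = (\<integral>x. p x * cos (s * x k + 0 * \<theta> x + \<psi>) \<partial>N)
        + (1/2) * (\<integral>x. p x * cos (s * x k + 1 * \<theta> x + (\<phi> + \<psi>)) \<partial>N)
        + (1/2) * (\<integral>x. p x * cos (s * x k + (- 1) * \<theta> x + (\<psi> - \<phi>)) \<partial>N)"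
      if N: "prob_space N" "sets N = sets (Pi\<^sub>M I (\<lambda>_. borel))" for N
    proof -
      have i: "integrable N (\<lambda>x. p x * cos (s * x k + e * \<theta> x + \<phi>'))" for e \<phi>'
      proof (rule int[OF N])
        show "\<bar>p x * cos (s * x k + e * \<theta> x + \<phi>')\<bar> \<le> 3" for x
          using pcos_bd[of x "s * x k + e * \<theta> x + \<phi>'"] by linarith
      qed measurable
      show ?thesis unfolding e
        by (simp only: Bochner_Integration.integral_add Bochner_Integration.integrable_add integrable_mult_right integral_mult_right_zero i)
    qed
    then show ?thesis by (simp only: P S IH)
  qed
  define \<nu> where "\<nu> N \<phi> = distr (density N (\<lambda>x. ennreal (h \<phi> x))) borel (\<lambda>x. x k)" for N :: "('i \<Rightarrow> real) measure" and \<phi>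
  \<comment> \<open>The phase \<open>- pi / 2\<close> turns the cosine into a sine, so real and
    imaginary part of the characteristic function are integrals of the same shape and both fall
    under \<open>hcos\<close>.\<close>
  have \<nu>: "finite_measure (\<nu> N \<phi>) \<and> (\<forall>t. char (\<nu> N \<phi>) t =
        Complex (\<integral>x. h \<phi> x * cos (t * x k + 0) \<partial>N) (\<integral>x. h \<phi> x * cos (t * x k + (- pi / 2)) \<partial>N))
      \<and> measure (\<nu> N \<phi>) (D k) = (\<integral>x. h \<phi> x * indicator (D k) (x k) \<partial>N)"
    if N: "prob_space N" "sets N = sets (Pi\<^sub>M I (\<lambda>_. borel))" for N \<phi>
  proof -
    interpret prob_space N by fact
    note N(2)[measurable_cong]
    have ih: "integrable N (h \<phi>)" by (intro int[OF N] habs) auto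
    have "finite_measure (density N (\<lambda>x. ennreal (h \<phi> x)))"
      using ih h0 by (intro finite_measureI) (auto simp: emeasure_density nn_integral_eq_integral)
    then have 1: "finite_measure (\<nu> N \<phi>)"
      unfolding \<nu>_def by (intro finite_measure.finite_measure_distr) auto
    have 2: "char (\<nu> N \<phi>) t =
        Complex (\<integral>x. h \<phi> x * cos (t * x k + 0) \<partial>N) (\<integral>x. h \<phi> x * cos (t * x k + (- pi / 2)) \<partial>N)" for t
    proof -
      have "char (\<nu> N \<phi>) t = (\<integral>x. h \<phi> x *\<^sub>R iexp (t * x k) \<partial>N)"
        unfolding char_def \<nu>_def using h0 by (subst integral_distr) (auto simp: integral_density)
      moreover have i: "integrable N (\<lambda>x. h \<phi> x *\<^sub>R iexp (t * x k))"
        using ih by (rule Bochner_Integration.integrable_bound) auto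
      have c: "cos (t * y + (- pi / 2)) = sin (t * y)" for y
        by (rule trans[OF cos_add]) (simp add: cos_minus sin_minus)
      have "Re (\<integral>x. h \<phi> x *\<^sub>R iexp (t * x k) \<partial>N) = (\<integral>x. h \<phi> x * cos (t * x k + 0) \<partial>N)"
        unfolding integral_Re[OF i, symmetric]
        by (rule Bochner_Integration.integral_cong) (simp_all add: Re_exp)
      moreover have "Im (\<integral>x. h \<phi> x *\<^sub>R iexp (t * x k) \<partial>N) = (\<integral>x. h \<phi> x * cos (t * x k + (- pi / 2)) \<partial>N)"
        unfolding integral_Im[OF i, symmetric] c
        by (rule Bochner_Integration.integral_cong) (simp_all add: Im_exp)
      ultimately show ?thesis by (simp add: complex_eq_iff)
    qed
    have "emeasure (\<nu> N \<phi>) (D k) = (\<integral>\<^sup>+x. ennreal (h \<phi> x * indicator (D k) (x k)) \<partial>N)"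
      unfolding \<nu>_def by (subst emeasure_distr)
        (auto simp: emeasure_density h0 ennreal_mult' ennreal_indicator split: split_indicator intro!: nn_integral_cong)
    also have "\<dots> = ennreal (\<integral>x. h \<phi> x * indicator (D k) (x k) \<partial>N)"
    proof (rule nn_integral_eq_integral)
      show "integrable N (\<lambda>x. h \<phi> x * indicator (D k) (x k))"
        using ih by (rule Bochner_Integration.integrable_bound) (auto split: split_indicator)
    qed (auto simp: h0)
    finally have 3: "measure (\<nu> N \<phi>) (D k) = (\<integral>x. h \<phi> x * indicator (D k) (x k) \<partial>N)"
      unfolding measure_def by (simp add: h0)
    show ?thesis using 1 2 3 by blast
  qed
  have "\<nu> N1 \<phi> = \<nu> N2 \<phi>" for \<phi>
  proof (rule finite_measure_eqI_char)
    show "char (\<nu> N1 \<phi>) = char (\<nu> N2 \<phi>)"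
    proof
      fix t
      show "char (\<nu> N1 \<phi>) t = char (\<nu> N2 \<phi>) t"
        using \<nu>[OF P(1) S(1), THEN conjunct2, THEN conjunct1, rule_format, of \<phi> t]
          \<nu>[OF P(2) S(2), THEN conjunct2, THEN conjunct1, rule_format, of \<phi> t]
        by (simp only: hcos)
    qed
  qed (use \<nu>[OF P(1) S(1)] \<nu>[OF P(2) S(2)] in \<open>auto simp: \<nu>_def\<close>)
  then have A: "(\<integral>x. h \<phi> x * indicator (D k) (x k) \<partial>N1) = (\<integral>x. h \<phi> x * indicator (D k) (x k) \<partial>N2)" for \<phi>
    using \<nu>[OF P(1) S(1)] \<nu>[OF P(2) S(2)] by metis
  \<comment> \<open>The phase \<open>\<phi> + pi\<close> cancels the cosine, which isolates the constant part.\<close>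
  have "(\<integral>x. p x * indicator (D k) (x k) * cos (\<theta> x + \<phi>) \<partial>N) =
      ((\<integral>x. h \<phi> x * indicator (D k) (x k) \<partial>N) - (\<integral>x. h (\<phi> + pi) x * indicator (D k) (x k) \<partial>N)) / 2"
    if N: "prob_space N" "sets N = sets (Pi\<^sub>M I (\<lambda>_. borel))" for N
  proof -
    have i: "integrable N (\<lambda>x. h \<phi> x * indicator (D k) (x k))" for \<phi>
      by (intro int[OF N]) (auto simp: habs split: split_indicator)
    have "(\<integral>x. h \<phi> x * indicator (D k) (x k) \<partial>N) - (\<integral>x. h (\<phi> + pi) x * indicator (D k) (x k) \<partial>N) =
        (\<integral>x. 2 * (p x * indicator (D k) (x k) * cos (\<theta> x + \<phi>)) \<partial>N)"
      unfolding Bochner_Integration.integral_diff[OF i i, symmetric]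
      by (auto intro!: Bochner_Integration.integral_cong simp: h_def cos_add algebra_simps)
    then show ?thesis by simp
  qed
  then have "(\<integral>x. p x * indicator (D k) (x k) * cos (\<theta> x + \<phi>) \<partial>N1) =
      (\<integral>x. p x * indicator (D k) (x k) * cos (\<theta> x + \<phi>) \<partial>N2)"
    by (simp only: P S A)
  then show ?case
    using insert.hyps by (simp add: p_def \<theta>_def J_def[symmetric] mult_ac)
qed

text \<open>With all coordinates replaced by indicators the cosine in
  \<open>cramer_wold_step\<close> is that of an empty sum, namely 1, and the integrals are the
  measures of boxes; boxes form a generator stable under intersection.\<close>

lemma cramer_wold:
  fixes N1 N2 :: "('i \<Rightarrow> real) measure"
  assumes I: "finite I" and P: "prob_space N1" "prob_space N2"
    and S: "sets N1 = sets (Pi\<^sub>M I (\<lambda>_. borel))" "sets N2 = sets (Pi\<^sub>M I (\<lambda>_. borel))"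
    and eq: "\<And>z. distr N1 borel (\<lambda>x. \<Sum>i\<in>I. z i * x i) = distr N2 borel (\<lambda>x. \<Sum>i\<in>I. z i * x i)"
  shows "N1 = N2"
proof (rule measure_eqI_PiM_finite[OF I S])
  interpret N1: prob_space N1 by fact
  interpret N2: prob_space N2 by fact
  show "emeasure N1 (Pi\<^sub>E I A) = emeasure N2 (Pi\<^sub>E I A)" if A: "\<And>i. i \<in> I \<Longrightarrow> A i \<in> sets borel" for A
  proof -
    have "(\<integral>x. (\<Prod>k\<in>I. indicator (A k) (x k)) \<partial>N) = measure N (Pi\<^sub>E I A)"
      if N: "sets N = sets (Pi\<^sub>M I (\<lambda>_. borel))" for N :: "('i \<Rightarrow> real) measure"
    proof -
      have sp: "space N = (\<Pi>\<^sub>E i\<in>I. UNIV)" using sets_eq_imp_space_eq[OF N] by (simp add: space_PiM)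
      have "(\<integral>x. (\<Prod>k\<in>I. indicator (A k) (x k)) \<partial>N) = (\<integral>x. (indicator (Pi\<^sub>E I A) x :: real) \<partial>N)"
      proof (rule Bochner_Integration.integral_cong[OF refl])
        fix x assume "x \<in> space N"
        then have x: "x \<in> extensional I" by (auto simp: sp PiE_iff)
        show "(\<Prod>k\<in>I. indicator (A k) (x k)) = (indicator (Pi\<^sub>E I A) x :: real)"
        proof (cases "\<forall>k\<in>I. x k \<in> A k")
          case True
          then show ?thesis using x by (simp add: PiE_iff)
        next
          case False
          then show ?thesis using prod_zero[OF I, of "\<lambda>k. indicator (A k) (x k) :: real"]
            by (auto simp: PiE_iff indicator_def)
        qed
      qed
      also have "\<dots> = measure N (Pi\<^sub>E I A)"
      proof -
        have "Pi\<^sub>E I A \<subseteq> space N" by (auto simp: sp PiE_iff)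
        then show ?thesis by (simp add: Int_absorb2)
      qed
      finally show ?thesis .
    qed
    with cramer_wold_step[OF I P S eq order_refl, where D = A and z = "\<lambda>_. 0" and \<phi> = 0] A S show ?thesis
      by (simp add: N1.emeasure_eq_measure N2.emeasure_eq_measure)
  qed
  show "range (\<lambda>n::nat. \<Pi>\<^sub>E i\<in>I. UNIV) \<subseteq> prod_algebra I (\<lambda>_. borel)"
    by (auto intro!: prod_algebraI_finite I)
  show "emeasure N1 (\<Pi>\<^sub>E i\<in>I. UNIV) \<noteq> \<infinity>"
    by (simp add: N1.emeasure_eq_measure)
qed (auto simp: space_PiM)

subsection \<open>Normal laws and elementary Wiener integrals\<close>

text \<open>The affine image of a standard normal variable covers the point mass as well, since its
  scale factor vanishes for \<open>v = 0\<close>. Later computations thus need no case distinction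
  on the variance.\<close>

lemma normal_law_eq_distr:
  assumes "v \<ge> 0"
  shows "normal_law \<mu> v = distr std_normal_distribution borel (\<lambda>x. \<mu> + sqrt v * x)"
proof (cases "v = 0")
  case True
  interpret prob_space std_normal_distribution
    by (rule prob_space_normal_density) simp
  show ?thesis using True distr_const[of \<mu> borel] by (simp add: normal_law_def)
next
  case False
  with assms have v: "v > 0" by simp
  interpret prob_space std_normal_distribution
    by (rule prob_space_normal_density) simp
  have "distributed std_normal_distribution lborel (\<lambda>x. x) std_normal_density"
    by (auto simp: distributed_def intro!: measure_eqI simp: emeasure_distr)
  from normal_density_affine[OF this, of "sqrt v" \<mu>] v
  have "distr std_normal_distribution lborel (\<lambda>x. \<mu> + sqrt v * x) = density lborel (normal_density \<mu> (sqrt v))"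
    by (simp add: distributed_def)
  moreover have "distr std_normal_distribution lborel (\<lambda>x. \<mu> + sqrt v * x) =
      distr std_normal_distribution borel (\<lambda>x. \<mu> + sqrt v * x)"
    by (rule distr_cong) auto
  ultimately show ?thesis using v by (simp add: normal_law_def)
qed

lemma real_distribution_normal_law:
  assumes "v \<ge> 0"
  shows "real_distribution (normal_law \<mu> v)"
proof -
  interpret prob_space std_normal_distribution
    by (rule prob_space_normal_density) simp
  show ?thesis unfolding normal_law_eq_distr[OF assms] by (rule real_distribution_distr) simp
qed

lemma char_normal_law:
  assumes "v \<ge> 0"
  shows "char (normal_law \<mu> v) t = iexp (t * \<mu>) * of_real (exp (- (v * t\<^sup>2) / 2))"
proof -
  have "char (normal_law \<mu> v) t = (CLINT x|std_normal_distribution. iexp (t * \<mu>) * iexp ((t * sqrt v) * x))"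
    unfolding normal_law_eq_distr[OF assms] char_def
    by (subst integral_distr) (auto simp: algebra_simps exp_add intro!: Bochner_Integration.integral_cong)
  also have "\<dots> = iexp (t * \<mu>) * char std_normal_distribution (t * sqrt v)"
    by (simp add: char_def)
  finally show ?thesis using assms
    by (simp add: char_std_normal_distribution power_mult_distrib mult.commute)
qed

lemma distr_eq_normal_lawI:
  assumes "prob_space M" "X \<in> borel_measurable M" "v \<ge> 0"
    and "\<And>t. char (distr M borel X) t = iexp (t * \<mu>) * of_real (exp (- (v * t\<^sup>2) / 2))"
  shows "distr M borel X = normal_law \<mu> v"
proof -
  interpret prob_space M by fact
  show ?thesis using assms
    by (intro Levy_uniqueness real_distribution_normal_law real_distribution_distr ext)
      (auto simp: char_normal_law)
qed

lemma normal_law_moments: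
  assumes [measurable]: "X \<in> borel_measurable M" and v: "v \<ge> 0" and X: "distr M borel X = normal_law 0 v"
  shows "integrable M X" "integral\<^sup>L M X = 0" "integrable M (\<lambda>\<omega>. (X \<omega>)\<^sup>2)" "(\<integral>\<omega>. (X \<omega>)\<^sup>2 \<partial>M) = v"
proof -
  note eq = X[unfolded normal_law_eq_distr[OF v]]
  have 1: "has_bochner_integral std_normal_distribution (\<lambda>x. x) 0"
    using std_normal_moment_odd[of 0] by (simp add: has_bochner_integral_density)
  have 2: "has_bochner_integral std_normal_distribution (\<lambda>x. x\<^sup>2) 1"
    using std_normal_moment_even[of 1] by (simp add: has_bochner_integral_density fact_2)
  have *: "integrable M (\<lambda>\<omega>. g (X \<omega>)) = integrable std_normal_distribution (\<lambda>x. g (sqrt v * x))"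
      "(\<integral>\<omega>. g (X \<omega>) \<partial>M) = (\<integral>x. g (sqrt v * x) \<partial>std_normal_distribution)"
    if [measurable]: "g \<in> borel_measurable borel" for g :: "real \<Rightarrow> real"
    using arg_cong[OF eq, of "\<lambda>N. integrable N g"] arg_cong[OF eq, of "\<lambda>N. integral\<^sup>L N g"]
    by (simp_all add: integrable_distr_eq integral_distr)
  have "integrable std_normal_distribution (\<lambda>x. sqrt v * x)"
    using integrable.intros[OF 1] by (rule integrable_mult_right)
  then show "integrable M X" by (subst *(1)[of "\<lambda>x. x"]) auto
  have "(\<integral>x. sqrt v * x \<partial>std_normal_distribution) = 0"
    using has_bochner_integral_integral_eq[OF 1] by (subst integral_mult_right_zero) simp
  then show "integral\<^sup>L M X = 0" by (subst *(2)[of "\<lambda>x. x"]) auto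
  have e: "(sqrt v * x)\<^sup>2 = v * x\<^sup>2" for x
    using v by (simp add: power_mult_distrib)
  have "integrable std_normal_distribution (\<lambda>x. (sqrt v * x)\<^sup>2)"
    unfolding e using integrable.intros[OF 2] by (rule integrable_mult_right)
  then show "integrable M (\<lambda>\<omega>. (X \<omega>)\<^sup>2)" by (subst *(1)[of "\<lambda>x. x\<^sup>2"]) auto
  have "(\<integral>x. (sqrt v * x)\<^sup>2 \<partial>std_normal_distribution) = v"
    unfolding e using has_bochner_integral_integral_eq[OF 2] by (subst integral_mult_right_zero) simp
  then show "(\<integral>\<omega>. (X \<omega>)\<^sup>2 \<partial>M) = v" by (subst *(2)[of "\<lambda>x. x\<^sup>2"]) auto
qed

lemma char_distr_mult:
  assumes [measurable]: "X \<in> borel_measurable M"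
  shows "char (distr M borel (\<lambda>\<omega>. c * X \<omega>)) t = char (distr M borel X) (c * t)"
  unfolding char_def by (simp add: integral_distr mult_ac)

section \<open>Laws of increments and of integrals of step functions\<close>

context
  fixes M :: "'w measure" and B :: "real \<Rightarrow> 'w \<Rightarrow> real"
  assumes W: "wiener_process M B"
begin

lemma wiener_prob_space: "prob_space M"
  using W by (simp add: wiener_process_def)

lemma wiener_measurable: "t \<ge> 0 \<Longrightarrow> B t \<in> borel_measurable M"
  using W by (simp add: wiener_process_def)

text \<open>Partitions may repeat points, so the increment over an empty interval must be included;
  \<open>wiener_process\<close> prescribes the law only for \<open>s < t\<close>, and the case
  \<open>s = t\<close> is a point mass at 0.\<close>

lemma wiener_increment_char:
  assumes "0 \<le> s" "s \<le> t"
  shows "char (distr M borel (\<lambda>\<omega>. B t \<omega> - B s \<omega>)) x = of_real (exp (- ((t - s) * x\<^sup>2) / 2))"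
proof (cases "s = t")
  case True
  interpret prob_space M by (rule wiener_prob_space)
  show ?thesis using True by (simp add: char_def distr_const integral_return)
next
  case False
  with assms W have "distributed M lborel (\<lambda>\<omega>. B t \<omega> - B s \<omega>) (normal_density 0 (sqrt (t - s)))"
    by (simp add: wiener_process_def)
  then have "distr M lborel (\<lambda>\<omega>. B t \<omega> - B s \<omega>) = normal_law 0 (t - s)"
    using False assms by (simp add: distributed_def normal_law_def)
  moreover have "distr M lborel (\<lambda>\<omega>. B t \<omega> - B s \<omega>) = distr M borel (\<lambda>\<omega>. B t \<omega> - B s \<omega>)"
    by (rule distr_cong) auto
  ultimately show ?thesis using assms by (simp add: char_normal_law)
qed

text \<open>Independence of the increments makes the characteristic function a product of Gaussian
  factors, whose exponents add up to the stated variance.\<close>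

lemma step_integral_normal:
  assumes p: "0 \<le> p 0" "\<And>k. k < N \<Longrightarrow> p k \<le> p (Suc k)"
  shows "distr M borel (step_integral B N p c) = normal_law 0 (\<Sum>k<N. (c k)\<^sup>2 * (p (Suc k) - p k))"
proof -
  interpret prob_space M by (rule wiener_prob_space)
  have p0: "k \<le> N \<Longrightarrow> 0 \<le> p k" for k
    using p by (induction k) (auto intro: order_trans)
  have meas: "(\<lambda>\<omega>. B (p (Suc k)) \<omega> - B (p k) \<omega>) \<in> borel_measurable M" if "k < N" for k
    using that p0[of k] p0[of "Suc k"] by (intro borel_measurable_diff wiener_measurable) auto
  have "indep_vars (\<lambda>_. borel) (\<lambda>k \<omega>. B (p (Suc k)) \<omega> - B (p k) \<omega>) {..<N}"
    using W p by (simp add: wiener_process_def)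
  then have ind: "indep_vars (\<lambda>_. borel) (\<lambda>k \<omega>. c k * (B (p (Suc k)) \<omega> - B (p k) \<omega>)) {..<N}"
    by (rule indep_vars_compose2) auto
  show ?thesis
  proof (rule distr_eq_normal_lawI)
    show "step_integral B N p c \<in> borel_measurable M"
      unfolding step_integral_def[abs_def] using meas by (intro borel_measurable_sum borel_measurable_times) auto
    show "0 \<le> (\<Sum>k<N. (c k)\<^sup>2 * (p (Suc k) - p k))"
      using p by (intro sum_nonneg) auto
    show "char (distr M borel (step_integral B N p c)) t =
        iexp (t * 0) * of_real (exp (- ((\<Sum>k<N. (c k)\<^sup>2 * (p (Suc k) - p k)) * t\<^sup>2) / 2))" for t
    proof -
      have "char (distr M borel (step_integral B N p c)) t =
          (\<Prod>k<N. char (distr M borel (\<lambda>\<omega>. c k * (B (p (Suc k)) \<omega> - B (p k) \<omega>))) t)"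
        unfolding step_integral_def[abs_def] by (rule char_distr_sum[OF ind])
      also have "\<dots> = (\<Prod>k<N. of_real (exp (- ((c k)\<^sup>2 * (p (Suc k) - p k) * t\<^sup>2) / 2)))"
        using p p0 meas by (intro prod.cong) (auto simp: char_distr_mult wiener_increment_char power_mult_distrib mult_ac)
      also have "\<dots> = of_real (exp (- ((\<Sum>k<N. (c k)\<^sup>2 * (p (Suc k) - p k)) * t\<^sup>2) / 2))"
        by (simp add: exp_sum[symmetric] sum_distrib_right sum_negf sum_divide_distrib flip: of_real_prod)
      finally show ?thesis by simp
    qed
  qed (rule wiener_prob_space)
qed

end

text \<open>The cells are disjoint, so cross terms vanish. In the induction the new cell begins at
  \<open>p N\<close>, to the left of which all earlier cells end.\<close>

lemma step_function_power2:
  assumes "\<And>k. k < N \<Longrightarrow> p k \<le> p (Suc k)"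
  shows "(step_function N p c u)\<^sup>2 = step_function N p (\<lambda>k. (c k)\<^sup>2) u"
  using assms
proof (induction N)
  case (Suc N)
  have "p k \<le> p N" if "k \<le> N" for k
    using that by (induction rule: inc_induct) (auto intro: order_trans[OF Suc.prems])
  then have "step_function N p c u * indicator {p N<..p (Suc N)} u = 0"
    by (auto simp: step_function_def sum_distrib_right indicator_def less_le_trans intro!: sum.neutral)
      (metis Suc_leI leD order.trans)
  with Suc show ?case by (simp add: step_function_def power2_sum power_mult_distrib algebra_simps) (simp add: indicator_def)
qed (simp add: step_function_def)

lemma has_integral_step_function_power2:
  assumes p: "\<And>k. k < N \<Longrightarrow> p k \<le> p (Suc k)"
  shows "has_bochner_integral lborel (\<lambda>u. (step_function N p c u)\<^sup>2) (\<Sum>k<N. (c k)\<^sup>2 * (p (Suc k) - p k))"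
proof -
  have sq: "(step_function N p c u)\<^sup>2 = step_function N p (\<lambda>k. (c k)\<^sup>2) u" for u
    by (rule step_function_power2) (rule p)
  have "has_bochner_integral lborel (indicator {p k<..p (Suc k)} :: real \<Rightarrow> real) (p (Suc k) - p k)" if "k < N" for k
    using has_bochner_integral_real_indicator[of "{p k<..p (Suc k)}" lborel] p[OF that] by simp
  then show ?thesis
    unfolding sq unfolding step_function_def by (intro has_bochner_integral_sum has_bochner_integral_mult_right) auto
qed

text \<open>
  Coding a step function by the jumps \<open>z\<close> at a finite set of points \<open>P\<close> makes sums of step
  functions over different partitions trivial.
\<close>

definition elem_fun :: "real set \<Rightarrow> (real \<Rightarrow> real) \<Rightarrow> real \<Rightarrow> real" where
  "elem_fun P z u = (\<Sum>x\<in>P. z x * indicator {0<..x} u)"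

definition elem_integral :: "(real \<Rightarrow> 'w \<Rightarrow> real) \<Rightarrow> real set \<Rightarrow> (real \<Rightarrow> real) \<Rightarrow> 'w \<Rightarrow> real" where
  "elem_integral B P z \<omega> = (\<Sum>x\<in>P. z x * B x \<omega>)"

text \<open>Summation by parts. Adding a new largest point \<open>x\<close> appends a cell from
  \<open>p N\<close> to \<open>x\<close> with coefficient \<open>z x\<close> and raises all earlier
  coefficients by \<open>z x\<close>; the raised part telescopes to \<open>\<phi> (p N)\<close>
  because \<open>p 0 = 0\<close> and \<open>\<phi> 0 = 0\<close>. The coefficients do not depend on
  \<open>\<phi>\<close>, so one partition serves the indicator functions and the paths of the Wiener
  process alike.\<close>

lemma ex_sorted_partition:
  fixes z :: "real \<Rightarrow> real"
  assumes "finite P" "P \<subseteq> {0..}"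
  shows "\<exists>N p c. p 0 = 0 \<and> (\<forall>k<N. p k \<le> p (Suc k)) \<and> p N \<in> insert 0 P \<and>
    (\<forall>\<phi> :: real \<Rightarrow> real. \<phi> 0 = 0 \<longrightarrow> (\<Sum>x\<in>P. z x * \<phi> x) = (\<Sum>k<N. c k * (\<phi> (p (Suc k)) - \<phi> (p k))))"
  using assms
proof (induction P rule: finite_linorder_max_induct)
  case empty
  show ?case by (intro exI[of _ 0] exI[of _ "\<lambda>_. 0"]) auto
next
  case (insert x P)
  then obtain N p c where p: "p 0 = 0" "\<And>k. k < N \<Longrightarrow> p k \<le> p (Suc k)" "p N \<in> insert 0 P"
    and c: "\<And>\<phi> :: real \<Rightarrow> real. \<phi> 0 = 0 \<Longrightarrow> (\<Sum>x\<in>P. z x * \<phi> x) = (\<Sum>k<N. c k * (\<phi> (p (Suc k)) - \<phi> (p k)))"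
    by auto
  have x: "x \<notin> P" "p N \<le> x" "0 \<le> x" using insert.hyps insert.prems p(3) by (auto intro: less_imp_le)
  define p' where "p' = p(Suc N := x)"
  define c' where "c' k = (if k < N then c k + z x else z x)" for k
  have "(\<Sum>y\<in>insert x P. z y * \<phi> y) = (\<Sum>k<Suc N. c' k * (\<phi> (p' (Suc k)) - \<phi> (p' k)))"
    if "\<phi> 0 = 0" for \<phi> :: "real \<Rightarrow> real"
  proof -
    have "(\<Sum>k<Suc N. c' k * (\<phi> (p' (Suc k)) - \<phi> (p' k))) =
        (\<Sum>k<N. c k * (\<phi> (p (Suc k)) - \<phi> (p k))) + z x * (\<Sum>k<N. \<phi> (p (Suc k)) - \<phi> (p k)) + z x * (\<phi> x - \<phi> (p N))"
      by (simp add: p'_def c'_def algebra_simps sum.distrib sum_distrib_left sum_subtractf)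
    also have "(\<Sum>k<N. \<phi> (p (Suc k)) - \<phi> (p k)) = \<phi> (p N)"
      using sum_lessThan_telescope[of "\<lambda>k. \<phi> (p k)" N] p(1) that by simp
    finally show ?thesis using c[of \<phi>, OF that] insert.hyps x by (simp add: algebra_simps)
  qed
  then show ?case using p x
    by (intro exI[of _ "Suc N"] exI[of _ p'] exI[of _ c']) (auto simp: p'_def less_Suc_eq)
qed

text \<open>\<open>ex_sorted_partition\<close> is used for two functions \<open>\<phi>\<close>: for
  \<open>x\<close> mapped to the indicator of \<open>{0<..x}\<close> it gives an identity of
  integrands, for \<open>x\<close> mapped to \<open>B x \<omega>\<close> one of integrals. The
  second holds only almost surely, as \<open>B 0\<close> vanishes only almost surely.\<close>

lemma elem_normal:
  assumes W: "wiener_process M B" and P: "finite P" "P \<subseteq> {0..}"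
  shows "integrable lborel (\<lambda>u. (elem_fun P z u)\<^sup>2)"
    and "distr M borel (elem_integral B P z) = normal_law 0 (\<integral>u. (elem_fun P z u)\<^sup>2 \<partial>lborel)"
proof -
  obtain N p c where p: "p 0 = 0" "\<And>k. k < N \<Longrightarrow> p k \<le> p (Suc k)"
    and c: "\<And>\<phi> :: real \<Rightarrow> real. \<phi> 0 = 0 \<Longrightarrow> (\<Sum>x\<in>P. z x * \<phi> x) = (\<Sum>k<N. c k * (\<phi> (p (Suc k)) - \<phi> (p k)))"
    using ex_sorted_partition[OF P, of z] by metis
  have p0: "k \<le> N \<Longrightarrow> 0 \<le> p k" for k
    using p by (induction k) (auto intro: order_trans)
  have f: "elem_fun P z = step_function N p c"
  proof
    fix u
    have "indicator {0<..p (Suc k)} u - indicator {0<..p k} u = (indicator {p k<..p (Suc k)} u :: real)" if "k < N" for k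
      using p0[of k] p(2)[OF that] that by (auto simp: indicator_def)
    moreover have "elem_fun P z u = (\<Sum>k<N. c k * (indicator {0<..p (Suc k)} u - indicator {0<..p k} u))"
      unfolding elem_fun_def by (rule c) simp
    ultimately show "elem_fun P z u = step_function N p c u"
      by (simp add: step_function_def)
  qed
  have int: "has_bochner_integral lborel (\<lambda>u. (elem_fun P z u)\<^sup>2) (\<Sum>k<N. (c k)\<^sup>2 * (p (Suc k) - p k))"
    unfolding f by (rule has_integral_step_function_power2) (rule p(2))
  then show "integrable lborel (\<lambda>u. (elem_fun P z u)\<^sup>2)" by (rule integrable.intros)
  have [measurable]: "B x \<in> borel_measurable M" if "x \<ge> 0" for x
    using wiener_measurable[OF W that] .
  have "AE \<omega> in M. B 0 \<omega> = 0" using W by (simp add: wiener_process_def)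
  then have "AE \<omega> in M. elem_integral B P z \<omega> = step_integral B N p c \<omega>"
    by eventually_elim (simp add: elem_integral_def step_integral_def c[of "\<lambda>x. B x _"])
  then have "distr M borel (elem_integral B P z) = distr M borel (step_integral B N p c)"
    using P p0 unfolding elem_integral_def[abs_def] step_integral_def[abs_def]
    by (intro distr_cong_AE borel_measurable_sum borel_measurable_times borel_measurable_diff) auto
  also have "\<dots> = normal_law 0 (\<integral>u. (elem_fun P z u)\<^sup>2 \<partial>lborel)"
    using step_integral_normal[OF W, of p N c] p has_bochner_integral_integral_eq[OF int] by simp
  finally show "distr M borel (elem_integral B P z) = normal_law 0 (\<integral>u. (elem_fun P z u)\<^sup>2 \<partial>lborel)" .
qed

subsection \<open>Wiener integrals of deterministic functions\<close>

text \<open>A crude triangle inequality for squared L2 distances, from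
  \<open>(x + y)^2 \<le> 2 x^2 + 2 y^2\<close>. The factor 2 does no harm, because the errors it is
  applied to can be made arbitrarily small.\<close>

lemma nn_integral_power2_add_le:
  assumes [measurable]: "F \<in> borel_measurable M" "G \<in> borel_measurable M"
    and F: "(\<integral>\<^sup>+x. ennreal ((F x)\<^sup>2) \<partial>M) \<le> ennreal \<alpha>" "0 \<le> \<alpha>"
    and G: "(\<integral>\<^sup>+x. ennreal ((G x)\<^sup>2) \<partial>M) \<le> ennreal \<beta>" "0 \<le> \<beta>"
  shows "(\<integral>\<^sup>+x. ennreal ((F x + G x)\<^sup>2) \<partial>M) \<le> ennreal (2 * \<alpha> + 2 * \<beta>)"
proof -
  have "(F x + G x)\<^sup>2 \<le> 2 * (F x)\<^sup>2 + 2 * (G x)\<^sup>2" for x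
    using sum_squares_bound[of "F x" "G x"] by (simp add: power2_sum)
  then have "(\<integral>\<^sup>+x. ennreal ((F x + G x)\<^sup>2) \<partial>M) \<le> (\<integral>\<^sup>+x. 2 * ennreal ((F x)\<^sup>2) + 2 * ennreal ((G x)\<^sup>2) \<partial>M)"
    by (intro nn_integral_mono) (simp add: ennreal_leI flip: ennreal_plus ennreal_numeral ennreal_mult)
  also have "\<dots> = 2 * (\<integral>\<^sup>+x. ennreal ((F x)\<^sup>2) \<partial>M) + 2 * (\<integral>\<^sup>+x. ennreal ((G x)\<^sup>2) \<partial>M)"
    by (simp add: nn_integral_add nn_integral_cmult)
  also have "\<dots> \<le> 2 * ennreal \<alpha> + 2 * ennreal \<beta>"
    using F G by (intro add_mono mult_left_mono) auto
  also have "\<dots> = ennreal (2 * \<alpha> + 2 * \<beta>)"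
    using F G by (simp add: ennreal_mult flip: ennreal_numeral)
  finally show ?thesis .
qed

lemma integrable_power2_of_nn:
  assumes [measurable]: "F \<in> borel_measurable M"
    and "(\<integral>\<^sup>+x. ennreal ((F x)\<^sup>2) \<partial>M) \<le> ennreal e" "0 \<le> e"
  shows "integrable M (\<lambda>x. (F x)\<^sup>2)" "(\<integral>x. (F x)\<^sup>2 \<partial>M) \<le> e"
proof -
  show i: "integrable M (\<lambda>x. (F x)\<^sup>2)"
    using assms by (intro integrableI_bounded) (auto intro: le_less_trans)
  show "(\<integral>x. (F x)\<^sup>2 \<partial>M) \<le> e"
    using assms(2,3) nn_integral_eq_integral[OF i] by simp
qed

lemma integrable_power2_add:
  fixes F G :: "'a \<Rightarrow> real"
  assumes [measurable]: "F \<in> borel_measurable M" "G \<in> borel_measurable M"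
    and "integrable M (\<lambda>x. (F x)\<^sup>2)" "integrable M (\<lambda>x. (G x)\<^sup>2)"
  shows "integrable M (\<lambda>x. (F x + G x)\<^sup>2)"
proof (rule Bochner_Integration.integrable_bound)
  show "integrable M (\<lambda>x. 2 * (F x)\<^sup>2 + 2 * (G x)\<^sup>2)" using assms by simp
  show "AE x in M. norm ((F x + G x)\<^sup>2) \<le> norm (2 * (F x)\<^sup>2 + 2 * (G x)\<^sup>2)"
  proof (rule AE_I2)
    fix x
    have "(F x + G x)\<^sup>2 \<le> 2 * (F x)\<^sup>2 + 2 * (G x)\<^sup>2"
      using sum_squares_bound[of "F x" "G x"] by (simp add: power2_sum)
    then show "norm ((F x + G x)\<^sup>2) \<le> norm (2 * (F x)\<^sup>2 + 2 * (G x)\<^sup>2)" by simp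
  qed
qed measurable

lemma borel_measurable_elem_fun [measurable]: "elem_fun P z \<in> borel_measurable borel"
  unfolding elem_fun_def[abs_def] by measurable

lemma borel_measurable_elem_integral:
  assumes "wiener_process M B" "P \<subseteq> {0..}"
  shows "elem_integral B P z \<in> borel_measurable M"
  unfolding elem_integral_def[abs_def] using assms wiener_measurable[OF assms(1)]
  by (intro borel_measurable_sum borel_measurable_times) auto

text \<open>
  \<open>wint M B f X\<close>: the random variable \<open>X\<close> is a version of the Wiener integral of the square
  integrable function \<open>f\<close> over the whole line.
\<close>

definition wint :: "'w measure \<Rightarrow> (real \<Rightarrow> 'w \<Rightarrow> real) \<Rightarrow> (real \<Rightarrow> real) \<Rightarrow> ('w \<Rightarrow> real) \<Rightarrow> bool" where
  "wint M B f X \<longleftrightarrow> f \<in> borel_measurable borel \<and> X \<in> borel_measurable M \<and>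
     integrable lborel (\<lambda>u. (f u)\<^sup>2) \<and>
     (\<forall>e>0. \<exists>P z. finite P \<and> P \<subseteq> {0..} \<and>
        (\<integral>\<^sup>+u. ennreal ((f u - elem_fun P z u)\<^sup>2) \<partial>lborel) \<le> ennreal e \<and>
        (\<integral>\<^sup>+\<omega>. ennreal ((X \<omega> - elem_integral B P z \<omega>)\<^sup>2) \<partial>M) \<le> ennreal e)"

lemma wintD:
  assumes "wint M B f X"
  shows "f \<in> borel_measurable borel" "X \<in> borel_measurable M" "integrable lborel (\<lambda>u. (f u)\<^sup>2)"
  using assms by (auto simp: wint_def)

lemma wint_approx:
  assumes "wint M B f X" "e > 0"
  obtains P z where "finite P" "P \<subseteq> {0..}"
    "(\<integral>\<^sup>+u. ennreal ((f u - elem_fun P z u)\<^sup>2) \<partial>lborel) \<le> ennreal e"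
    "(\<integral>\<^sup>+\<omega>. ennreal ((X \<omega> - elem_integral B P z \<omega>)\<^sup>2) \<partial>M) \<le> ennreal e"
  using assms unfolding wint_def by blast

lemma wint_add:
  assumes W: "wiener_process M B" and f: "wint M B f X" and g: "wint M B g Y"
  shows "wint M B (\<lambda>u. f u + g u) (\<lambda>\<omega>. X \<omega> + Y \<omega>)"
  unfolding wint_def
proof (intro conjI allI impI)
  note [measurable] = wintD(1,2)[OF f] wintD(1,2)[OF g]
  show "(\<lambda>u. f u + g u) \<in> borel_measurable borel" "(\<lambda>\<omega>. X \<omega> + Y \<omega>) \<in> borel_measurable M" by measurable
  show "integrable lborel (\<lambda>u. (f u + g u)\<^sup>2)"
    using wintD(3)[OF f] wintD(3)[OF g] by (intro integrable_power2_add) simp_all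
  fix e :: real assume "e > 0"
  \<comment> \<open>Two errors of \<open>e / 4\<close>, each doubled by
    \<open>nn_integral_power2_add_le\<close>, add up to \<open>e\<close>.\<close>
  then have e: "e / 4 > 0" by simp
  obtain P z where P: "finite P" "P \<subseteq> {0..}"
    "(\<integral>\<^sup>+u. ennreal ((f u - elem_fun P z u)\<^sup>2) \<partial>lborel) \<le> ennreal (e/4)"
    "(\<integral>\<^sup>+\<omega>. ennreal ((X \<omega> - elem_integral B P z \<omega>)\<^sup>2) \<partial>M) \<le> ennreal (e/4)"
    by (rule wint_approx[OF f e])
  obtain Q w where Q: "finite Q" "Q \<subseteq> {0..}"
    "(\<integral>\<^sup>+u. ennreal ((g u - elem_fun Q w u)\<^sup>2) \<partial>lborel) \<le> ennreal (e/4)"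
    "(\<integral>\<^sup>+\<omega>. ennreal ((Y \<omega> - elem_integral B Q w \<omega>)\<^sup>2) \<partial>M) \<le> ennreal (e/4)"
    by (rule wint_approx[OF g e])
  \<comment> \<open>Both jump functions are extended by zero to the union of their supports and
    added; this is where coding by jumps spares a common refinement of partitions.\<close>
  define v where "v x = (if x \<in> P then z x else 0) + (if x \<in> Q then w x else 0)" for x
  have v: "(\<Sum>x\<in>P \<union> Q. v x * \<phi> x) = (\<Sum>x\<in>P. z x * \<phi> x) + (\<Sum>x\<in>Q. w x * \<phi> x)" for \<phi> :: "real \<Rightarrow> real"
  proof -
    have "(\<Sum>x\<in>P \<union> Q. v x * \<phi> x) = (\<Sum>x\<in>P \<union> Q. if x \<in> P then z x * \<phi> x else 0) + (\<Sum>x\<in>P \<union> Q. if x \<in> Q then w x * \<phi> x else 0)"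
      unfolding sum.distrib[symmetric] by (intro sum.cong) (auto simp: v_def algebra_simps)
    also have "\<dots> = (\<Sum>x\<in>P. z x * \<phi> x) + (\<Sum>x\<in>Q. w x * \<phi> x)"
      using P(1) Q(1) by (simp add: sum.If_cases Int_absorb1)
    finally show ?thesis .
  qed
  have [measurable]: "elem_integral B P z \<in> borel_measurable M" "elem_integral B Q w \<in> borel_measurable M"
    using borel_measurable_elem_integral[OF W] P Q by auto
  have "(\<integral>\<^sup>+u. ennreal (((f u - elem_fun P z u) + (g u - elem_fun Q w u))\<^sup>2) \<partial>lborel) \<le> ennreal (2 * (e/4) + 2 * (e/4))"
    by (rule nn_integral_power2_add_le) (use e P Q in auto)
  moreover have "(\<integral>\<^sup>+\<omega>. ennreal (((X \<omega> - elem_integral B P z \<omega>) + (Y \<omega> - elem_integral B Q w \<omega>))\<^sup>2) \<partial>M) \<le> ennreal (2 * (e/4) + 2 * (e/4))"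
    by (rule nn_integral_power2_add_le) (use e P Q in auto)
  ultimately show "\<exists>P z. finite P \<and> P \<subseteq> {0..} \<and>
        (\<integral>\<^sup>+u. ennreal ((f u + g u - elem_fun P z u)\<^sup>2) \<partial>lborel) \<le> ennreal e \<and>
        (\<integral>\<^sup>+\<omega>. ennreal ((X \<omega> + Y \<omega> - elem_integral B P z \<omega>)\<^sup>2) \<partial>M) \<le> ennreal e"
    using P(1,2) Q(1,2)
    by (intro exI[of _ "P \<union> Q"] exI[of _ v]) (simp add: elem_fun_def elem_integral_def v algebra_simps)
qed

lemma wint_cmult:
  assumes W: "wiener_process M B" and f: "wint M B f X"
  shows "wint M B (\<lambda>u. c * f u) (\<lambda>\<omega>. c * X \<omega>)"
  unfolding wint_def
proof (intro conjI allI impI)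
  note [measurable] = wintD(1,2)[OF f]
  show "(\<lambda>u. c * f u) \<in> borel_measurable borel" "(\<lambda>\<omega>. c * X \<omega>) \<in> borel_measurable M" by measurable
  show "integrable lborel (\<lambda>u. (c * f u)\<^sup>2)"
    using wintD(3)[OF f] by (simp add: power_mult_distrib)
  fix e :: real assume "e > 0"
  \<comment> \<open>Dividing by \<open>1 + c^2\<close> instead of \<open>c^2\<close> includes the
    case \<open>c = 0\<close>.\<close>
  then have e: "e / (1 + c\<^sup>2) > 0" by (simp add: add_pos_nonneg)
  obtain P z where P: "finite P" "P \<subseteq> {0..}"
    "(\<integral>\<^sup>+u. ennreal ((f u - elem_fun P z u)\<^sup>2) \<partial>lborel) \<le> ennreal (e / (1 + c\<^sup>2))"
    "(\<integral>\<^sup>+\<omega>. ennreal ((X \<omega> - elem_integral B P z \<omega>)\<^sup>2) \<partial>M) \<le> ennreal (e / (1 + c\<^sup>2))"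
    by (rule wint_approx[OF f e])
  have [measurable]: "elem_integral B P z \<in> borel_measurable M"
    using borel_measurable_elem_integral[OF W] P by auto
  have *: "(\<integral>\<^sup>+x. ennreal ((c * F x)\<^sup>2) \<partial>N) \<le> ennreal e"
    if [measurable]: "F \<in> borel_measurable N" and le: "(\<integral>\<^sup>+x. ennreal ((F x)\<^sup>2) \<partial>N) \<le> ennreal (e / (1 + c\<^sup>2))" for F :: "'z \<Rightarrow> real" and N
  proof -
    have "(\<integral>\<^sup>+x. ennreal ((c * F x)\<^sup>2) \<partial>N) = ennreal (c\<^sup>2) * (\<integral>\<^sup>+x. ennreal ((F x)\<^sup>2) \<partial>N)"
      by (simp add: power_mult_distrib ennreal_mult nn_integral_cmult)
    also have "\<dots> \<le> ennreal (c\<^sup>2) * ennreal (e / (1 + c\<^sup>2))" by (intro mult_left_mono le) simp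
    also have "\<dots> = ennreal (c\<^sup>2 * (e / (1 + c\<^sup>2)))"
      using e by (intro ennreal_mult[symmetric]) auto
    also have "\<dots> \<le> ennreal e"
    proof (rule ennreal_leI)
      have "c\<^sup>2 * (e / (1 + c\<^sup>2)) \<le> (1 + c\<^sup>2) * (e / (1 + c\<^sup>2))" using e by (intro mult_right_mono) auto
      also have "\<dots> = e" by (simp add: add_nonneg_eq_0_iff)
      finally show "c\<^sup>2 * (e / (1 + c\<^sup>2)) \<le> e" .
    qed
    finally show ?thesis .
  qed
  have "(\<integral>\<^sup>+u. ennreal ((c * (f u - elem_fun P z u))\<^sup>2) \<partial>lborel) \<le> ennreal e"
      "(\<integral>\<^sup>+\<omega>. ennreal ((c * (X \<omega> - elem_integral B P z \<omega>))\<^sup>2) \<partial>M) \<le> ennreal e"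
    by (rule *; use P in simp)+
  moreover have "elem_fun P (\<lambda>x. c * z x) u = c * elem_fun P z u" for u
    by (simp add: elem_fun_def sum_distrib_left mult.assoc)
  moreover have "elem_integral B P (\<lambda>x. c * z x) \<omega> = c * elem_integral B P z \<omega>" for \<omega>
    by (simp add: elem_integral_def sum_distrib_left mult.assoc)
  ultimately show "\<exists>P z. finite P \<and> P \<subseteq> {0..} \<and>
        (\<integral>\<^sup>+u. ennreal ((c * f u - elem_fun P z u)\<^sup>2) \<partial>lborel) \<le> ennreal e \<and>
        (\<integral>\<^sup>+\<omega>. ennreal ((c * X \<omega> - elem_integral B P z \<omega>)\<^sup>2) \<partial>M) \<le> ennreal e"
    using P(1,2)
    by (intro exI[of _ P] exI[of _ "\<lambda>x. c * z x"]) (simp add: right_diff_distrib)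
qed

lemma wint_diff:
  assumes "wiener_process M B" "wint M B f X" "wint M B g Y"
  shows "wint M B (\<lambda>u. f u - g u) (\<lambda>\<omega>. X \<omega> - Y \<omega>)"
  using wint_add[OF assms(1,2) wint_cmult[OF assms(1,3), of "-1"]] by simp

lemma wint_zero: "wint M B (\<lambda>_. 0) (\<lambda>_. 0)"
  unfolding wint_def by (auto intro!: exI[of _ "{}"] simp: elem_fun_def elem_integral_def)

lemma wint_sum:
  assumes W: "wiener_process M B" and "\<And>i. i \<in> I \<Longrightarrow> wint M B (f i) (X i)"
  shows "wint M B (\<lambda>u. \<Sum>i\<in>I. z i * f i u) (\<lambda>\<omega>. \<Sum>i\<in>I. z i * X i \<omega>)"
  using assms(2)
proof (induction I rule: infinite_finite_induct)
  case (insert i I)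
  then show ?case by (simp add: wint_add[OF W] wint_cmult[OF W])
qed (simp_all add: wint_zero)

lemma wint_AE_cong:
  assumes "wint M B f X" and [measurable]: "Y \<in> borel_measurable M" and eq: "AE \<omega> in M. X \<omega> = Y \<omega>"
  shows "wint M B f Y"
proof -
  have "(\<integral>\<^sup>+\<omega>. ennreal ((Y \<omega> - S \<omega>)\<^sup>2) \<partial>M) = (\<integral>\<^sup>+\<omega>. ennreal ((X \<omega> - S \<omega>)\<^sup>2) \<partial>M)" for S
    using eq by (intro nn_integral_cong_AE) auto
  then show ?thesis using assms by (simp add: wint_def)
qed

text \<open>
  The elementary bound \<open>2|xy| \<le> \<eta> x\<^sup>2 + y\<^sup>2/\<eta>\<close>, with an approximation error of order
  \<open>\<eta>\<^sup>2\<close>, replaces the Cauchy--Schwarz inequality.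
\<close>

lemma wint_normal:
  assumes W: "wiener_process M B" and f: "wint M B f X"
  shows "distr M borel X = normal_law 0 (\<integral>u. (f u)\<^sup>2 \<partial>lborel)"
proof (rule distr_eq_normal_lawI)
  interpret prob_space M by (rule wiener_prob_space[OF W])
  note [measurable] = wintD(1,2)[OF f]
  show "X \<in> borel_measurable M" "0 \<le> (\<integral>u. (f u)\<^sup>2 \<partial>lborel)" by auto
  define v where "v = (\<integral>u. (f u)\<^sup>2 \<partial>lborel)"
  define \<eta> :: "nat \<Rightarrow> real" where "\<eta> j = 1 / real (Suc j)" for j
  have \<eta>: "\<eta> j > 0" for j by (simp add: \<eta>_def)
  have \<eta>0: "\<eta> \<longlonglongrightarrow> 0" unfolding \<eta>_def by (rule LIMSEQ_Suc[OF lim_1_over_n])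
  define Q where "Q j P z \<longleftrightarrow> finite P \<and> P \<subseteq> {0..} \<and>
      (\<integral>\<^sup>+u. ennreal ((f u - elem_fun P z u)\<^sup>2) \<partial>lborel) \<le> ennreal ((\<eta> j)\<^sup>2) \<and>
      (\<integral>\<^sup>+\<omega>. ennreal ((X \<omega> - elem_integral B P z \<omega>)\<^sup>2) \<partial>M) \<le> ennreal ((\<eta> j)\<^sup>2)" for j P z
  have "\<exists>P z. Q j P z" for j
  proof -
    have "(\<eta> j)\<^sup>2 > 0" using \<eta>[of j] by simp
    then show ?thesis using f unfolding wint_def Q_def by blast
  qed
  then obtain P z where "\<And>j. Q j (P j) (z j)" by metis
  then have P: "\<And>j. finite (P j)" "\<And>j. P j \<subseteq> {0..}"
    and fP: "\<And>j. (\<integral>\<^sup>+u. ennreal ((f u - elem_fun (P j) (z j) u)\<^sup>2) \<partial>lborel) \<le> ennreal ((\<eta> j)\<^sup>2)"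
    and XP: "\<And>j. (\<integral>\<^sup>+\<omega>. ennreal ((X \<omega> - elem_integral B (P j) (z j) \<omega>)\<^sup>2) \<partial>M) \<le> ennreal ((\<eta> j)\<^sup>2)"
    by (simp_all add: Q_def)
  define s where "s j = elem_fun (P j) (z j)" for j
  define S where "S j = elem_integral B (P j) (z j)" for j
  have [measurable]: "s j \<in> borel_measurable borel" "S j \<in> borel_measurable M" for j
    using borel_measurable_elem_integral[OF W P(2)] by (auto simp: s_def S_def)
  define V where "V j = (\<integral>u. (s j u)\<^sup>2 \<partial>lborel)" for j
  have s2: "integrable lborel (\<lambda>u. (s j u)\<^sup>2)" and S: "distr M borel (S j) = normal_law 0 (V j)" for j
    unfolding s_def S_def V_def using elem_normal[OF W P(1)[of j] P(2)[of j]] by blast+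
  have f2: "integrable lborel (\<lambda>u. (f u)\<^sup>2)" using wintD(3)[OF f] .
  have fs: "integrable lborel (\<lambda>u. (f u - s j u)\<^sup>2)" "(\<integral>u. (f u - s j u)\<^sup>2 \<partial>lborel) \<le> (\<eta> j)\<^sup>2" for j
    using integrable_power2_of_nn[of "\<lambda>u. f u - s j u" lborel "(\<eta> j)\<^sup>2"] fP[of j] by (auto simp: s_def)
  have XS: "integrable M (\<lambda>\<omega>. (X \<omega> - S j \<omega>)\<^sup>2)" "(\<integral>\<omega>. (X \<omega> - S j \<omega>)\<^sup>2 \<partial>M) \<le> (\<eta> j)\<^sup>2" for j
    using integrable_power2_of_nn[of "\<lambda>u. X u - S j u" M "(\<eta> j)\<^sup>2"] XP[of j]
    by (simp_all add: S_def[symmetric])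
  have young: "2 * \<bar>x * y\<bar> \<le> \<eta> j * x\<^sup>2 + y\<^sup>2 / \<eta> j" for x y j
  proof -
    have "0 \<le> (\<eta> j * \<bar>x\<bar> - \<bar>y\<bar>)\<^sup>2 / \<eta> j" using \<eta>[of j] by simp
    also have "\<dots> = \<eta> j * x\<^sup>2 + y\<^sup>2 / \<eta> j - 2 * \<bar>x * y\<bar>"
      using \<eta>[of j] by (simp add: power2_diff abs_mult field_simps power2_eq_square)
    finally show ?thesis by simp
  qed
  have "V \<longlonglongrightarrow> v"
  proof (rule LIM_zero_cancel, rule Lim_null_comparison)
    show "\<forall>\<^sub>F j in sequentially. norm (V j - v) \<le> (\<eta> j)\<^sup>2 + \<eta> j + \<eta> j * v"
    proof (intro always_eventually allI)
      fix j
      have "V j - v = (\<integral>u. (s j u)\<^sup>2 - (f u)\<^sup>2 \<partial>lborel)" using s2 f2 by (simp add: V_def v_def)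
      also have "\<bar>\<dots>\<bar> \<le> (\<integral>u. \<bar>(s j u)\<^sup>2 - (f u)\<^sup>2\<bar> \<partial>lborel)"
        using integral_norm_bound[of lborel "\<lambda>u. (s j u)\<^sup>2 - (f u)\<^sup>2"] by simp
      also have "\<dots> \<le> (\<integral>u. (f u - s j u)\<^sup>2 + (\<eta> j * (f u)\<^sup>2 + (f u - s j u)\<^sup>2 / \<eta> j) \<partial>lborel)"
      proof (rule integral_mono)
        show "\<bar>(s j u)\<^sup>2 - (f u)\<^sup>2\<bar> \<le> (f u - s j u)\<^sup>2 + (\<eta> j * (f u)\<^sup>2 + (f u - s j u)\<^sup>2 / \<eta> j)" for u
        proof -
          have "(s j u)\<^sup>2 - (f u)\<^sup>2 = (f u - s j u)\<^sup>2 - 2 * (f u * (f u - s j u))"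
            by (simp add: power2_eq_square algebra_simps)
          then have "\<bar>(s j u)\<^sup>2 - (f u)\<^sup>2\<bar> \<le> (f u - s j u)\<^sup>2 + 2 * \<bar>f u * (f u - s j u)\<bar>"
            using zero_le_power2[of "f u - s j u"] by linarith
          then show ?thesis using young[of "f u" "f u - s j u" j] by linarith
        qed
      qed (use s2 f2 fs in auto)
      also have "\<dots> = (\<integral>u. (f u - s j u)\<^sup>2 \<partial>lborel) + (\<eta> j * v + (\<integral>u. (f u - s j u)\<^sup>2 \<partial>lborel) / \<eta> j)"
        using fs(1) f2 by (simp add: v_def)
      also have "\<dots> \<le> (\<eta> j)\<^sup>2 + (\<eta> j * v + (\<eta> j)\<^sup>2 / \<eta> j)"
        using fs(2)[of j] \<eta>[of j] by (intro add_mono divide_right_mono) auto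
      also have "\<dots> = (\<eta> j)\<^sup>2 + \<eta> j + \<eta> j * v" using \<eta>[of j] by (simp add: power2_eq_square)
      finally show "norm (V j - v) \<le> (\<eta> j)\<^sup>2 + \<eta> j + \<eta> j * v" by simp
    qed
    show "(\<lambda>j. (\<eta> j)\<^sup>2 + \<eta> j + \<eta> j * v) \<longlonglongrightarrow> 0"
      by (rule tendsto_eq_intros \<eta>0 refl | simp)+
  qed
  show "char (distr M borel X) t = iexp (t * 0) * of_real (exp (- ((\<integral>u. (f u)\<^sup>2 \<partial>lborel) * t\<^sup>2) / 2))" for t
  proof (rule LIMSEQ_unique)
    have "V j \<ge> 0" for j by (simp add: V_def)
    then have "char (distr M borel (S j)) t = of_real (exp (- (V j * t\<^sup>2) / 2))" for j
      by (simp add: S char_normal_law)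
    moreover have "(\<lambda>j. complex_of_real (exp (- (V j * t\<^sup>2) / 2))) \<longlonglongrightarrow> of_real (exp (- (v * t\<^sup>2) / 2))"
      by (intro tendsto_intros \<open>V \<longlonglongrightarrow> v\<close>) auto
    ultimately show "(\<lambda>j. char (distr M borel (S j)) t) \<longlonglongrightarrow> iexp (t * 0) * of_real (exp (- ((\<integral>u. (f u)\<^sup>2 \<partial>lborel) * t\<^sup>2) / 2))"
      by (simp add: v_def)
    show "(\<lambda>j. char (distr M borel (S j)) t) \<longlonglongrightarrow> char (distr M borel X) t"
    proof (rule LIM_zero_cancel, rule Lim_null_comparison)
      show "\<forall>\<^sub>F j in sequentially. norm (char (distr M borel (S j)) t - char (distr M borel X) t) \<le> \<bar>t\<bar> * \<eta> j"
      proof (intro always_eventually allI)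
        fix j
        have i: "integrable M (\<lambda>\<omega>. iexp (t * Y \<omega>))" if "Y \<in> borel_measurable M" for Y
          using that by (intro integrable_const_bound[where B=1]) auto
        have "char (distr M borel (S j)) t - char (distr M borel X) t = (\<integral>\<omega>. iexp (t * S j \<omega>) - iexp (t * X \<omega>) \<partial>M)"
          using i by (simp add: char_def integral_distr)
        also have "norm \<dots> \<le> (\<integral>\<omega>. norm (iexp (t * S j \<omega>) - iexp (t * X \<omega>)) \<partial>M)"
          by (rule integral_norm_bound)
        also have "\<dots> \<le> (\<integral>\<omega>. \<bar>t\<bar> / 2 * (\<eta> j + (X \<omega> - S j \<omega>)\<^sup>2 / \<eta> j) \<partial>M)"
        proof (rule integral_mono)
          show "norm (iexp (t * S j \<omega>) - iexp (t * X \<omega>)) \<le> \<bar>t\<bar> / 2 * (\<eta> j + (X \<omega> - S j \<omega>)\<^sup>2 / \<eta> j)" for \<omega>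
          proof -
            have "iexp (t * S j \<omega>) - iexp (t * X \<omega>) = iexp (t * S j \<omega>) * (1 - iexp (t * (X \<omega> - S j \<omega>)))"
              by (simp add: right_diff_distrib flip: exp_add)
            then have "norm (iexp (t * S j \<omega>) - iexp (t * X \<omega>)) = norm (iexp (t * (X \<omega> - S j \<omega>)) - 1)"
              by (simp add: norm_mult norm_minus_commute)
            also have "\<dots> \<le> \<bar>t * (X \<omega> - S j \<omega>)\<bar>"
              using iexp_approx1[of "t * (X \<omega> - S j \<omega>)" 0] by simp
            \<comment> \<open>The factor 1 is inserted so that \<open>young\<close> applies to the
              pair of 1 and \<open>X \<omega> - S j \<omega>\<close>.\<close>
            also have "\<dots> = \<bar>t\<bar> * \<bar>1 * (X \<omega> - S j \<omega>)\<bar>" by (simp add: abs_mult)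
            also have "\<dots> \<le> \<bar>t\<bar> * ((\<eta> j + (X \<omega> - S j \<omega>)\<^sup>2 / \<eta> j) / 2)"
              using young[of 1 "X \<omega> - S j \<omega>" j] by (intro mult_left_mono) auto
            finally show ?thesis by simp
          qed
          show "integrable M (\<lambda>\<omega>. norm (iexp (t * S j \<omega>) - iexp (t * X \<omega>)))"
            using i by (intro integrable_norm Bochner_Integration.integrable_diff) auto
        qed (use XS in auto)
        also have "\<dots> = \<bar>t\<bar> / 2 * (\<eta> j + (\<integral>\<omega>. (X \<omega> - S j \<omega>)\<^sup>2 \<partial>M) / \<eta> j)"
          using XS(1)[of j] by (simp add: prob_space)
        also have "\<dots> \<le> \<bar>t\<bar> / 2 * (\<eta> j + (\<eta> j)\<^sup>2 / \<eta> j)"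
          using XS(2)[of j] \<eta>[of j] by (intro mult_left_mono add_mono divide_right_mono) auto
        also have "\<dots> = \<bar>t\<bar> * \<eta> j" using \<eta>[of j] by (simp add: power2_eq_square)
        finally show "norm (char (distr M borel (S j)) t - char (distr M borel X) t) \<le> \<bar>t\<bar> * \<eta> j" .
      qed
      show "(\<lambda>j. \<bar>t\<bar> * \<eta> j) \<longlonglongrightarrow> 0" by (rule tendsto_eq_intros \<eta>0 refl | simp)+
    qed
  qed
qed (rule wiener_prob_space[OF W])

lemma wint_moments:
  assumes W: "wiener_process M B" and f: "wint M B f X"
  shows "integrable M X" "integral\<^sup>L M X = 0" "integrable M (\<lambda>\<omega>. (X \<omega>)\<^sup>2)"
    "(\<integral>\<omega>. (X \<omega>)\<^sup>2 \<partial>M) = (\<integral>u. (f u)\<^sup>2 \<partial>lborel)"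
  using normal_law_moments[OF wintD(2)[OF f] _ wint_normal[OF W f]] by simp_all

lemma wint_isometry:
  assumes W: "wiener_process M B" and f: "wint M B f X"
  shows "(\<integral>\<^sup>+\<omega>. ennreal ((X \<omega>)\<^sup>2) \<partial>M) = (\<integral>\<^sup>+u. ennreal ((f u)\<^sup>2) \<partial>lborel)"
  using wint_moments(3,4)[OF W f] wintD(3)[OF f] by (simp add: nn_integral_eq_integral)

text \<open>
  By the isometry the \<open>X n\<close> form an \<open>L\<^sup>2\<close>-Cauchy sequence, and Fatou's lemma shows that
  its almost sure limit is the limit in \<open>L\<^sup>2\<close> as well.
\<close>

lemma wint_limit:
  assumes W: "wiener_process M B" and fX: "\<And>n. wint M B (f n) (X n)"
    and [measurable]: "g \<in> borel_measurable borel" "Y \<in> borel_measurable M"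
    and g2: "integrable lborel (\<lambda>u. (g u)\<^sup>2)"
    and lim: "(\<lambda>n. \<integral>\<^sup>+u. ennreal ((f n u - g u)\<^sup>2) \<partial>lborel) \<longlonglongrightarrow> 0"
    and AE: "AE \<omega> in M. (\<lambda>n. X n \<omega>) \<longlonglongrightarrow> Y \<omega>"
  shows "wint M B g Y"
  unfolding wint_def
proof (intro conjI allI impI g2)
  have [measurable]: "f n \<in> borel_measurable borel" "X n \<in> borel_measurable M" for n
    using wintD[OF fX] by auto
  fix e :: real assume e: "e > 0"
  \<comment> \<open>The larger of the two final bounds is \<open>2 * (4 * d) + 2 * d\<close>, that
    is ten times \<open>d\<close>, and must stay below \<open>e\<close>.\<close>
  define d where "d = e / 16"
  have d: "d > 0" using e by (simp add: d_def)
  have "\<forall>\<^sub>F n in sequentially. (\<integral>\<^sup>+u. ennreal ((f n u - g u)\<^sup>2) \<partial>lborel) < ennreal d"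
    using order_tendstoD(2)[OF lim, of "ennreal d"] d by simp
  then obtain n where n: "\<And>m. m \<ge> n \<Longrightarrow> (\<integral>\<^sup>+u. ennreal ((f m u - g u)\<^sup>2) \<partial>lborel) \<le> ennreal d"
    unfolding eventually_sequentially by (auto intro: less_imp_le)
  have "(\<integral>\<^sup>+\<omega>. ennreal ((X n \<omega> - X m \<omega>)\<^sup>2) \<partial>M) \<le> ennreal (4 * d)" if m: "m \<ge> n" for m
  proof -
    have "(\<integral>\<^sup>+\<omega>. ennreal ((X n \<omega> - X m \<omega>)\<^sup>2) \<partial>M) = (\<integral>\<^sup>+u. ennreal (((f n u - g u) + (g u - f m u))\<^sup>2) \<partial>lborel)"
      using wint_isometry[OF W wint_diff[OF W fX[of n] fX[of m]]] by simp
    also have "\<dots> \<le> ennreal (2 * d + 2 * d)"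
      using n[OF order_refl] n[OF m] d by (intro nn_integral_power2_add_le) (auto simp: power2_commute)
    finally show ?thesis by simp
  qed
  then have "liminf (\<lambda>m. \<integral>\<^sup>+\<omega>. ennreal ((X n \<omega> - X m \<omega>)\<^sup>2) \<partial>M) \<le> ennreal (4 * d)"
    by (intro Liminf_le) (auto simp: eventually_sequentially)
  moreover have "(\<integral>\<^sup>+\<omega>. ennreal ((X n \<omega> - Y \<omega>)\<^sup>2) \<partial>M) = (\<integral>\<^sup>+\<omega>. liminf (\<lambda>m. ennreal ((X n \<omega> - X m \<omega>)\<^sup>2)) \<partial>M)"
  proof (rule nn_integral_cong_AE)
    show "AE \<omega> in M. ennreal ((X n \<omega> - Y \<omega>)\<^sup>2) = liminf (\<lambda>m. ennreal ((X n \<omega> - X m \<omega>)\<^sup>2))"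
      using AE
    proof eventually_elim
      case (elim \<omega>)
      have "(\<lambda>m. ennreal ((X n \<omega> - X m \<omega>)\<^sup>2)) \<longlonglongrightarrow> ennreal ((X n \<omega> - Y \<omega>)\<^sup>2)"
        by (intro tendsto_ennrealI tendsto_intros elim)
      then show ?case by (rule lim_imp_Liminf[OF sequentially_bot, symmetric])
    qed
  qed
  moreover have "(\<integral>\<^sup>+\<omega>. liminf (\<lambda>m. ennreal ((X n \<omega> - X m \<omega>)\<^sup>2)) \<partial>M) \<le>
      liminf (\<lambda>m. \<integral>\<^sup>+\<omega>. ennreal ((X n \<omega> - X m \<omega>)\<^sup>2) \<partial>M)"
    by (rule nn_integral_liminf) measurable
  ultimately have XY: "(\<integral>\<^sup>+\<omega>. ennreal ((Y \<omega> - X n \<omega>)\<^sup>2) \<partial>M) \<le> ennreal (4 * d)"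
    by (simp add: power2_commute)
  obtain P z where P: "finite P" "P \<subseteq> {0..}"
    "(\<integral>\<^sup>+u. ennreal ((f n u - elem_fun P z u)\<^sup>2) \<partial>lborel) \<le> ennreal d"
    "(\<integral>\<^sup>+\<omega>. ennreal ((X n \<omega> - elem_integral B P z \<omega>)\<^sup>2) \<partial>M) \<le> ennreal d"
    by (rule wint_approx[OF fX d])
  have [measurable]: "elem_integral B P z \<in> borel_measurable M"
    using borel_measurable_elem_integral[OF W] P by auto
  have "(\<integral>\<^sup>+u. ennreal (((g u - f n u) + (f n u - elem_fun P z u))\<^sup>2) \<partial>lborel) \<le> ennreal (2 * d + 2 * d)"
    using n[of n] P d by (intro nn_integral_power2_add_le) (auto simp: power2_commute)
  moreover have "(\<integral>\<^sup>+\<omega>. ennreal (((Y \<omega> - X n \<omega>) + (X n \<omega> - elem_integral B P z \<omega>))\<^sup>2) \<partial>M) \<le> ennreal (2 * (4 * d) + 2 * d)"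
    using XY P d by (intro nn_integral_power2_add_le) auto
  moreover have "ennreal (2 * d + 2 * d) \<le> ennreal e" "ennreal (2 * (4 * d) + 2 * d) \<le> ennreal e"
    using e by (auto simp: d_def intro!: ennreal_leI)
  ultimately show "\<exists>P z. finite P \<and> P \<subseteq> {0..} \<and>
        (\<integral>\<^sup>+u. ennreal ((g u - elem_fun P z u)\<^sup>2) \<partial>lborel) \<le> ennreal e \<and>
        (\<integral>\<^sup>+\<omega>. ennreal ((Y \<omega> - elem_integral B P z \<omega>)\<^sup>2) \<partial>M) \<le> ennreal e"
    using P(1,2) by (intro exI[of _ P] exI[of _ z]) (auto intro: order_trans)
qed measurable

text \<open>Passes from a partition back to jumps. The jump at \<open>x\<close> collects the
  coefficients of all cells ending at \<open>x\<close> minus those of all cells starting there;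
  summing over cells instead of inverting \<open>p\<close> accounts for partition points that
  coincide.\<close>

lemma ex_jumps_of_increments:
  fixes p c :: "nat \<Rightarrow> real"
  shows "\<exists>z. \<forall>\<phi> :: real \<Rightarrow> real. (\<Sum>x\<in>p ` {..N}. z x * \<phi> x) = (\<Sum>k<N. c k * (\<phi> (p (Suc k)) - \<phi> (p k)))"
proof (intro exI allI)
  fix \<phi> :: "real \<Rightarrow> real"
  define z where "z x = (\<Sum>k<N. c k * ((if x = p (Suc k) then 1 else 0) - (if x = p k then 1 else 0)))" for x
  have "(\<Sum>x\<in>p ` {..N}. z x * \<phi> x) =
      (\<Sum>k<N. \<Sum>x\<in>p ` {..N}. c k * ((if x = p (Suc k) then \<phi> x else 0) - (if x = p k then \<phi> x else 0)))"
    unfolding z_def sum_distrib_right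
    by (subst sum.swap) (auto intro!: sum.cong)
  also have "\<dots> = (\<Sum>k<N. c k * (\<phi> (p (Suc k)) - \<phi> (p k)))"
    by (intro sum.cong refl) (auto simp: sum_subtractf simp flip: sum_distrib_left)
  finally show "(\<Sum>x\<in>p ` {..N}. (\<lambda>x. \<Sum>k<N. c k * ((if x = p (Suc k) then 1 else 0) - (if x = p k then 1 else 0))) x * \<phi> x) =
      (\<Sum>k<N. c k * (\<phi> (p (Suc k)) - \<phi> (p k)))"
    unfolding z_def .
qed

text \<open>Puts integrals over different intervals \<open>[0,t]\<close> on the common footing of
  the whole line. The approximating step functions vanish outside \<open>[0,t]\<close>, so extending
  \<open>f\<close> by zero leaves the L2 distances unchanged; continuity of \<open>f\<close>
  provides measurability and square integrability.\<close>

lemma is_wiener_integral_wint: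
  assumes W: "wiener_process M B" and J: "is_wiener_integral M B f t J" and f: "continuous_on {0..t} f"
  shows "wint M B (\<lambda>u. indicator {0..t} u * f u) J"
  unfolding wint_def
proof (intro conjI allI impI)
  show "(\<lambda>u. indicator {0..t} u * f u) \<in> borel_measurable borel"
    using borel_measurable_continuous_on_indicator[OF _ f] by simp
  show "J \<in> borel_measurable M" using J by (simp add: is_wiener_integral_def)
  have "set_integrable lborel {0..t} (\<lambda>u. f u ^ 2)"
    using borel_integrable_atLeastAtMost'[of 0 t "\<lambda>u. f u ^ 2"] f by (auto intro!: continuous_intros)
  then show "integrable lborel (\<lambda>u. (indicator {0..t} u * f u)\<^sup>2)"
    unfolding set_integrable_def
    by (rule Bochner_Integration.integrable_cong[THEN iffD1, rotated 2]) (auto simp: indicator_def)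
  fix e :: real assume e: "e > 0"
  from J obtain N p c where p: "\<And>j. p j 0 = 0" "\<And>j. p j (N j) = t" "\<And>j k. k < N j \<Longrightarrow> p j k \<le> p j (Suc k)"
    and l1: "(\<lambda>j. \<integral>\<^sup>+u\<in>{0..t}. ennreal ((f u - step_function (N j) (p j) (c j) u)\<^sup>2) \<partial>lborel) \<longlonglongrightarrow> 0"
    and l2: "(\<lambda>j. \<integral>\<^sup>+\<omega>. ennreal ((J \<omega> - step_integral B (N j) (p j) (c j) \<omega>)\<^sup>2) \<partial>M) \<longlonglongrightarrow> 0"
    unfolding is_wiener_integral_def by blast
  have "\<forall>\<^sub>F j in sequentially.
      (\<integral>\<^sup>+u\<in>{0..t}. ennreal ((f u - step_function (N j) (p j) (c j) u)\<^sup>2) \<partial>lborel) < ennreal e \<and>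
      (\<integral>\<^sup>+\<omega>. ennreal ((J \<omega> - step_integral B (N j) (p j) (c j) \<omega>)\<^sup>2) \<partial>M) < ennreal e"
    using order_tendstoD(2)[OF l1, of "ennreal e"] order_tendstoD(2)[OF l2, of "ennreal e"] e
    by (auto intro: eventually_conj)
  then obtain j where
    j1: "(\<integral>\<^sup>+u\<in>{0..t}. ennreal ((f u - step_function (N j) (p j) (c j) u)\<^sup>2) \<partial>lborel) \<le> ennreal e" and
    j2: "(\<integral>\<^sup>+\<omega>. ennreal ((J \<omega> - step_integral B (N j) (p j) (c j) \<omega>)\<^sup>2) \<partial>M) \<le> ennreal e"
    using eventually_happens'[OF sequentially_bot] by (auto intro: less_imp_le)
  obtain z where z: "\<And>\<phi> :: real \<Rightarrow> real.
      (\<Sum>x\<in>p j ` {..N j}. z x * \<phi> x) = (\<Sum>k<N j. c j k * (\<phi> (p j (Suc k)) - \<phi> (p j k)))"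
    using ex_jumps_of_increments[of "p j" "N j" "c j"] by auto
  have mono: "p j k \<le> p j l" if "k \<le> l" "l \<le> N j" for k l
    using that
  proof (induction l rule: dec_induct)
    case (step n)
    then show ?case using p(3)[of n j] by simp
  qed simp
  have p0: "0 \<le> p j k" "p j k \<le> t" if "k \<le> N j" for k
    using mono[of 0 k] mono[of k "N j"] that p by auto
  have S: "elem_integral B (p j ` {..N j}) z = step_integral B (N j) (p j) (c j)"
    unfolding elem_integral_def[abs_def] step_integral_def[abs_def] by (intro ext z)
  have s: "elem_fun (p j ` {..N j}) z u = step_function (N j) (p j) (c j) u" for u
  proof -
    have "indicator {0<..p j (Suc k)} u - indicator {0<..p j k} u = (indicator {p j k<..p j (Suc k)} u :: real)" if "k < N j" for k
      using p0[of k] p(3)[OF that] that by (auto simp: indicator_def)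
    then show ?thesis unfolding elem_fun_def z step_function_def by (intro sum.cong) auto
  qed
  have "step_function (N j) (p j) (c j) u = 0" if "u \<notin> {0..t}" for u
    unfolding step_function_def
  proof (intro sum.neutral ballI)
    fix k assume k: "k \<in> {..<N j}"
    show "c j k * indicator {p j k<..p j (Suc k)} u = 0"
      using p0[of k] p0[of "Suc k"] that k by (auto simp: indicator_def)
  qed
  then have "(\<integral>\<^sup>+u. ennreal ((indicator {0..t} u * f u - elem_fun (p j ` {..N j}) z u)\<^sup>2) \<partial>lborel) =
      (\<integral>\<^sup>+u\<in>{0..t}. ennreal ((f u - step_function (N j) (p j) (c j) u)\<^sup>2) \<partial>lborel)"
    unfolding s by (intro nn_integral_cong) (auto simp: indicator_def)
  with j1 j2 S p0 show "\<exists>P z. finite P \<and> P \<subseteq> {0..} \<and>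
        (\<integral>\<^sup>+u. ennreal ((indicator {0..t} u * f u - elem_fun P z u)\<^sup>2) \<partial>lborel) \<le> ennreal e \<and>
        (\<integral>\<^sup>+\<omega>. ennreal ((J \<omega> - elem_integral B P z \<omega>)\<^sup>2) \<partial>M) \<le> ennreal e"
    by (intro exI[of _ "p j ` {..N j}"] exI[of _ z]) auto
qed

subsection \<open>Gauss laws of Wiener integrals\<close>

lemma gauss_law_unique:
  assumes I: "finite I" and N: "gauss_law I m C N1" "gauss_law I m C N2"
  shows "N1 = N2"
proof (rule cramer_wold[OF I])
  \<comment> \<open>The functional with all coefficients zero already has a normal law as image,
    which forces total mass one.\<close>
  have P: "prob_space N" if "gauss_law I m C N" for N
  proof -
    from that have S[measurable_cong]: "sets N = sets (Pi\<^sub>M I (\<lambda>_. borel))"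
      and "distr N borel (\<lambda>x. \<Sum>i\<in>I. 0 * x i) = normal_law (\<Sum>i\<in>I. 0 * m i) (\<Sum>i\<in>I. \<Sum>j\<in>I. 0 * C i j * 0)"
      unfolding gauss_law_def by (auto simp del: mult_zero_left mult_zero_right elim!: allE[of _ "\<lambda>_. 0"])
    then have "prob_space (distr N borel (\<lambda>x. \<Sum>i\<in>I. 0 * x i))"
      using real_distribution_normal_law[of 0 0] by (simp add: real_distribution_def)
    then show "prob_space N" by (rule prob_space_distrD[rotated]) measurable
  qed
  show "prob_space N1" "prob_space N2" using P N by auto
qed (use N in \<open>auto simp: gauss_law_def\<close>)

lemma normal_law_shift:
  assumes v: "v \<ge> 0"
  shows "distr (normal_law \<nu> v) borel (\<lambda>x. \<mu> + x) = normal_law (\<mu> + \<nu>) v"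
  unfolding normal_law_eq_distr[OF v] by (subst distr_distr) (auto simp: comp_def add.assoc)

text \<open>Polarisation: the product is recovered from the squares of \<open>F\<close>,
  \<open>G\<close> and \<open>F + G\<close>. It is applied both to random variables and to their
  kernels.\<close>

lemma integral_power2_add:
  fixes F G :: "'a \<Rightarrow> real"
  assumes [measurable]: "F \<in> borel_measurable M" "G \<in> borel_measurable M"
    and F: "integrable M (\<lambda>x. (F x)\<^sup>2)" and G: "integrable M (\<lambda>x. (G x)\<^sup>2)"
  shows "integrable M (\<lambda>x. F x * G x)"
    and "(\<integral>x. (F x + G x)\<^sup>2 \<partial>M) = (\<integral>x. (F x)\<^sup>2 \<partial>M) + 2 * (\<integral>x. F x * G x \<partial>M) + (\<integral>x. (G x)\<^sup>2 \<partial>M)"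
proof -
  have "(\<lambda>x. F x * G x) = (\<lambda>x. ((F x + G x)\<^sup>2 - (F x)\<^sup>2 - (G x)\<^sup>2) / 2)"
    by (simp add: power2_sum fun_eq_iff)
  moreover have "integrable M (\<lambda>x. ((F x + G x)\<^sup>2 - (F x)\<^sup>2 - (G x)\<^sup>2) / 2)"
    using F G by (intro integrable_divide Bochner_Integration.integrable_diff integrable_power2_add) auto
  ultimately show i: "integrable M (\<lambda>x. F x * G x)" by simp
  have "(\<integral>x. (F x + G x)\<^sup>2 \<partial>M) = (\<integral>x. (F x)\<^sup>2 + 2 * (F x * G x) + (G x)\<^sup>2 \<partial>M)"
    by (simp add: power2_sum algebra_simps)
  also have "\<dots> = (\<integral>x. (F x)\<^sup>2 \<partial>M) + 2 * (\<integral>x. F x * G x \<partial>M) + (\<integral>x. (G x)\<^sup>2 \<partial>M)"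
    using F G i by simp
  finally show "(\<integral>x. (F x + G x)\<^sup>2 \<partial>M) = (\<integral>x. (F x)\<^sup>2 \<partial>M) + 2 * (\<integral>x. F x * G x \<partial>M) + (\<integral>x. (G x)\<^sup>2 \<partial>M)" .
qed

lemma wint_integrable_mult:
  assumes "wint M B f X" "wint M B g Y"
  shows "integrable lborel (\<lambda>u. f u * g u)"
  using wintD[OF assms(1)] wintD[OF assms(2)] by (intro integral_power2_add) auto

lemma wint_measurable:
  assumes "wint M B f (\<lambda>\<omega>. X \<omega> - \<mu>)"
  shows "X \<in> borel_measurable M"
  using borel_measurable_add[OF wintD(2)[OF assms], of "\<lambda>_. \<mu>"] by simp

section \<open>Means, covariances and joint laws of Wiener integrals\<close>

context
  fixes M :: "'w measure" and B :: "real \<Rightarrow> 'w \<Rightarrow> real"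
  assumes W: "wiener_process M B"
begin

text \<open>The isometry holds for \<open>X\<close>, for \<open>Y\<close> and for
  \<open>X + Y\<close>, and polarisation on both sides yields the mixed term.\<close>

lemma wint_covariance:
  assumes f: "wint M B f X" and g: "wint M B g Y"
  shows "(\<integral>\<omega>. X \<omega> * Y \<omega> \<partial>M) = (\<integral>u. f u * g u \<partial>lborel)"
proof -
  note [measurable] = wintD(1,2)[OF f] wintD(1,2)[OF g]
  have "(\<integral>\<omega>. (X \<omega> + Y \<omega>)\<^sup>2 \<partial>M) = (\<integral>u. (f u + g u)\<^sup>2 \<partial>lborel)"
    using wint_moments[OF W wint_add[OF W f g]] by simp
  then show ?thesis
    using integral_power2_add(2)[of X M Y] integral_power2_add(2)[of f lborel g]
      wint_moments[OF W f] wint_moments[OF W g] wintD[OF f] wintD[OF g] by simp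
qed

lemma wint_normal_shift:
  assumes f: "wint M B f (\<lambda>\<omega>. X \<omega> - \<mu>)"
  shows "distr M borel X = normal_law \<mu> (\<integral>u. (f u)\<^sup>2 \<partial>lborel)"
proof -
  note [measurable] = wintD(2)[OF f]
  have "distr M borel X = distr (distr M borel (\<lambda>\<omega>. X \<omega> - \<mu>)) borel (\<lambda>x. \<mu> + x)"
    by (subst distr_distr) (auto simp: comp_def)
  then show ?thesis by (simp add: wint_normal[OF W f] normal_law_shift)
qed

lemma wint_mean:
  assumes f: "wint M B f (\<lambda>\<omega>. X \<omega> - \<mu>)"
  shows "mean M X = \<mu>"
proof -
  interpret prob_space M by (rule wiener_prob_space[OF W])
  have "integrable M (\<lambda>\<omega>. (X \<omega> - \<mu>) + \<mu>)"
    using wint_moments(1)[OF W f] by (intro Bochner_Integration.integrable_add) auto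
  then show ?thesis using wint_moments(2)[OF W f] by (simp add: mean_def prob_space)
qed

lemma wint_covariance_mean:
  assumes f: "wint M B f (\<lambda>\<omega>. X \<omega> - \<mu>)" and g: "wint M B g (\<lambda>\<omega>. Y \<omega> - \<nu>)"
  shows "covariance M X Y = (\<integral>u. f u * g u \<partial>lborel)"
  using wint_covariance[OF f g] by (simp add: covariance_def wint_mean[OF f] wint_mean[OF g])

lemma wint_linear_combination:
  assumes "\<And>i. i \<in> I \<Longrightarrow> wint M B (f i) (\<lambda>\<omega>. X i \<omega> - m i)"
  shows "wint M B (\<lambda>u. \<Sum>i\<in>I. z i * f i u) (\<lambda>\<omega>. (\<Sum>i\<in>I. z i * X i \<omega>) - (\<Sum>i\<in>I. z i * m i))"
proof -
  have "wint M B (\<lambda>u. \<Sum>i\<in>I. z i * f i u) (\<lambda>\<omega>. \<Sum>i\<in>I. z i * (X i \<omega> - m i))"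
    by (rule wint_sum[OF W]) (rule assms)
  then show ?thesis by (simp add: right_diff_distrib sum_subtractf)
qed

text \<open>Each linear functional of the vector is, up to its mean, the Wiener integral of the same
  linear combination of kernels. Its variance is the squared norm of that combination, which expands
  into the quadratic form of the Gram matrix of the kernels.\<close>

lemma gauss_law_wint:
  assumes I: "finite I" and f: "\<And>i. i \<in> I \<Longrightarrow> wint M B (f i) (\<lambda>\<omega>. X i \<omega> - m i)"
  shows "gauss_law I m (\<lambda>i j. \<integral>u. f i u * f j u \<partial>lborel) (law M I X)"
  unfolding gauss_law_def
proof (intro conjI ballI allI)
  show "sets (law M I X) = sets (Pi\<^sub>M I (\<lambda>_. borel))" by (simp add: law_def)
  show "(\<integral>u. f i u * f j u \<partial>lborel) = (\<integral>u. f j u * f i u \<partial>lborel)" for i j by (simp add: mult.commute)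
  fix z :: "'a \<Rightarrow> real"
  have int: "integrable lborel (\<lambda>u. f i u * f j u)" if "i \<in> I" "j \<in> I" for i j
    using wint_integrable_mult f that by blast
  have "(\<integral>u. (\<Sum>i\<in>I. z i * f i u)\<^sup>2 \<partial>lborel) = (\<integral>u. (\<Sum>i\<in>I. \<Sum>j\<in>I. z i * (f i u * f j u) * z j) \<partial>lborel)"
    by (simp add: power2_eq_square sum_product algebra_simps)
  also have "\<dots> = (\<Sum>i\<in>I. \<Sum>j\<in>I. z i * (\<integral>u. f i u * f j u \<partial>lborel) * z j)"
    using int by (simp add: Bochner_Integration.integral_sum)
  finally have v: "(\<integral>u. (\<Sum>i\<in>I. z i * f i u)\<^sup>2 \<partial>lborel) = (\<Sum>i\<in>I. \<Sum>j\<in>I. z i * (\<integral>u. f i u * f j u \<partial>lborel) * z j)" .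
  show "0 \<le> (\<Sum>i\<in>I. \<Sum>j\<in>I. z i * (\<integral>u. f i u * f j u \<partial>lborel) * z j)"
    unfolding v[symmetric] by simp
  have [measurable]: "X i \<in> borel_measurable M" if "i \<in> I" for i using wint_measurable f that by blast
  have "distr (law M I X) borel (\<lambda>x. \<Sum>i\<in>I. z i * x i) = distr M borel (\<lambda>\<omega>. \<Sum>i\<in>I. z i * X i \<omega>)"
    unfolding law_def by (subst distr_distr) (auto simp: random_vector_def[abs_def] comp_def cong: sum.cong)
  also have "\<dots> = normal_law (\<Sum>i\<in>I. z i * m i) (\<Sum>i\<in>I. \<Sum>j\<in>I. z i * (\<integral>u. f i u * f j u \<partial>lborel) * z j)"
    unfolding v[symmetric] by (intro wint_normal_shift wint_linear_combination f)
  finally show "distr (law M I X) borel (\<lambda>x. \<Sum>i\<in>I. z i * x i) =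
      normal_law (\<Sum>i\<in>I. z i * m i) (\<Sum>i\<in>I. \<Sum>j\<in>I. z i * (\<integral>u. f i u * f j u \<partial>lborel) * z j)" .
qed

text \<open>On the product space the two arguments are independent copies, so Fubini's theorem
  factors the exponential.\<close>

lemma char_pair_add:
  assumes [measurable]: "X \<in> borel_measurable M" "Y \<in> borel_measurable M"
  shows "char (distr (M \<Otimes>\<^sub>M M) borel (\<lambda>(\<omega>, \<omega>'). X \<omega> + Y \<omega>')) t = char (distr M borel X) t * char (distr M borel Y) t"
proof -
  interpret prob_space M by (rule wiener_prob_space[OF W])
  interpret P: pair_prob_space M M ..
  have "char (distr (M \<Otimes>\<^sub>M M) borel (\<lambda>(\<omega>, \<omega>'). X \<omega> + Y \<omega>')) t =
      (\<integral>p. iexp (t * X (fst p)) * iexp (t * Y (snd p)) \<partial>(M \<Otimes>\<^sub>M M))"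
    unfolding char_def by (subst integral_distr) (auto simp: split_beta' distrib_left simp flip: exp_add)
  also have "\<dots> = (\<integral>\<omega>. \<integral>\<omega>'. iexp (t * X \<omega>) * iexp (t * Y \<omega>') \<partial>M \<partial>M)"
    by (subst P.integral_fst'[symmetric]) (auto intro!: P.integrable_const_bound[where B=1] simp: norm_mult)
  also have "\<dots> = char (distr M borel X) t * char (distr M borel Y) t"
    by (simp add: char_def integral_distr)
  finally show ?thesis .
qed

end

subsection \<open>Conditioning on a Gauss variable\<close>

lemma gauss_law_cong:
  assumes "\<And>i. i \<in> I \<Longrightarrow> m i = m' i" "\<And>i j. i \<in> I \<Longrightarrow> j \<in> I \<Longrightarrow> C i j = C' i j"
  shows "gauss_law I m C N \<longleftrightarrow> gauss_law I m' C' N"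
proof -
  have "(\<Sum>i\<in>I. z i * m i) = (\<Sum>i\<in>I. z i * m' i)"
      "(\<Sum>i\<in>I. \<Sum>j\<in>I. z i * C i j * z j) = (\<Sum>i\<in>I. \<Sum>j\<in>I. z i * C' i j * z j)" for z
    using assms by (auto intro!: sum.cong)
  then show ?thesis using assms by (simp add: gauss_law_def)
qed

lemma sum_option:
  assumes "finite I"
  shows "(\<Sum>k\<in>insert None (Some ` I). h k) = h None + (\<Sum>i\<in>I. h (Some i))"
  using assms by (subst sum.insert) (auto simp: sum.reindex)

lemma measurable_random_vector:
  assumes "\<And>i. i \<in> I \<Longrightarrow> X i \<in> borel_measurable M"
  shows "random_vector I X \<in> M \<rightarrow>\<^sub>M Pi\<^sub>M I (\<lambda>_. borel)"
  unfolding random_vector_def[abs_def] using assms by (intro measurable_restrict) auto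

context
  fixes M :: "'w measure" and B :: "real \<Rightarrow> 'w \<Rightarrow> real" and I :: "'i set"
    and X :: "'i \<Rightarrow> 'w \<Rightarrow> real" and V :: "'w \<Rightarrow> real"
    and f :: "'i \<Rightarrow> real \<Rightarrow> real" and m :: "'i \<Rightarrow> real" and g :: "real \<Rightarrow> real" and \<mu> :: real
begin

text \<open>Regression coefficient of \<open>X i\<close> on \<open>V\<close>, the quotient of
  covariance and variance, expressed by the kernels: the coefficient of the orthogonal projection of
  \<open>f i\<close> onto \<open>g\<close> in L2.\<close>

definition regr :: "'i \<Rightarrow> real" where
  "regr i = (\<integral>u. f i u * g u \<partial>lborel) / (\<integral>u. g u * g u \<partial>lborel)"

text \<open>The residual of \<open>X i\<close> plus the regression term with \<open>V\<close>
  replaced by the number \<open>w\<close>. Its unconditional law is the candidate for the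
  conditional law given \<open>V = w\<close>, and setting \<open>w = V \<omega>\<close> gives back
  \<open>X i \<omega>\<close>.\<close>

definition cond_vector :: "real \<Rightarrow> 'i \<Rightarrow> 'w \<Rightarrow> real" where
  "cond_vector w i \<omega> = X i \<omega> + regr i * (w - V \<omega>)"

context
  assumes W: "wiener_process M B" and I: "finite I"
    and f: "\<And>i. i \<in> I \<Longrightarrow> wint M B (f i) (\<lambda>\<omega>. X i \<omega> - m i)"
    and g: "wint M B g (\<lambda>\<omega>. V \<omega> - \<mu>)"
    and pos: "0 < (\<integral>u. g u * g u \<partial>lborel)"
begin

lemma cond_X_measurable: "i \<in> I \<Longrightarrow> X i \<in> borel_measurable M"
  using wint_measurable[OF f] .

lemma cond_V_measurable: "V \<in> borel_measurable M"
  using wint_measurable[OF g] .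

lemma cond_residual_wint:
  "i \<in> I \<Longrightarrow> wint M B (\<lambda>u. f i u - regr i * g u) (\<lambda>\<omega>. (X i \<omega> - regr i * V \<omega>) - (m i - regr i * \<mu>))"
  using wint_diff[OF W f wint_cmult[OF W g, of "regr i"]] by (simp add: algebra_simps)

lemma cond_residual_orthogonal:
  assumes i: "i \<in> I"
  shows "(\<integral>u. (f i u - regr i * g u) * g u \<partial>lborel) = 0"
proof -
  have "(\<integral>u. (f i u - regr i * g u) * g u \<partial>lborel) = (\<integral>u. f i u * g u - regr i * (g u * g u) \<partial>lborel)"
    by (simp add: algebra_simps)
  also have "\<dots> = (\<integral>u. f i u * g u \<partial>lborel) - regr i * (\<integral>u. g u * g u \<partial>lborel)"
    using wint_integrable_mult[OF f[OF i] g] wint_integrable_mult[OF g g]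
    by (subst Bochner_Integration.integral_diff) auto
  finally show ?thesis using pos by (simp add: regr_def)
qed

text \<open>The covariance matrix is the Gram matrix of the residual kernels. Writing the second
  residual as \<open>f j\<close> minus a multiple of \<open>g\<close>, the multiple of
  \<open>g\<close> contributes nothing by orthogonality, so a single correction term
  remains.\<close>

lemma cond_vector_gauss:
  "gauss_law I (\<lambda>i. m i + regr i * (w - \<mu>))
     (\<lambda>i j. (\<integral>u. f i u * f j u \<partial>lborel) - regr i * (\<integral>u. f j u * g u \<partial>lborel))
     (law M I (cond_vector w))"
proof -
  have "gauss_law I (\<lambda>i. m i + regr i * (w - \<mu>))
      (\<lambda>i j. \<integral>u. (f i u - regr i * g u) * (f j u - regr j * g u) \<partial>lborel) (law M I (cond_vector w))"
    using cond_residual_wint by (intro gauss_law_wint[OF W I]) (simp add: cond_vector_def algebra_simps)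
  moreover have "(\<integral>u. (f i u - regr i * g u) * (f j u - regr j * g u) \<partial>lborel) =
      (\<integral>u. f i u * f j u \<partial>lborel) - regr i * (\<integral>u. f j u * g u \<partial>lborel)" if i: "i \<in> I" and j: "j \<in> I" for i j
  proof -
    have "(\<integral>u. (f i u - regr i * g u) * (f j u - regr j * g u) \<partial>lborel) =
        (\<integral>u. (f i u * f j u - regr i * (f j u * g u)) - regr j * ((f i u - regr i * g u) * g u) \<partial>lborel)"
      by (simp add: algebra_simps)
    also have "\<dots> = (\<integral>u. f i u * f j u \<partial>lborel) - regr i * (\<integral>u. f j u * g u \<partial>lborel)
        - regr j * (\<integral>u. (f i u - regr i * g u) * g u \<partial>lborel)"
      using wint_integrable_mult[OF f[OF i] f[OF j]] wint_integrable_mult[OF f[OF j] g]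
        wint_integrable_mult[OF cond_residual_wint[OF i] g]
      by simp
    finally show ?thesis by (simp add: cond_residual_orthogonal[OF i])
  qed
  ultimately show ?thesis by (simp cong: gauss_law_cong)
qed

text \<open>
  The regression residuals of \<open>X\<close> are independent of \<open>V\<close>: the law of \<open>(V, X)\<close> does not change when
  \<open>V\<close> is resampled independently of the residuals.
\<close>

lemma joint_law_eq:
  defines "K \<equiv> insert None (Some ` I)"
  shows "law M K (case_option V X) =
    distr (M \<Otimes>\<^sub>M M) (Pi\<^sub>M K (\<lambda>_. borel))
      (\<lambda>p. random_vector K (case_option (\<lambda>_. V (snd p)) (cond_vector (V (snd p)))) (fst p))"
    (is "?N1 = distr _ _ ?Y")
proof (rule cramer_wold)
  note [measurable] = cond_X_measurable cond_V_measurable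
  interpret prob_space M by (rule wiener_prob_space[OF W])
  interpret P: pair_prob_space M M ..
  show "finite K" using I by (simp add: K_def)
  have Y[measurable]: "?Y \<in> M \<Otimes>\<^sub>M M \<rightarrow>\<^sub>M Pi\<^sub>M K (\<lambda>_. borel)"
    unfolding random_vector_def
    by (intro measurable_restrict) (auto simp: K_def cond_vector_def)
  have X[measurable]: "random_vector K (case_option V X) \<in> M \<rightarrow>\<^sub>M Pi\<^sub>M K (\<lambda>_. borel)"
    by (intro measurable_random_vector) (auto simp: K_def)
  show "prob_space ?N1" unfolding law_def by (intro prob_space_distr) measurable
  show "prob_space (distr (M \<Otimes>\<^sub>M M) (Pi\<^sub>M K (\<lambda>_. borel)) ?Y)" by (intro P.prob_space_distr) measurable
  fix z :: "'i option \<Rightarrow> real"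
  \<comment> \<open>Collecting all occurrences of \<open>V\<close> splits the functional with
    coefficients \<open>z\<close> into a combination \<open>A\<close> of residuals and the multiple
    \<open>\<beta>\<close> of \<open>V\<close>.\<close>
  define \<beta> where "\<beta> = z None + (\<Sum>i\<in>I. z (Some i) * regr i)"
  define A where "A \<omega> = (\<Sum>i\<in>I. z (Some i) * (X i \<omega> - regr i * V \<omega>))" for \<omega>
  define \<alpha> where "\<alpha> = (\<Sum>i\<in>I. z (Some i) * (m i - regr i * \<mu>))"
  define h where "h u = (\<Sum>i\<in>I. z (Some i) * (f i u - regr i * g u))" for u
  have A: "wint M B h (\<lambda>\<omega>. A \<omega> - \<alpha>)"
    unfolding h_def[abs_def] A_def[abs_def] \<alpha>_def
    by (intro wint_linear_combination[OF W] cond_residual_wint)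
  have V: "wint M B (\<lambda>u. \<beta> * g u) (\<lambda>\<omega>. \<beta> * V \<omega> - \<beta> * \<mu>)"
    using wint_cmult[OF W g, of \<beta>] by (simp add: right_diff_distrib)
  have AV: "wint M B (\<lambda>u. h u + \<beta> * g u) (\<lambda>\<omega>. (A \<omega> + \<beta> * V \<omega>) - (\<alpha> + \<beta> * \<mu>))"
    using wint_add[OF W A V] by (simp add: algebra_simps)
  have [measurable]: "A \<in> borel_measurable M" using wint_measurable[OF A] .
  have "(\<integral>u. h u * g u \<partial>lborel) = (\<Sum>i\<in>I. z (Some i) * (\<integral>u. (f i u - regr i * g u) * g u \<partial>lborel))"
    using wint_integrable_mult[OF cond_residual_wint g]
    by (simp add: h_def sum_distrib_right mult.assoc Bochner_Integration.integral_sum)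
  then have "(\<integral>u. h u * g u \<partial>lborel) = 0" by (simp add: cond_residual_orthogonal)
  then have "(\<integral>u. h u * (\<beta> * g u) \<partial>lborel) = 0" by (simp add: mult.left_commute)
  \<comment> \<open>Orthogonality makes the variances add up, so \<open>A + \<beta> V\<close> has
    the same normal law whether or not \<open>V\<close> is an independent copy.\<close>
  then have var: "(\<integral>u. (h u + \<beta> * g u)\<^sup>2 \<partial>lborel) = (\<integral>u. (h u)\<^sup>2 \<partial>lborel) + (\<integral>u. (\<beta> * g u)\<^sup>2 \<partial>lborel)"
    using integral_power2_add(2)[of h lborel "\<lambda>u. \<beta> * g u"] wintD[OF A] wintD[OF V] by simp
  have lin: "(\<Sum>k\<in>K. z k * (case k of None \<Rightarrow> V \<omega>' | Some i \<Rightarrow> cond_vector (V \<omega>') i \<omega>)) = A \<omega> + \<beta> * V \<omega>'" for \<omega> \<omega>'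
    by (simp add: K_def sum_option[OF I] A_def \<beta>_def cond_vector_def algebra_simps sum.distrib sum_subtractf sum_distrib_left)
  have "distr ?N1 borel (\<lambda>x. \<Sum>k\<in>K. z k * x k) = distr M borel (\<lambda>\<omega>. A \<omega> + \<beta> * V \<omega>)"
  proof -
    have "(\<Sum>k\<in>K. z k * random_vector K (case_option V X) \<omega> k) = A \<omega> + \<beta> * V \<omega>" for \<omega>
      unfolding lin[symmetric] random_vector_def by (intro sum.cong) (auto simp: cond_vector_def split: option.split)
    then show ?thesis unfolding law_def by (subst distr_distr) (auto simp: comp_def)
  qed
  also have "\<dots> = distr (M \<Otimes>\<^sub>M M) borel (\<lambda>(\<omega>, \<omega>'). A \<omega> + \<beta> * V \<omega>')"
  proof (rule Levy_uniqueness)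
    show "real_distribution (distr M borel (\<lambda>\<omega>. A \<omega> + \<beta> * V \<omega>))"
      by (rule real_distribution_distr) measurable
    show "real_distribution (distr (M \<Otimes>\<^sub>M M) borel (\<lambda>(\<omega>, \<omega>'). A \<omega> + \<beta> * V \<omega>'))"
      by (rule P.real_distribution_distr) measurable
    show "char (distr M borel (\<lambda>\<omega>. A \<omega> + \<beta> * V \<omega>)) = char (distr (M \<Otimes>\<^sub>M M) borel (\<lambda>(\<omega>, \<omega>'). A \<omega> + \<beta> * V \<omega>'))"
    proof
      fix t
      show "char (distr M borel (\<lambda>\<omega>. A \<omega> + \<beta> * V \<omega>)) t = char (distr (M \<Otimes>\<^sub>M M) borel (\<lambda>(\<omega>, \<omega>'). A \<omega> + \<beta> * V \<omega>')) t"
      proof -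
        have e1: "iexp (t * (x + y)) = iexp (t * x) * iexp (t * y)" for x y
          by (simp add: distrib_left flip: exp_add)
        have e2: "exp (- ((x + y) * t\<^sup>2) / 2) = exp (- (x * t\<^sup>2) / 2) * exp (- (y * t\<^sup>2) / 2)" for x y :: real
          unfolding exp_add[symmetric] by (simp add: distrib_right add_divide_distrib diff_divide_distrib)
        have "char (distr (M \<Otimes>\<^sub>M M) borel (\<lambda>(\<omega>, \<omega>'). A \<omega> + \<beta> * V \<omega>')) t =
            char (distr M borel A) t * char (distr M borel (\<lambda>\<omega>. \<beta> * V \<omega>)) t"
          by (rule char_pair_add[OF W]) measurable
        moreover note wint_normal_shift[OF W AV] wint_normal_shift[OF W A] wint_normal_shift[OF W V]
        moreover have nn: "0 \<le> (\<integral>u. (h u)\<^sup>2 \<partial>lborel)" "0 \<le> (\<integral>u. (\<beta> * g u)\<^sup>2 \<partial>lborel)" by auto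
        ultimately show ?thesis
          by (simp only: char_normal_law[OF nn(1)] char_normal_law[OF nn(2)]
              char_normal_law[OF add_nonneg_nonneg[OF nn]] var e1 e2) (simp only: of_real_mult mult_ac)
      qed
    qed
  qed
  also have "\<dots> = distr (distr (M \<Otimes>\<^sub>M M) (Pi\<^sub>M K (\<lambda>_. borel)) ?Y) borel (\<lambda>x. \<Sum>k\<in>K. z k * x k)"
  proof -
    have "(\<Sum>k\<in>K. z k * ?Y p k) = A (fst p) + \<beta> * V (snd p)" for p
      unfolding lin[symmetric] random_vector_def by (intro sum.cong) (auto split: option.split)
    then show ?thesis by (subst distr_distr) (auto simp: comp_def split_beta')
  qed
  finally show "distr ?N1 borel (\<lambda>x. \<Sum>k\<in>K. z k * x k) =
      distr (distr (M \<Otimes>\<^sub>M M) (Pi\<^sub>M K (\<lambda>_. borel)) ?Y) borel (\<lambda>x. \<Sum>k\<in>K. z k * x k)" .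
qed (simp_all add: law_def)

text \<open>\<open>joint_law_eq\<close> turns the probability of the event into a product measure.
  Integrating over the second argument last freezes the value of \<open>V\<close> there, and the
  inner measure is the law of \<open>cond_vector\<close> at this frozen value.\<close>

lemma cond_vector_regular_cond_distr:
  "regular_cond_distr M I X V (\<lambda>w. law M I (cond_vector w))"
  unfolding regular_cond_distr_def
proof (intro conjI ballI)
  note [measurable] = cond_X_measurable cond_V_measurable
  interpret prob_space M by (rule wiener_prob_space[OF W])
  interpret P: pair_prob_space M M ..
  have rv: "random_vector I (cond_vector w) \<in> M \<rightarrow>\<^sub>M Pi\<^sub>M I (\<lambda>_. borel)" for w
    by (intro measurable_random_vector) (auto simp: cond_vector_def[abs_def])
  show \<kappa>: "(\<lambda>w. law M I (cond_vector w)) \<in> borel \<rightarrow>\<^sub>M prob_algebra (Pi\<^sub>M I (\<lambda>_. borel))"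
    unfolding law_def
  proof (rule measurable_distr_prob_space2)
    show "(\<lambda>w. M) \<in> borel \<rightarrow>\<^sub>M prob_algebra M"
      by (intro measurable_const) (simp add: space_prob_algebra prob_space_axioms)
    show "(\<lambda>(w, \<omega>). random_vector I (cond_vector w) \<omega>) \<in> borel \<Otimes>\<^sub>M M \<rightarrow>\<^sub>M Pi\<^sub>M I (\<lambda>_. borel)"
      unfolding random_vector_def split_beta' cond_vector_def by (intro measurable_restrict) simp
  qed
  fix A :: "('i \<Rightarrow> real) set" and D :: "real set"
  assume A[measurable]: "A \<in> sets (Pi\<^sub>M I (\<lambda>_. borel))" and D[measurable]: "D \<in> sets borel"
  define K where "K = insert None (Some ` I)"
  define E where "E = {x \<in> space (Pi\<^sub>M K (\<lambda>_. borel :: real measure)). (\<lambda>i\<in>I. x (Some i)) \<in> A \<and> x None \<in> D}"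
  have [measurable]: "(\<lambda>x. \<lambda>i\<in>I. x (Some i)) \<in> Pi\<^sub>M K (\<lambda>_. borel) \<rightarrow>\<^sub>M Pi\<^sub>M I (\<lambda>_. borel)"
    by (intro measurable_restrict) (auto simp: K_def)
  have [measurable]: "(\<lambda>x. x None) \<in> Pi\<^sub>M K (\<lambda>_. borel) \<rightarrow>\<^sub>M borel"
    by (intro measurable_component_singleton) (simp add: K_def)
  have E: "E \<in> sets (Pi\<^sub>M K (\<lambda>_. borel))" unfolding E_def by measurable
  define Y where "Y p = random_vector K (case_option (\<lambda>_. V (snd p)) (cond_vector (V (snd p)))) (fst p)" for p
  have Y[measurable]: "Y \<in> M \<Otimes>\<^sub>M M \<rightarrow>\<^sub>M Pi\<^sub>M K (\<lambda>_. borel)"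
    unfolding Y_def random_vector_def
    by (intro measurable_restrict) (auto simp: K_def cond_vector_def)
  have X[measurable]: "random_vector K (case_option V X) \<in> M \<rightarrow>\<^sub>M Pi\<^sub>M K (\<lambda>_. borel)"
    by (intro measurable_random_vector) (auto simp: K_def)
  have IK: "(\<lambda>i\<in>I. random_vector K Z \<omega> (Some i)) = random_vector I (\<lambda>i. Z (Some i)) \<omega>"
      "random_vector K Z \<omega> None = Z None \<omega>" for Z :: "'i option \<Rightarrow> 'w \<Rightarrow> real" and \<omega>
    by (auto simp: random_vector_def K_def fun_eq_iff)
  have "emeasure M {\<omega> \<in> space M. random_vector I X \<omega> \<in> A \<and> V \<omega> \<in> D} = emeasure (law M K (case_option V X)) E"
    unfolding law_def using measurable_space[OF X]
    by (subst emeasure_distr[OF X E]) (auto simp: E_def IK intro!: arg_cong[where f = "emeasure M"])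
  also have "\<dots> = emeasure (M \<Otimes>\<^sub>M M) (Y -` E \<inter> space (M \<Otimes>\<^sub>M M))"
    unfolding joint_law_eq[folded K_def] Y_def[symmetric] by (rule emeasure_distr[OF Y E])
  also have "\<dots> = (\<integral>\<^sup>+\<omega>'. emeasure M ((\<lambda>\<omega>. (\<omega>, \<omega>')) -` (Y -` E \<inter> space (M \<Otimes>\<^sub>M M))) \<partial>M)"
    by (rule P.emeasure_pair_measure_alt2[OF measurable_sets[OF Y E]])
  also have "\<dots> = (\<integral>\<^sup>+\<omega>'. emeasure (law M I (cond_vector (V \<omega>'))) A * indicator D (V \<omega>') \<partial>M)"
  proof (rule nn_integral_cong)
    fix \<omega>' assume \<omega>': "\<omega>' \<in> space M"
    have "(\<lambda>\<omega>. (\<omega>, \<omega>')) -` (Y -` E \<inter> space (M \<Otimes>\<^sub>M M)) =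
        (if V \<omega>' \<in> D then random_vector I (cond_vector (V \<omega>')) -` A \<inter> space M else {})"
      using \<omega>' measurable_space[OF Y, of "(_, \<omega>')"]
      by (auto simp: E_def Y_def IK space_pair_measure)
    then show "emeasure M ((\<lambda>\<omega>. (\<omega>, \<omega>')) -` (Y -` E \<inter> space (M \<Otimes>\<^sub>M M))) =
        emeasure (law M I (cond_vector (V \<omega>'))) A * indicator D (V \<omega>')"
      unfolding law_def by (simp add: emeasure_distr[OF rv A])
  qed
  also have "\<dots> = (\<integral>\<^sup>+w\<in>D. emeasure (law M I (cond_vector w)) A \<partial>distr M borel V)"
  proof (rule nn_integral_distr[symmetric])
    note * = measurable_emeasure_kernel[OF measurable_prob_algebraD[OF \<kappa>] A]
    show "(\<lambda>w. emeasure (law M I (cond_vector w)) A * indicator D w) \<in> borel_measurable (distr M borel V)"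
      unfolding measurable_distr_eq1 by (intro borel_measurable_times_ennreal * borel_measurable_indicator D)
  qed measurable
  finally show "emeasure M {\<omega> \<in> space M. random_vector I X \<omega> \<in> A \<and> V \<omega> \<in> D} =
      (\<integral>\<^sup>+w\<in>D. emeasure (law M I (cond_vector w)) A \<partial>distr M borel V)" .
qed

lemma jointly_gauss_wint: "jointly_gauss M I X V"
  unfolding jointly_gauss_def gauss_vector_def
proof (intro conjI exI ballI)
  note [measurable] = cond_X_measurable cond_V_measurable
  let ?K = "insert None (Some ` I)"
  show "case_option V X k \<in> borel_measurable M" if "k \<in> ?K" for k using that by auto
  show "gauss_law ?K (case_option \<mu> m) (\<lambda>i j. \<integral>u. case_option g f i u * case_option g f j u \<partial>lborel) (law M ?K (case_option V X))"
    by (rule gauss_law_wint[OF W]) (use I f g in auto)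
qed

text \<open>Translates the definition, which speaks of means and covariances, into kernel integrals;
  joint Gaussianity and positive variance hold in this context and disappear from the right-hand
  side.\<close>

lemma gauss_cond_distr_iff:
  "gauss_cond_distr M I X V \<kappa> \<longleftrightarrow> regular_cond_distr M I X V \<kappa> \<and>
     (\<forall>w. gauss_law I (\<lambda>i. m i + regr i * (w - \<mu>))
       (\<lambda>i j. (\<integral>u. f i u * f j u \<partial>lborel) - regr i * (\<integral>u. f j u * g u \<partial>lborel)) (\<kappa> w))"
proof -
  have *: "mean M (X i) = m i" "mean M V = \<mu>" "covariance M (X i) (X j) = (\<integral>u. f i u * f j u \<partial>lborel)"
      "covariance M (X i) V = (\<integral>u. f i u * g u \<partial>lborel)" "covariance M V V = (\<integral>u. g u * g u \<partial>lborel)"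
    if "i \<in> I" "j \<in> I" for i j
    using that by (simp_all add: wint_mean[OF W f] wint_mean[OF W g] wint_covariance_mean[OF W f f]
        wint_covariance_mean[OF W f g] wint_covariance_mean[OF W g g])
  have cov: "covariance M V V = (\<integral>u. g u * g u \<partial>lborel)" by (rule wint_covariance_mean[OF W g g])
  have "gauss_law I (\<lambda>i. mean M (X i) + covariance M (X i) V / covariance M V V * (w - mean M V))
        (\<lambda>i j. covariance M (X i) (X j) - covariance M (X i) V / covariance M V V * covariance M (X j) V) (\<kappa> w) \<longleftrightarrow>
      gauss_law I (\<lambda>i. m i + regr i * (w - \<mu>))
       (\<lambda>i j. (\<integral>u. f i u * f j u \<partial>lborel) - regr i * (\<integral>u. f j u * g u \<partial>lborel)) (\<kappa> w)" for w
    by (rule gauss_law_cong) (simp_all add: * regr_def)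
  then show ?thesis
    using jointly_gauss_wint pos cov by (simp add: gauss_cond_distr_def)
qed

text \<open>Uniqueness is pointwise in \<open>w\<close>: the mean and covariance prescribed for each
  \<open>w\<close> determine the Gauss law, so no exceptional null set arises.\<close>

lemma ex1_gauss_cond_distr: "\<exists>!\<kappa>. gauss_cond_distr M I X V \<kappa>"
proof (rule ex1I)
  show "gauss_cond_distr M I X V (\<lambda>w. law M I (cond_vector w))"
    using cond_vector_regular_cond_distr cond_vector_gauss by (simp add: gauss_cond_distr_iff)
  show "\<kappa> = (\<lambda>w. law M I (cond_vector w))" if "gauss_cond_distr M I X V \<kappa>" for \<kappa>
    using that cond_vector_gauss by (auto simp: gauss_cond_distr_iff fun_eq_iff intro: gauss_law_unique[OF I])
qed

end

end

subsection \<open>Variation of constants\<close>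

lemma lborel_integral_eq_integral:
  fixes f :: "real \<Rightarrow> real"
  assumes ab: "a \<le> b" and f: "continuous_on {a..b} f"
  shows "(\<integral>u. indicator {a..b} u * f u \<partial>lborel) = integral {a..b} f"
  using set_borel_integral_eq_integral(2)[OF borel_integrable_atLeastAtMost'[OF f]]
  by (simp add: set_lebesgue_integral_def)

lemma integrable_indicator_continuous:
  fixes f :: "real \<Rightarrow> real"
  assumes f: "continuous_on {a..b} f"
  shows "integrable lborel (\<lambda>u. indicator {a..b} u * f u)"
  using borel_integrable_atLeastAtMost'[OF f] by (simp add: set_integrable_def)

lemma measurable_indicator_continuous:
  fixes f :: "real \<Rightarrow> real"
  assumes "continuous_on {a..b} f"
  shows "(\<lambda>u. indicator {a..b} u * f u) \<in> borel_measurable borel"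
  using borel_measurable_continuous_on_indicator[OF _ assms] by simp

section \<open>Weighted grid sums approximating time integrals\<close>

definition grid :: "real \<Rightarrow> nat \<Rightarrow> nat \<Rightarrow> real" where
  "grid t n k = t * real k / real (Suc n)"

lemma grid_mem: "0 \<le> t \<Longrightarrow> k \<le> Suc n \<Longrightarrow> grid t n k \<in> {0..t}"
  by (auto simp: grid_def divide_simps mult_left_mono)

lemma grid_Suc: "grid t n (Suc k) = grid t n k + t / real (Suc n)"
  by (simp add: grid_def distrib_left add_divide_distrib)

text \<open>Rescaling maps \<open>u\<close> to a point \<open>x\<close> of
  \<open>(0, n + 1]\<close>, and the cells to unit intervals open on the left; hence the cell number
  is the ceiling of \<open>x\<close> minus one, and \<open>u = 0\<close> lies in no cell.\<close>

lemma ex_grid_cell: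
  assumes t: "t > 0" and u: "u \<in> {0<..t}"
  shows "\<exists>k<Suc n. \<forall>l. u \<in> {grid t n l<..grid t n (Suc l)} \<longleftrightarrow> l = k"
proof -
  define x where "x = u * real (Suc n) / t"
  have x: "0 < x" "x \<le> real (Suc n)" using t u by (auto simp: x_def pos_divide_le_eq mult.commute mult_left_mono simp del: of_nat_Suc)
  have "u \<in> {grid t n l<..grid t n (Suc l)} \<longleftrightarrow> real l < x \<and> x \<le> real l + 1" for l
    using t by (auto simp: grid_def x_def field_simps)
  moreover have "real l < x \<and> x \<le> real l + 1 \<longleftrightarrow> l = nat \<lceil>x\<rceil> - 1" for l
    using x by (auto simp: le_nat_iff nat_eq_iff ceiling_eq_iff) linarith+
  moreover have "nat \<lceil>x\<rceil> - 1 < Suc n" using x by linarith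
  ultimately show ?thesis by (intro exI[of _ "nat \<lceil>x\<rceil> - 1"]) auto
qed

text \<open>The weight is the exact integral of \<open>G\<close> over the cell, not a value of
  \<open>G\<close> times the mesh. A weighted sum of values of \<open>\<phi>\<close> is then the
  integral of \<open>G\<close> times a step function, so only \<open>\<phi>\<close> is
  approximated.\<close>

definition cell_weight :: "real \<Rightarrow> (real \<Rightarrow> real) \<Rightarrow> nat \<Rightarrow> nat \<Rightarrow> real" where
  "cell_weight t G n k = (\<integral>u. indicator {grid t n k<..grid t n (Suc k)} u * (indicator {0..t} u * G u) \<partial>lborel)"

lemma cell_weight_bound:
  assumes t: "t > 0" and C: "\<And>u. u \<in> {0..t} \<Longrightarrow> \<bar>G u\<bar> \<le> C"
  shows "\<bar>cell_weight t G n k\<bar> \<le> C * (t / real (Suc n))"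
proof -
  have "C \<ge> 0" using C[of 0] t by simp
  have "\<bar>cell_weight t G n k\<bar> \<le> (\<integral>u. \<bar>indicator {grid t n k<..grid t n (Suc k)} u * (indicator {0..t} u * G u)\<bar> \<partial>lborel)"
    unfolding cell_weight_def using integral_norm_bound[of lborel] by (simp del: abs_mult)
  also have "\<dots> \<le> (\<integral>u. C * indicator {grid t n k<..grid t n (Suc k)} u \<partial>lborel)"
  proof (rule integral_mono_AE')
    show "integrable lborel (\<lambda>u. C * indicator {grid t n k<..grid t n (Suc k)} u)"
      using t by (intro integrable_mult_right integrable_real_indicator) (simp_all add: grid_Suc)
  qed (use C \<open>C \<ge> 0\<close> in \<open>auto simp: indicator_def\<close>)
  also have "\<dots> = C * (t / real (Suc n))" using t by (subst integral_mult_right_zero) (simp add: grid_Suc)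
  finally show ?thesis .
qed

text \<open>The bound is uniform in \<open>n\<close>; it supplies the dominating function when the
  kernels of the approximating integrals converge.\<close>

lemma cell_sum_bound:
  assumes t: "t > 0" and C: "\<And>u. u \<in> {0..t} \<Longrightarrow> \<bar>G u\<bar> \<le> C" and D: "\<And>k. \<bar>\<phi> k\<bar> \<le> D" "0 \<le> D"
  shows "\<bar>\<Sum>k<Suc n. cell_weight t G n k * \<phi> k\<bar> \<le> C * t * D"
proof -
  have "C \<ge> 0" using C[of 0] t by simp
  have "\<bar>\<Sum>k<Suc n. cell_weight t G n k * \<phi> k\<bar> \<le> (\<Sum>k<Suc n. \<bar>cell_weight t G n k\<bar> * \<bar>\<phi> k\<bar>)"
    unfolding abs_mult[symmetric] by (rule sum_abs)
  also have "\<dots> \<le> (\<Sum>k<Suc n. C * (t / real (Suc n)) * D)"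
    using cell_weight_bound[OF t C] D \<open>C \<ge> 0\<close> t by (intro sum_mono mult_mono) auto
  also have "\<dots> = C * t * D" by simp
  finally show ?thesis .
qed

text \<open>Dominated convergence for \<open>G\<close> times the step function with the values of
  \<open>\<phi>\<close> at left end points. It serves two purposes: for a path it gives the time
  integral, and for the indicator of \<open>{s..}\<close>, whose jump is the exceptional point
  \<open>s\<close>, it gives the limit of the kernels.\<close>

lemma cell_sum_limit:
  assumes t: "t > 0" and G: "continuous_on {0..t} G"
    and \<phi>m: "(\<lambda>u. indicator {0..t} u * \<phi> u) \<in> borel_measurable borel"
    and D: "\<And>u. u \<in> {0..t} \<Longrightarrow> \<bar>\<phi> u\<bar> \<le> D"
    and \<phi>: "\<And>u. u \<in> {0..t} \<Longrightarrow> u \<noteq> s \<Longrightarrow> continuous (at u within {0..t}) \<phi>"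
  shows "(\<lambda>n. \<Sum>k<Suc n. cell_weight t G n k * \<phi> (grid t n k)) \<longlonglongrightarrow>
    (\<integral>u. indicator {0..t} u * (G u * \<phi> u) \<partial>lborel)"
proof -
  define G' where "G' u = indicator {0..t} u * G u" for u
  have G': "integrable lborel G'" unfolding G'_def[abs_def] by (rule integrable_indicator_continuous[OF G])
  then have [measurable]: "G' \<in> borel_measurable borel" by simp
  define S where "S n u = (\<Sum>k<Suc n. \<phi> (grid t n k) * indicator {grid t n k<..grid t n (Suc k)} u) * G' u" for n u
  have "D \<ge> 0" using D[of 0] t by simp
  have S_cell: "\<exists>k<Suc n. u \<in> {grid t n k<..grid t n (Suc k)} \<and> S n u = \<phi> (grid t n k) * G' u" if u: "u \<in> {0<..t}" for n u
  proof -
    obtain k where k: "k < Suc n" "\<And>l. u \<in> {grid t n l<..grid t n (Suc l)} \<longleftrightarrow> l = k"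
      using ex_grid_cell[OF t u] by blast
    have "(\<Sum>l<Suc n. \<phi> (grid t n l) * indicator {grid t n l<..grid t n (Suc l)} u) = (\<Sum>l<Suc n. if l = k then \<phi> (grid t n l) else 0)"
      by (intro sum.cong refl) (simp add: indicator_def k(2)[simplified])
    also have "\<dots> = \<phi> (grid t n k)" using k(1) by (simp del: sum.lessThan_Suc)
    finally show ?thesis using k by (auto simp: S_def)
  qed
  have "(\<lambda>n. \<integral>u. S n u \<partial>lborel) \<longlonglongrightarrow> (\<integral>u. indicator {0..t} u * \<phi> u * G' u \<partial>lborel)"
  proof (rule integral_dominated_convergence)
    show "(\<lambda>u. indicator {0..t} u * \<phi> u * G' u) \<in> borel_measurable lborel" using \<phi>m by simp
    show "S n \<in> borel_measurable lborel" for n unfolding S_def[abs_def] by measurable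
    show "integrable lborel (\<lambda>u. D * \<bar>G' u\<bar>)" using G' by simp
    \<comment> \<open>Excluded are 0, which belongs to no cell, and the possible discontinuity of
      \<open>\<phi>\<close>.\<close>
    have ne: "AE u in lborel. u \<noteq> 0 \<and> u \<noteq> s"
      using AE_lborel_singleton[of 0] AE_lborel_singleton[of s] by eventually_elim simp
    show "AE u in lborel. (\<lambda>n. S n u) \<longlonglongrightarrow> indicator {0..t} u * \<phi> u * G' u"
      using ne
    proof eventually_elim
      case (elim u)
      show ?case
      proof (cases "u \<in> {0..t}")
        case False
        then show ?thesis by (simp add: S_def G'_def)
      next
        case True
        with elim have u: "u \<in> {0<..t}" by auto
        from S_cell[OF u] obtain k where k: "\<And>n. k n < Suc n" "\<And>n. u \<in> {grid t n (k n)<..grid t n (Suc (k n))}"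
            "\<And>n. S n u = \<phi> (grid t n (k n)) * G' u"
          by metis
        have "(\<lambda>n. grid t n (k n)) \<longlonglongrightarrow> u"
        proof (rule LIM_zero_cancel, rule Lim_null_comparison)
          show "\<forall>\<^sub>F n in sequentially. norm (grid t n (k n) - u) \<le> t / real (Suc n)"
          proof (intro always_eventually allI)
            fix n
            have "grid t n (k n) < u" "u \<le> grid t n (k n) + t / real (Suc n)"
              using k(2)[of n] by (simp_all add: grid_Suc)
            then show "norm (grid t n (k n) - u) \<le> t / real (Suc n)"
              unfolding real_norm_def by linarith
          qed
          show "(\<lambda>n. t / real (Suc n)) \<longlonglongrightarrow> 0"
            using tendsto_mult[OF tendsto_const LIMSEQ_Suc[OF lim_1_over_n], of t] by simp
        qed
        moreover have "grid t n (k n) \<in> {0..t}" for n using k(1)[of n] t by (intro grid_mem) auto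
        ultimately have "(\<lambda>n. \<phi> (grid t n (k n))) \<longlonglongrightarrow> \<phi> u"
          using \<phi>[OF True] elim unfolding continuous_within_sequentially by (auto simp: comp_def)
        then have "(\<lambda>n. \<phi> (grid t n (k n)) * G' u) \<longlonglongrightarrow> \<phi> u * G' u" by (intro tendsto_intros)
        then show ?thesis using True by (simp add: k(3))
      qed
    qed
    show "AE u in lborel. norm (S n u) \<le> D * \<bar>G' u\<bar>" for n
      using ne
    proof eventually_elim
      case (elim u)
      show ?case
      proof (cases "u \<in> {0..t}")
        case False
        then show ?thesis by (simp add: S_def G'_def)
      next
        case True
        with elim have u: "u \<in> {0<..t}" by auto
        from S_cell[OF u, of n] obtain k where "k < Suc n" "S n u = \<phi> (grid t n k) * G' u" by blast
        moreover have "grid t n k \<in> {0..t}" using t \<open>k < Suc n\<close> by (intro grid_mem) auto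
        ultimately show ?thesis using D[of "grid t n k"] by (simp add: abs_mult mult_right_mono)
      qed
    qed
  qed
  moreover have "(\<integral>u. S n u \<partial>lborel) = (\<Sum>k<Suc n. cell_weight t G n k * \<phi> (grid t n k))" for n
  proof -
    have i: "integrable lborel (\<lambda>u. indicator {grid t n k<..grid t n (Suc k)} u * G' u)" for k
      using integrable_mult_indicator[OF _ G', of "{grid t n k<..grid t n (Suc k)}"] by simp
    have "S n u = (\<Sum>k<Suc n. \<phi> (grid t n k) * (indicator {grid t n k<..grid t n (Suc k)} u * G' u))" for u
      unfolding S_def sum_distrib_right by (simp add: mult.assoc)
    then show ?thesis
      using i by (simp add: Bochner_Integration.integral_sum cell_weight_def G'_def[abs_def] mult.commute del: sum.lessThan_Suc)
  qed
  moreover have "indicator {0..t} u * \<phi> u * G' u = indicator {0..t} u * (G u * \<phi> u)" for u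
    by (simp add: G'_def indicator_def)
  ultimately show ?thesis by simp
qed

section \<open>Pathwise solution of the linear equation\<close>

lemma qbar_has_derivative:
  assumes "continuous_on {0..t} q" "u \<in> {0..t}"
  shows "(qbar q has_real_derivative q u) (at u within {0..t})"
  unfolding qbar_def[abs_def] using assms by (rule integral_has_real_derivative)

lemma continuous_on_qbar:
  assumes "continuous_on {0..t} q"
  shows "continuous_on {0..t} (qbar q)"
  using DERIV_continuous[OF qbar_has_derivative[OF assms]]
  by (simp add: continuous_on_eq_continuous_within)

lemma qbar_0 [simp]: "qbar q 0 = 0"
  by (simp add: qbar_def)

text \<open>The integrand is the derivative of \<open>- exp (qbar q t - qbar q u)\<close>. The
  left-hand side is the factor that the grid sums produce in front of \<open>\<sigma> s\<close>; the
  right-hand side is the one in the kernel of \<open>Z t\<close>.\<close>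

lemma exp_qbar_integral:
  assumes q: "continuous_on {0..t} q" and s: "0 \<le> s" "s \<le> t"
  shows "1 + integral {s..t} (\<lambda>u. exp (qbar q t - qbar q u) * q u) = exp (qbar q t - qbar q s)"
proof -
  have "((\<lambda>u. exp (qbar q t - qbar q u) * q u) has_integral
      - exp (qbar q t - qbar q t) - - exp (qbar q t - qbar q s)) {s..t}"
  proof (rule fundamental_theorem_of_calculus[OF s(2)])
    fix u assume u: "u \<in> {s..t}"
    have "(qbar q has_real_derivative q u) (at u within {s..t})"
      using s u by (intro DERIV_subset[OF qbar_has_derivative[OF q]]) auto
    then show "((\<lambda>u. - exp (qbar q t - qbar q u)) has_vector_derivative exp (qbar q t - qbar q u) * q u) (at u within {s..t})"
      unfolding has_real_derivative_iff_has_vector_derivative[symmetric]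
      by (auto intro!: derivative_eq_intros)
  qed
  then show ?thesis by (simp add: integral_unique)
qed

text \<open>The noise path \<open>y\<close> need not be differentiable, but \<open>V = x - y\<close>
  is, with derivative \<open>q x + r = q V + (q y + r)\<close>. The integrating factor is therefore
  applied to \<open>V\<close>, with \<open>q y\<close> acting as an additional inhomogeneity; no
  stochastic calculus enters.\<close>

lemma variation_of_constants:
  fixes x :: "real \<Rightarrow> real"
  assumes t: "0 \<le> t" and q: "continuous_on {0..t} q" and r: "continuous_on {0..t} r" and x: "continuous_on {0..t} x"
  defines "y \<equiv> \<lambda>u. x u - x 0 - integral {0..u} (\<lambda>v. q v * x v + r v)"
  shows "x t - mean_fun q r (x 0) 0 t = y t + integral {0..t} (\<lambda>u. exp (qbar q t - qbar q u) * q u * y u)"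
    and "continuous_on {0..t} y"
proof -
  define V where "V u = x 0 + integral {0..u} (\<lambda>v. q v * x v + r v)" for u
  have V: "(V has_real_derivative q u * x u + r u) (at u within {0..t})" if "u \<in> {0..t}" for u
    unfolding V_def[abs_def] using that q r x
    by (auto intro!: derivative_eq_intros integral_has_real_derivative continuous_intros)
  have "continuous_on {0..t} V"
    using DERIV_continuous[OF V] by (simp add: continuous_on_eq_continuous_within)
  moreover have y: "y = (\<lambda>u. x u - V u)" by (simp add: y_def V_def diff_diff_eq)
  ultimately show yc: "continuous_on {0..t} y" using x by (auto intro: continuous_intros)
  have "((\<lambda>u. exp (qbar q t - qbar q u) * (q u * y u + r u)) has_integral
      exp (qbar q t - qbar q t) * V t - exp (qbar q t - qbar q 0) * V 0) {0..t}"
  proof (rule fundamental_theorem_of_calculus[OF t])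
    fix u assume u: "u \<in> {0..t}"
    show "((\<lambda>u. exp (qbar q t - qbar q u) * V u) has_vector_derivative exp (qbar q t - qbar q u) * (q u * y u + r u)) (at u within {0..t})"
      unfolding has_real_derivative_iff_has_vector_derivative[symmetric]
      by (auto intro!: derivative_eq_intros qbar_has_derivative[OF q u] V[OF u] simp: y algebra_simps)
  qed
  then have "integral {0..t} (\<lambda>u. exp (qbar q t - qbar q u) * (q u * y u + r u)) = V t - exp (qbar q t) * x 0"
    by (simp add: integral_unique V_def)
  moreover have "integral {0..t} (\<lambda>u. exp (qbar q t - qbar q u) * (q u * y u + r u)) =
      integral {0..t} (\<lambda>u. exp (qbar q t - qbar q u) * q u * y u) + integral {0..t} (\<lambda>u. exp (qbar q t - qbar q u) * r u)"
    unfolding distrib_left mult.assoc[symmetric] using q r yc continuous_on_qbar[OF q]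
    by (intro integral_add integrable_continuous_real continuous_intros)
  ultimately show "x t - mean_fun q r (x 0) 0 t = y t + integral {0..t} (\<lambda>u. exp (qbar q t - qbar q u) * q u * y u)"
    by (simp add: mean_fun_def y)
qed

lemma isCont_indicator_atLeast:
  "u \<noteq> s \<Longrightarrow> isCont (indicator {s..} :: real \<Rightarrow> real) u"
  by (simp add: isCont_indicator frontier_def)

lemma continuous_on_interval_bound:
  fixes f :: "real \<Rightarrow> real"
  assumes "continuous_on {a..b} f"
  obtains C where "\<And>u. u \<in> {a..b} \<Longrightarrow> \<bar>f u\<bar> \<le> C"
proof -
  have "bounded (f ` {a..b})"
    by (rule compact_imp_bounded[OF compact_continuous_image[OF assms compact_Icc]])
  then obtain C where "\<forall>x\<in>f ` {a..b}. norm x \<le> C" by (auto simp: bounded_iff)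
  then show thesis by (intro that[of C]) auto
qed

text \<open>
  By variation of constants \<open>Z t\<close> is a pathwise functional of the stochastic integrals of \<open>\<sigma>\<close>.
  The integral in time is the limit of weighted sums of these stochastic integrals at grid points;
  the corresponding sums of integrands converge in \<open>L\<^sup>2\<close>.
\<close>

lemma linear_process_wint:
  assumes W: "wiener_process M B" and L: "linear_process M B q \<sigma> r a Z"
    and q: "continuous_on {0..} q" and \<sigma>: "continuous_on {0..} \<sigma>" and r: "continuous_on {0..} r"
    and t: "t > 0"
  shows "wint M B (\<lambda>s. indicator {0..t} s * (exp (qbar q t - qbar q s) * \<sigma> s)) (\<lambda>\<omega>. Z t \<omega> - mean_fun q r a 0 t)"
proof -
  have qt: "continuous_on {0..t} q" and rt: "continuous_on {0..t} r" and \<sigma>t: "continuous_on {0..t} \<sigma>"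
    using q r \<sigma> by (auto intro: continuous_on_subset)
  have Qt: "continuous_on {0..t} (qbar q)" by (rule continuous_on_qbar[OF qt])
  define G where "G u = exp (qbar q t - qbar q u) * q u" for u
  have G: "continuous_on {0..t} G"
    unfolding G_def[abs_def] using qt Qt by (intro continuous_intros)
  obtain C where C: "\<And>u. u \<in> {0..t} \<Longrightarrow> \<bar>G u\<bar> \<le> C"
    using continuous_on_interval_bound[OF G] by blast
  have C0: "C \<ge> 0" using C[of 0] t by simp
  define g where "g s = indicator {0..t} s * (exp (qbar q t - qbar q s) * \<sigma> s)" for s
  have gc: "continuous_on {0..t} (\<lambda>s. exp (qbar q t - qbar q s) * \<sigma> s)"
    using \<sigma>t Qt by (intro continuous_intros)
  define P where "P u J \<longleftrightarrow> is_wiener_integral M B \<sigma> u J \<and>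
      (AE \<omega> in M. Z u \<omega> = Z 0 \<omega> + integral {0..u} (\<lambda>v. q v * Z v \<omega> + r v) + J \<omega>)" for u J
  have "\<forall>u\<ge>0. \<exists>J. P u J" using L by (simp add: linear_process_def P_def)
  then obtain J where "\<And>u. u \<ge> 0 \<Longrightarrow> P u (J u)" by metis
  then have J: "\<And>u. u \<ge> 0 \<Longrightarrow> is_wiener_integral M B \<sigma> u (J u)"
    and ZJ: "\<And>u. u \<ge> 0 \<Longrightarrow> AE \<omega> in M. Z u \<omega> = Z 0 \<omega> + integral {0..u} (\<lambda>v. q v * Z v \<omega> + r v) + J u \<omega>"
    by (simp_all add: P_def)
  have wJ: "wint M B (\<lambda>s. indicator {0..u} s * \<sigma> s) (J u)" if "u \<ge> 0" for u
    using is_wiener_integral_wint[OF W J[OF that]] \<sigma> by (meson atLeastAtMost_iff atLeast_iff continuous_on_subset subsetI)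
  define c where "c n k = cell_weight t G n k" for n k
  define F where "F n s = indicator {0..t} s * \<sigma> s + (\<Sum>k<Suc n. c n k * (indicator {0..grid t n k} s * \<sigma> s))" for n s
  define X where "X n \<omega> = J t \<omega> + (\<Sum>k<Suc n. c n k * J (grid t n k) \<omega>)" for n \<omega>
  have grid: "grid t n k \<in> {0..t}" if "k < Suc n" for n k
    using t that by (intro grid_mem) auto
  have wX: "wint M B (F n) (X n)" for n
    unfolding F_def[abs_def] X_def[abs_def]
    using t grid by (intro wint_add[OF W] wint_sum[OF W] wJ) auto
  \<comment> \<open>The exchange of the two integrations: for \<open>s\<close> in
    \<open>[0,t]\<close>, the condition that \<open>s\<close> lies below a grid point is read as a
    condition on the grid point. For fixed \<open>s\<close> the sum is then a grid sum for the
    indicator of \<open>{s..}\<close>.\<close>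
  have F_factor: "F n s = \<sigma> s * (1 + (\<Sum>k<Suc n. c n k * indicator {s..} (grid t n k)))" if "s \<in> {0..t}" for n s
  proof -
    have "(\<Sum>k<Suc n. c n k * (indicator {0..grid t n k} s * \<sigma> s)) = (\<Sum>k<Suc n. \<sigma> s * (c n k * indicator {s..} (grid t n k)))"
      using that by (intro sum.cong refl) (auto simp: indicator_def)
    moreover have "F n s = \<sigma> s + (\<Sum>k<Suc n. c n k * (indicator {0..grid t n k} s * \<sigma> s))"
      using that unfolding F_def by simp
    ultimately show ?thesis by (simp only: distrib_left sum_distrib_left mult_1_right)
  qed
  have F_zero: "F n s = 0" if "s \<notin> {0..t}" for n s
    using that grid unfolding F_def by (auto intro!: sum.neutral simp: indicator_def simp del: sum.lessThan_Suc) force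
  have "wint M B g (\<lambda>\<omega>. Z t \<omega> - mean_fun q r a 0 t)"
  proof (rule wint_limit[OF W wX])
    show gm[measurable]: "g \<in> borel_measurable borel"
      unfolding g_def[abs_def] by (rule measurable_indicator_continuous[OF gc])
    have "Z t \<in> borel_measurable M" using L t by (simp add: linear_process_def)
    then show "(\<lambda>\<omega>. Z t \<omega> - mean_fun q r a 0 t) \<in> borel_measurable M" by simp
    have "(\<lambda>s. (g s)\<^sup>2) = (\<lambda>s. indicator {0..t} s * (exp (qbar q t - qbar q s) * \<sigma> s)\<^sup>2)"
      by (auto simp: g_def indicator_def)
    then show "integrable lborel (\<lambda>s. (g s)\<^sup>2)"
      using Qt \<sigma>t by (simp only:) (intro integrable_indicator_continuous continuous_intros)
    \<comment> \<open>Square of the sum of the bounds on \<open>F n\<close> and \<open>g\<close>;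
      the term \<open>C * t * 1\<close> is the bound of \<open>cell_sum_bound\<close> for
      indicators, with \<open>D = 1\<close>.\<close>
    define b where "b s = (\<bar>\<sigma> s\<bar> * (1 + C * t * 1) + \<bar>exp (qbar q t - qbar q s) * \<sigma> s\<bar>)\<^sup>2" for s
    have b: "continuous_on {0..t} b" unfolding b_def[abs_def] using \<sigma>t Qt by (intro continuous_intros)
    have [measurable]: "F n \<in> borel_measurable borel" for n using wintD[OF wX] by simp
    have "(\<lambda>n. \<integral>\<^sup>+u. ennreal ((F n u - g u)\<^sup>2) \<partial>lborel) \<longlonglongrightarrow> (\<integral>\<^sup>+u. 0 \<partial>(lborel :: real measure))"
    proof (rule nn_integral_dominated_convergence[where w = "\<lambda>u. ennreal (indicator {0..t} u * b u)"])
      show "(\<lambda>u. ennreal (indicator {0..t} u * b u)) \<in> borel_measurable lborel"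
        using measurable_indicator_continuous[OF b] by simp
      show "(\<integral>\<^sup>+u. ennreal (indicator {0..t} u * b u) \<partial>lborel) < \<infinity>"
        using integrable_indicator_continuous[OF b]
        by (subst nn_integral_eq_integral) (auto simp: b_def)
      show "AE s in lborel. ennreal ((F n s - g s)\<^sup>2) \<le> ennreal (indicator {0..t} s * b s)" for n
      proof (intro AE_I2 ennreal_leI)
        fix s
        show "(F n s - g s)\<^sup>2 \<le> indicator {0..t} s * b s"
        proof (cases "s \<in> {0..t}")
          case False
          then show ?thesis using F_zero[OF False] by (simp add: g_def)
        next
          case True
          have "\<bar>\<Sum>k<Suc n. c n k * indicator {s..} (grid t n k)\<bar> \<le> C * t * 1"
            unfolding c_def by (rule cell_sum_bound[OF t C]) (auto simp: indicator_def)
          then have "\<bar>F n s\<bar> \<le> \<bar>\<sigma> s\<bar> * (1 + C * t * 1)"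
            unfolding F_factor[OF True] abs_mult by (intro mult_left_mono) auto
          moreover have "g s = exp (qbar q t - qbar q s) * \<sigma> s" using True by (simp add: g_def)
          ultimately have "\<bar>F n s - g s\<bar> \<le> \<bar>\<sigma> s\<bar> * (1 + C * t * 1) + \<bar>exp (qbar q t - qbar q s) * \<sigma> s\<bar>"
            by linarith
          then have "\<bar>F n s - g s\<bar>\<^sup>2 \<le> b s" unfolding b_def by (intro power_mono) auto
          then show ?thesis using True by simp
        qed
      qed
      show "AE s in lborel. (\<lambda>n. ennreal ((F n s - g s)\<^sup>2)) \<longlonglongrightarrow> 0"
      proof (rule AE_I2)
        fix s
        have "(\<lambda>n. F n s) \<longlonglongrightarrow> g s"
        proof (cases "s \<in> {0..t}")
          case False
          then show ?thesis using F_zero[OF False] by (simp add: g_def)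
        next
          case True
          have "(\<lambda>n. \<Sum>k<Suc n. cell_weight t G n k * indicator {s..} (grid t n k)) \<longlonglongrightarrow>
              (\<integral>u. indicator {0..t} u * (G u * indicator {s..} u) \<partial>lborel)"
          proof (rule cell_sum_limit[OF t G])
            show "\<bar>indicator {s..} u\<bar> \<le> (1 :: real)" for u by (simp add: indicator_def)
            show "continuous (at u within {0..t}) (indicator {s..} :: real \<Rightarrow> real)" if "u \<noteq> s" for u
              using isCont_indicator_atLeast[OF that] by (rule continuous_at_imp_continuous_within)
          qed measurable
          also have "(\<lambda>u. indicator {0..t} u * (G u * indicator {s..} u)) = (\<lambda>u. indicator {s..t} u * G u)"
            using True by (auto simp: indicator_def)
          also have "(\<integral>u. indicator {s..t} u * G u \<partial>lborel) = integral {s..t} G"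
            using True by (intro lborel_integral_eq_integral continuous_on_subset[OF G]) auto
          finally have "(\<lambda>n. \<sigma> s * (1 + (\<Sum>k<Suc n. c n k * indicator {s..} (grid t n k)))) \<longlonglongrightarrow> \<sigma> s * (1 + integral {s..t} G)"
            unfolding c_def by (intro tendsto_intros)
          moreover have "\<sigma> s * (1 + integral {s..t} G) = g s"
            using exp_qbar_integral[OF qt, of s] True by (simp add: G_def[abs_def] g_def)
          ultimately show ?thesis by (simp only: F_factor[OF True])
        qed
        then have "(\<lambda>n. ennreal ((F n s - g s)\<^sup>2)) \<longlonglongrightarrow> ennreal ((g s - g s)\<^sup>2)"
          by (intro tendsto_ennrealI tendsto_intros)
        then show "(\<lambda>n. ennreal ((F n s - g s)\<^sup>2)) \<longlonglongrightarrow> 0" by simp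
      qed
    qed measurable
    then show "(\<lambda>n. \<integral>\<^sup>+u. ennreal ((F n u - g u)\<^sup>2) \<partial>lborel) \<longlonglongrightarrow> 0" by simp
    have "AE \<omega> in M. continuous_on {0..} (\<lambda>t. Z t \<omega>)" "AE \<omega> in M. Z 0 \<omega> = a"
      using L by (auto simp: linear_process_def)
    \<comment> \<open>The integral equation holds almost surely for each time separately. Only
      countably many grid points occur, so one null set suffices.\<close>
    moreover have "AE \<omega> in M. \<forall>n k. k < Suc n \<longrightarrow> Z (grid t n k) \<omega> = Z 0 \<omega> +
        integral {0..grid t n k} (\<lambda>v. q v * Z v \<omega> + r v) + J (grid t n k) \<omega>"
      unfolding AE_all_countable
    proof (intro allI)
      fix n k
      show "AE \<omega> in M. k < Suc n \<longrightarrow> Z (grid t n k) \<omega> = Z 0 \<omega> +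
        integral {0..grid t n k} (\<lambda>v. q v * Z v \<omega> + r v) + J (grid t n k) \<omega>"
        using ZJ[of "grid t n k"] grid[of k n] by (cases "k < Suc n") auto
    qed
    moreover have "AE \<omega> in M. Z t \<omega> = Z 0 \<omega> + integral {0..t} (\<lambda>v. q v * Z v \<omega> + r v) + J t \<omega>"
      using ZJ[of t] t by simp
    ultimately show "AE \<omega> in M. (\<lambda>n. X n \<omega>) \<longlonglongrightarrow> Z t \<omega> - mean_fun q r a 0 t"
    proof eventually_elim
      case (elim \<omega>)
      define y where "y u = Z u \<omega> - Z 0 \<omega> - integral {0..u} (\<lambda>v. q v * Z v \<omega> + r v)" for u
      have Zc: "continuous_on {0..t} (\<lambda>u. Z u \<omega>)" using elim(1) by (rule continuous_on_subset) auto
      note voc = variation_of_constants[OF less_imp_le[OF t] qt rt Zc, folded y_def]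
      have y: "continuous_on {0..t} y" using voc(2) by (simp add: y_def[abs_def])
      have Jy: "J (grid t n k) \<omega> = y (grid t n k)" if "k < Suc n" for n k
        using elim(3) that by (simp add: y_def)
      have Jt: "J t \<omega> = y t" using elim(4) by (simp add: y_def)
      obtain D where D: "\<And>u. u \<in> {0..t} \<Longrightarrow> \<bar>y u\<bar> \<le> D"
        using continuous_on_interval_bound[OF y] by blast
      have "(\<lambda>n. \<Sum>k<Suc n. cell_weight t G n k * y (grid t n k)) \<longlonglongrightarrow> (\<integral>u. indicator {0..t} u * (G u * y u) \<partial>lborel)"
        using y by (intro cell_sum_limit[OF t G measurable_indicator_continuous[OF y] D, where s = 0])
          (auto simp: continuous_on_eq_continuous_within)
      also have "(\<integral>u. indicator {0..t} u * (G u * y u) \<partial>lborel) = integral {0..t} (\<lambda>u. G u * y u)"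
        using t G y by (intro lborel_integral_eq_integral continuous_intros) auto
      finally have "(\<lambda>n. y t + (\<Sum>k<Suc n. cell_weight t G n k * y (grid t n k))) \<longlonglongrightarrow> y t + integral {0..t} (\<lambda>u. G u * y u)"
        by (intro tendsto_intros)
      moreover have "X n \<omega> = y t + (\<Sum>k<Suc n. cell_weight t G n k * y (grid t n k))" for n
        unfolding X_def c_def Jt by (simp add: Jy del: sum.lessThan_Suc)
      moreover have "y t + integral {0..t} (\<lambda>u. G u * y u) = Z t \<omega> - mean_fun q r a 0 t"
        using voc(1) elim(2) by (simp add: G_def)
      ultimately show ?case by simp
    qed
  qed
  then show ?thesis by (simp add: g_def[abs_def])
qed

subsection \<open>Covariances of the process and of the bridge\<close>

context
  fixes q \<sigma> r :: "real \<Rightarrow> real" and T :: real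
begin

definition clock :: "real \<Rightarrow> real" where
  "clock t = integral {0..t} (\<lambda>u. exp (- 2 * qbar q u) * (\<sigma> u)\<^sup>2)"

definition process_kernel :: "real \<Rightarrow> real \<Rightarrow> real" where
  "process_kernel t u = indicator {0..t} u * (exp (qbar q t - qbar q u) * \<sigma> u)"

definition bridge_kernel :: "real \<Rightarrow> real \<Rightarrow> real" where
  "bridge_kernel t u = indicator {0..t} u *
     (gamma_fun q \<sigma> t T / gamma_fun q \<sigma> u T * exp (qbar q t - qbar q u) * \<sigma> u)"

lemma clock_0: "clock 0 = 0"
  by (simp add: clock_def)

context
  assumes q: "continuous_on {0..T} q" and \<sigma>: "continuous_on {0..T} \<sigma>" and r: "continuous_on {0..T} r"
    and \<sigma>0: "\<And>s. s \<in> {0..T} \<Longrightarrow> \<sigma> s \<noteq> 0" and T: "T > 0"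
begin

lemma continuous_on_qbar_subset: "A \<subseteq> {0..T} \<Longrightarrow> continuous_on A (qbar q)"
  using continuous_on_subset[OF continuous_on_qbar[OF q]] .

lemma continuous_on_clock_rate: "A \<subseteq> {0..T} \<Longrightarrow> continuous_on A (\<lambda>u. exp (- 2 * qbar q u) * (\<sigma> u)\<^sup>2)"
  by (intro continuous_intros continuous_on_qbar_subset continuous_on_subset[OF \<sigma>])

lemma clock_has_derivative:
  assumes "u \<in> {s..t}" "0 \<le> s" "t \<le> T"
  shows "(clock has_real_derivative exp (- 2 * qbar q u) * (\<sigma> u)\<^sup>2) (at u within {s..t})"
proof (rule DERIV_subset)
  show "(clock has_real_derivative exp (- 2 * qbar q u) * (\<sigma> u)\<^sup>2) (at u within {0..T})"
    unfolding clock_def[abs_def] using assms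
    by (intro integral_has_real_derivative continuous_on_clock_rate) auto
qed (use assms in auto)

text \<open>The derivative is positive because \<open>\<sigma>\<close> has no zero. Strict growth
  keeps the denominators \<open>clock T - clock u\<close> nonzero for \<open>u < T\<close>.\<close>

lemma clock_less:
  assumes "0 \<le> s" "s < t" "t \<le> T"
  shows "clock s < clock t"
proof -
  have "\<exists>u\<in>{s<..<t}. clock t - clock s = exp (- 2 * qbar q u) * (\<sigma> u)\<^sup>2 * (t - s)"
    using assms clock_has_derivative[of _ s t]
    by (intro mvt_simple[where f' = "\<lambda>u x. exp (- 2 * qbar q u) * (\<sigma> u)\<^sup>2 * x"]) (auto simp: has_field_derivative_def)
  then obtain u where "u \<in> {s<..<t}" "clock t - clock s = exp (- 2 * qbar q u) * (\<sigma> u)\<^sup>2 * (t - s)" by blast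
  moreover have "\<sigma> u \<noteq> 0" using \<sigma>0[of u] \<open>u \<in> {s<..<t}\<close> assms by auto
  ultimately have "clock t - clock s > 0" using assms by simp
  then show ?thesis by simp
qed

lemma clock_integral:
  assumes "0 \<le> s" "s \<le> t" "t \<le> T"
  shows "integral {s..t} (\<lambda>u. exp (- 2 * qbar q u) * (\<sigma> u)\<^sup>2) = clock t - clock s"
  unfolding clock_def
  using Henstock_Kurzweil_Integration.integral_combine[OF assms(1,2)
      integrable_continuous_real[OF continuous_on_clock_rate]] assms by fastforce

lemma gamma_fun_clock:
  assumes "0 \<le> s" "s \<le> t" "t \<le> T"
  shows "gamma_fun q \<sigma> s t = exp (2 * qbar q t) * (clock t - clock s)"
proof -
  have "(\<lambda>u. exp (2 * (qbar q t - qbar q u)) * (\<sigma> u)\<^sup>2) =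
      (\<lambda>u. exp (2 * qbar q t) * (exp (- 2 * qbar q u) * (\<sigma> u)\<^sup>2))"
    by (auto simp: right_diff_distrib exp_diff exp_minus field_simps)
  then show ?thesis
    unfolding gamma_fun_def clock_integral[OF assms, symmetric] by (simp only: integral_mult_right)
qed

lemma process_kernel_covariance:
  assumes "s \<in> {0..T}" "t \<in> {0..T}"
  shows "(\<integral>u. process_kernel s u * process_kernel t u \<partial>lborel) = exp (qbar q s + qbar q t) * clock (min s t)"
proof -
  have "process_kernel s u * process_kernel t u =
      exp (qbar q s + qbar q t) * (indicator {0..min s t} u * (exp (- 2 * qbar q u) * (\<sigma> u)\<^sup>2))" for u
  proof -
    have "exp (qbar q s - qbar q u) * exp (qbar q t - qbar q u) = exp (qbar q s + qbar q t) * exp (- 2 * qbar q u)"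
      by (simp flip: exp_add)
    moreover have "process_kernel s u * process_kernel t u =
        indicator {0..min s t} u * ((exp (qbar q s - qbar q u) * exp (qbar q t - qbar q u)) * (\<sigma> u)\<^sup>2)"
      by (auto simp: process_kernel_def indicator_def power2_eq_square)
    ultimately show ?thesis by (simp only: mult_ac)
  qed
  note * = this
  have "(\<integral>u. indicator {0..min s t} u * (exp (- 2 * qbar q u) * (\<sigma> u)\<^sup>2) \<partial>lborel) =
      integral {0..min s t} (\<lambda>u. exp (- 2 * qbar q u) * (\<sigma> u)\<^sup>2)"
    using assms by (intro lborel_integral_eq_integral continuous_on_clock_rate) auto
  also have "\<dots> = clock (min s t) - clock 0" using assms by (intro clock_integral) auto
  finally show ?thesis by (simp only: * integral_mult_right_zero clock_0 diff_zero)
qed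

text \<open>Separates the variables: the factor \<open>exp (2 * qbar q T)\<close> common to both
  values of \<open>gamma_fun\<close> cancels, leaving a function of \<open>t\<close> times a
  function of \<open>u\<close>. Continuity and covariance of the kernel are read off from this
  form.\<close>

lemma bridge_kernel_clock:
  assumes t: "t \<in> {0..<T}" and u: "u \<in> {0..t}"
  shows "gamma_fun q \<sigma> t T / gamma_fun q \<sigma> u T * exp (qbar q t - qbar q u) * \<sigma> u =
    exp (qbar q t) * (clock T - clock t) * (exp (- qbar q u) * \<sigma> u / (clock T - clock u))"
proof -
  have "gamma_fun q \<sigma> t T / gamma_fun q \<sigma> u T = (clock T - clock t) / (clock T - clock u)"
    using t u by (simp add: gamma_fun_clock)
  moreover have "exp (qbar q t - qbar q u) = exp (qbar q t) * exp (- qbar q u)"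
    by (simp flip: exp_add)
  ultimately show ?thesis by simp
qed

lemma clock_less_T: "u \<in> {0..<T} \<Longrightarrow> clock u < clock T"
  using clock_less[of u T] by auto

lemma continuous_on_clock: "A \<subseteq> {0..T} \<Longrightarrow> continuous_on A clock"
proof (rule continuous_on_subset)
  show "continuous_on {0..T} clock"
    using DERIV_continuous[OF clock_has_derivative] by (simp add: continuous_on_eq_continuous_within)
qed

lemma continuous_on_bridge_kernel:
  assumes t: "t \<in> {0..<T}"
  shows "continuous_on {0..t} (\<lambda>u. gamma_fun q \<sigma> t T / gamma_fun q \<sigma> u T * exp (qbar q t - qbar q u) * \<sigma> u)"
proof -
  have "clock T - clock u \<noteq> 0" if "u \<in> {0..t}" for u using clock_less_T[of u] t that by auto
  then have "continuous_on {0..t} (\<lambda>u. exp (qbar q t) * (clock T - clock t) * (exp (- qbar q u) * \<sigma> u / (clock T - clock u)))"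
    using t by (intro continuous_intros continuous_on_qbar_subset continuous_on_clock continuous_on_subset[OF \<sigma>]) auto
  then show ?thesis by (rule continuous_on_eq) (rule bridge_kernel_clock[OF t, symmetric])
qed

text \<open>By the separated form, the product of two kernels is a constant times
  \<open>\<psi>\<close> on \<open>[0, min s t]\<close>, and the primitive of \<open>\<psi>\<close>
  reduces the claim to a rational identity in three clock values.\<close>

lemma bridge_kernel_covariance:
  assumes s: "s \<in> {0..<T}" and t: "t \<in> {0..<T}"
  shows "(\<integral>u. bridge_kernel s u * bridge_kernel t u \<partial>lborel) =
    exp (qbar q s + qbar q t) * (clock (min s t) - clock s * clock t / clock T)"
proof -
  define m where "m = min s t"
  have m: "m \<in> {0..<T}" "m \<le> s" "m \<le> t" using s t by (auto simp: m_def)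
  have ne: "clock T - clock u \<noteq> 0" if "u \<in> {0..m}" for u using clock_less_T[of u] m that by auto
  define \<psi> where "\<psi> u = exp (- 2 * qbar q u) * (\<sigma> u)\<^sup>2 / (clock T - clock u)\<^sup>2" for u
  have \<psi>: "continuous_on {0..m} \<psi>"
    unfolding \<psi>_def[abs_def] using m ne
    by (intro continuous_on_divide continuous_on_clock_rate continuous_intros continuous_on_clock) auto
  have "(\<psi> has_integral 1 / (clock T - clock m) - 1 / (clock T - clock 0)) {0..m}"
  proof (rule fundamental_theorem_of_calculus)
    fix u assume u: "u \<in> {0..m}"
    then have "(clock has_real_derivative exp (- 2 * qbar q u) * (\<sigma> u)\<^sup>2) (at u within {0..m})"
      using m by (intro clock_has_derivative) auto
    then show "((\<lambda>u. 1 / (clock T - clock u)) has_vector_derivative \<psi> u) (at u within {0..m})"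
      unfolding has_real_derivative_iff_has_vector_derivative[symmetric] \<psi>_def
      using ne[OF u] by (auto intro!: derivative_eq_intros simp: power2_eq_square)
  qed (use m in auto)
  then have I: "integral {0..m} \<psi> = 1 / (clock T - clock m) - 1 / clock T"
    by (simp add: integral_unique clock_0)
  have "bridge_kernel s u * bridge_kernel t u =
      exp (qbar q s + qbar q t) * ((clock T - clock s) * (clock T - clock t)) * (indicator {0..m} u * \<psi> u)" for u
  proof (cases "u \<in> {0..m}")
    case True
    then have "bridge_kernel s u = exp (qbar q s) * (clock T - clock s) * (exp (- qbar q u) * \<sigma> u / (clock T - clock u))"
        "bridge_kernel t u = exp (qbar q t) * (clock T - clock t) * (exp (- qbar q u) * \<sigma> u / (clock T - clock u))"
      using m bridge_kernel_clock[OF s, of u] bridge_kernel_clock[OF t, of u] by (simp_all add: bridge_kernel_def)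
    moreover have "exp (- 2 * qbar q u) = exp (- qbar q u) * exp (- qbar q u)" by (simp flip: exp_add)
    ultimately show ?thesis using True
      by (simp only: \<psi>_def exp_add power2_eq_square times_divide_times_eq indicator_simps mult_1 mult_ac times_divide_eq_right times_divide_eq_left divide_divide_eq_left)
  next
    case False
    then show ?thesis by (auto simp: bridge_kernel_def m_def indicator_def)
  qed
  then have "(\<integral>u. bridge_kernel s u * bridge_kernel t u \<partial>lborel) =
      exp (qbar q s + qbar q t) * ((clock T - clock s) * (clock T - clock t)) * (1 / (clock T - clock m) - 1 / clock T)"
    using m \<psi> by (simp add: lborel_integral_eq_integral I)
  also have "\<dots> = exp (qbar q s + qbar q t) * (clock m - clock s * clock t / clock T)"
  proof -
    have "clock T > 0" using clock_less_T[of 0] T by (simp add: clock_0)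
    moreover have "clock s < clock T" "clock t < clock T" using s t clock_less_T by auto
    \<comment> \<open>Here \<open>x\<close>, \<open>y\<close>, \<open>z\<close> stand for the clock
      at \<open>s\<close>, \<open>t\<close>, \<open>T\<close>. This version is for
      \<open>s \<le> t\<close>, where the integral ends at \<open>s\<close>; the next one is for the
      opposite order.\<close>
    moreover have *: "(z - x) * (z - y) * (1 / (z - x) - 1 / z) = x - x * y / z" if "0 < z" "x < z" for x y z :: real
      using that by (simp add: diff_frac_eq) (simp add: field_simps)
    moreover have "(z - x) * (z - y) * (1 / (z - y) - 1 / z) = y - x * y / z" if "0 < z" "y < z" for x y z :: real
      using *[OF that, of x] by (simp add: mult.commute)
    ultimately show ?thesis by (cases "s \<le> t") (simp_all add: m_def mult.assoc)
  qed
  finally show ?thesis by (simp add: m_def)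
qed

text \<open>The flow property of the mean equation: solving up to \<open>T\<close> is solving up to
  \<open>t\<close> and continuing from there. It brings in the integral over \<open>[t,T]\<close>
  that occurs in \<open>bridge_mean\<close>.\<close>

lemma mean_fun_split:
  assumes t: "0 \<le> t" "t \<le> T"
  shows "mean_fun q r a 0 T = exp (qbar q T - qbar q t) * mean_fun q r a 0 t
    + integral {t..T} (\<lambda>u. exp (qbar q T - qbar q u) * r u)"
proof -
  have "continuous_on {0..T} (\<lambda>u. exp (qbar q T - qbar q u) * r u)"
    using r by (intro continuous_intros continuous_on_qbar_subset) auto
  from Henstock_Kurzweil_Integration.integral_combine[OF t integrable_continuous_real[OF this]]
  have "integral {0..T} (\<lambda>u. exp (qbar q T - qbar q u) * r u) =
      integral {0..t} (\<lambda>u. exp (qbar q T - qbar q u) * r u) + integral {t..T} (\<lambda>u. exp (qbar q T - qbar q u) * r u)"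
    by simp
  moreover have "(\<lambda>u. exp (qbar q T - qbar q u) * r u) =
      (\<lambda>u. exp (qbar q T - qbar q t) * (exp (qbar q t - qbar q u) * r u))"
    by (simp add: mult.assoc[symmetric] flip: exp_add)
  then have "integral {0..t} (\<lambda>u. exp (qbar q T - qbar q u) * r u) =
      exp (qbar q T - qbar q t) * integral {0..t} (\<lambda>u. exp (qbar q t - qbar q u) * r u)"
    by (simp only: integral_mult_right)
  moreover have "exp (qbar q T) = exp (qbar q T - qbar q t) * exp (qbar q t)"
    by (simp flip: exp_add)
  ultimately show ?thesis by (simp add: mean_fun_def algebra_simps)
qed

text \<open>By \<open>mean_fun_split\<close>, \<open>b\<close> minus the integral over
  \<open>[t,T]\<close> equals \<open>b\<close> minus the mean at \<open>T\<close> plus a multiple of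
  the mean at \<open>t\<close>. The two resulting weights of the mean at \<open>t\<close> are
  \<open>clock t / clock T\<close> and its complement to 1, so the bridge mean is the regression of
  \<open>Z t\<close> on \<open>Z T\<close> evaluated at \<open>b\<close>.\<close>

lemma bridge_mean_regression:
  assumes t: "t \<in> {0..<T}"
  shows "bridge_mean q \<sigma> r T a b 0 t = mean_fun q r a 0 t +
    exp (qbar q t - qbar q T) * (clock t / clock T) * (b - mean_fun q r a 0 T)"
proof -
  define x where "x = exp (qbar q T - qbar q t)"
  have x: "x > 0" "exp (qbar q t - qbar q T) = 1 / x" by (auto simp: x_def exp_diff)
  \<comment> \<open>All exponentials are expressed by \<open>x\<close> and
    \<open>exp (2 * qbar q T)\<close>; the latter cancels, and a rational identity remains.\<close>
  have Q: "exp (2 * qbar q t) = exp (2 * qbar q T) / x\<^sup>2"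
    by (simp add: x_def exp_diff exp_double power_divide)
  have "clock T > 0" using clock_less_T[of 0] T by (simp add: clock_0)
  then show ?thesis
    using t x(1) T
    by (simp add: bridge_mean_def gamma_fun_clock clock_0 mean_fun_split[of t a] x(2) Q x_def[symmetric])
      (simp add: field_simps power2_eq_square)
qed

end

end

text \<open>Existence and uniqueness of \<open>\<kappa>\<close> are part of the conclusion, so that
  the identity at \<open>b\<close> is not vacuous and concerns one definite kernel.\<close>

theorem proposition3p1:
  fixes M :: "'w measure"
    and B Z U :: "real \<Rightarrow> 'w \<Rightarrow> real"
    and q \<sigma> r :: "real \<Rightarrow> real"
    and a b T :: real
    and n :: nat
    and t :: "nat \<Rightarrow> real"
  assumes "continuous_on {0..} q" and "continuous_on {0..} \<sigma>" and "continuous_on {0..} r"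
    and "\<And>s. s \<ge> 0 \<Longrightarrow> \<sigma> s \<noteq> 0"
    and "T > 0"
    and "wiener_process M B"
    and "linear_process M B q \<sigma> r a Z"
    and "linear_process_bridge M B q \<sigma> r T a b U"
    and "n \<ge> 1"
    and "0 < t 1" and "\<And>k. 1 \<le> k \<Longrightarrow> k < n \<Longrightarrow> t k < t (Suc k)" and "t n < T"
  shows "(\<exists>!\<kappa>. gauss_cond_distr M {1..n} (\<lambda>k. Z (t k)) (Z T) \<kappa>) \<and>
         (\<forall>\<kappa>. gauss_cond_distr M {1..n} (\<lambda>k. Z (t k)) (Z T) \<kappa> \<longrightarrow>
            \<kappa> b = law M {1..n} (\<lambda>k. U (t k)))"
proof -
  note W = assms(6)
  have q: "continuous_on {0..T} q" and \<sigma>: "continuous_on {0..T} \<sigma>" and r: "continuous_on {0..T} r"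
    using assms(1-3) by (auto intro: continuous_on_subset)
  have \<sigma>0: "\<And>s. s \<in> {0..T} \<Longrightarrow> \<sigma> s \<noteq> 0" using assms(4) by auto
  note T = \<open>T > 0\<close>
  note ctxt = q \<sigma> r \<sigma>0 T
  have tk: "t k \<in> {0<..<T}" if k: "k \<in> {1..n}" for k
  proof -
    have "t i \<le> t j" if "1 \<le> i" "i \<le> j" "j \<le> n" for i j
      using that(2,3)
    proof (induction j rule: dec_induct)
      case (step l)
      then show ?case using assms(11)[of l] that(1) by simp
    qed simp
    from this[of 1 k] this[of k n] show ?thesis using k assms(10,12) by auto
  qed
  let ?g = "process_kernel q \<sigma>" and ?h = "bridge_kernel q \<sigma> T"
  have wZ: "wint M B (?g s) (\<lambda>\<omega>. Z s \<omega> - mean_fun q r a 0 s)" if "s > 0" for s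
    using linear_process_wint[OF W assms(7) assms(1,2,3) that] unfolding process_kernel_def[abs_def] .
  have wU: "wint M B (?h s) (\<lambda>\<omega>. U s \<omega> - bridge_mean q \<sigma> r T a b 0 s)" if s: "s \<in> {0<..<T}" for s
  proof -
    obtain J where J: "is_wiener_integral M B (\<lambda>u. gamma_fun q \<sigma> s T / gamma_fun q \<sigma> u T * exp (qbar q s - qbar q u) * \<sigma> u) s J"
        "AE \<omega> in M. U s \<omega> = bridge_mean q \<sigma> r T a b 0 s + J \<omega>"
    proof -
      have "s \<in> {0..<T}" using s by auto
      then show thesis using assms(8)[unfolded linear_process_bridge_def] that by blast
    qed
    have U: "U s \<in> borel_measurable M" using assms(8) s by (simp add: linear_process_bridge_def)
    have "wint M B (?h s) J"
      unfolding bridge_kernel_def[abs_def] using s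
      by (intro is_wiener_integral_wint[OF W J(1)] continuous_on_bridge_kernel[OF ctxt]) auto
    then show ?thesis
    proof (rule wint_AE_cong)
      show "AE \<omega> in M. J \<omega> = U s \<omega> - bridge_mean q \<sigma> r T a b 0 s"
        using J(2) by eventually_elim simp
    qed (use U in simp)
  qed
  have cT: "clock q \<sigma> T > 0"
    using clock_less_T[OF ctxt, of 0] T by (simp add: clock_0)
  have gT: "(\<integral>u. ?g T u * ?g T u \<partial>lborel) = exp (qbar q T + qbar q T) * clock q \<sigma> T"
    using process_kernel_covariance[OF ctxt, of T T] T by simp
  have pos: "0 < (\<integral>u. ?g T u * ?g T u \<partial>lborel)" unfolding gT using cT by simp
  define f where "f k = ?g (t k)" for k
  define X where "X k = Z (t k)" for k
  define m where "m k = mean_fun q r a 0 (t k)" for k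
  have f: "wint M B (f k) (\<lambda>\<omega>. X k \<omega> - m k)" if "k \<in> {1..n}" for k
    using wZ tk[OF that] by (simp add: f_def X_def m_def)
  have fg: "(\<integral>u. f k u * ?g T u \<partial>lborel) = exp (qbar q (t k) + qbar q T) * clock q \<sigma> (t k)" if "k \<in> {1..n}" for k
    using process_kernel_covariance[OF ctxt, of "t k" T] tk[OF that] T by (simp add: f_def)
  \<comment> \<open>The regression coefficient has exactly the form of the factor in
    \<open>bridge_mean_regression\<close>, which makes the means agree.\<close>
  have regr: "regr f (?g T) k = exp (qbar q (t k) - qbar q T) * (clock q \<sigma> (t k) / clock q \<sigma> T)" if "k \<in> {1..n}" for k
  proof -
    have "exp (qbar q (t k) + qbar q T) = exp (qbar q (t k) - qbar q T) * exp (qbar q T + qbar q T)"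
      by (simp flip: exp_add)
    then show ?thesis unfolding regr_def fg[OF that] gT by simp
  qed
  have "gauss_law {1..n} (\<lambda>k. bridge_mean q \<sigma> r T a b 0 (t k)) (\<lambda>i j. \<integral>u. ?h (t i) u * ?h (t j) u \<partial>lborel)
      (law M {1..n} (\<lambda>k. U (t k)))"
    using tk by (intro gauss_law_wint[OF W] wU) auto
  also have "?this \<longleftrightarrow> gauss_law {1..n} (\<lambda>k. m k + regr f (?g T) k * (b - mean_fun q r a 0 T))
      (\<lambda>i j. (\<integral>u. f i u * f j u \<partial>lborel) - regr f (?g T) i * (\<integral>u. f j u * ?g T u \<partial>lborel))
      (law M {1..n} (\<lambda>k. U (t k)))"
  proof (rule gauss_law_cong)
    fix i assume i: "i \<in> {1..n}"
    show "bridge_mean q \<sigma> r T a b 0 (t i) = m i + regr f (?g T) i * (b - mean_fun q r a 0 T)"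
      using bridge_mean_regression[OF ctxt, of "t i" a b] tk[OF i] by (simp add: m_def regr[OF i])
    fix j assume j: "j \<in> {1..n}"
    have "(\<integral>u. f i u * f j u \<partial>lborel) = exp (qbar q (t i) + qbar q (t j)) * clock q \<sigma> (min (t i) (t j))"
      using process_kernel_covariance[OF ctxt, of "t i" "t j"] tk[OF i] tk[OF j] by (simp add: f_def)
    moreover have "(\<integral>u. ?h (t i) u * ?h (t j) u \<partial>lborel) =
        exp (qbar q (t i) + qbar q (t j)) * (clock q \<sigma> (min (t i) (t j)) - clock q \<sigma> (t i) * clock q \<sigma> (t j) / clock q \<sigma> T)"
      using bridge_kernel_covariance[OF ctxt, of "t i" "t j"] tk[OF i] tk[OF j] by simp
    \<comment> \<open>The exponentials of \<open>qbar q T\<close> cancel, and the correction term of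
      the conditional covariance becomes the subtracted term of the bridge covariance.\<close>
    moreover have "regr f (?g T) i * (\<integral>u. f j u * ?g T u \<partial>lborel) =
        exp (qbar q (t i) + qbar q (t j)) * (clock q \<sigma> (t i) * clock q \<sigma> (t j) / clock q \<sigma> T)"
    proof -
      have "exp (qbar q (t i) - qbar q T) * exp (qbar q (t j) + qbar q T) = exp (qbar q (t i) + qbar q (t j))"
        by (simp flip: exp_add)
      then show ?thesis unfolding regr[OF i] fg[OF j] by (simp add: mult.assoc[symmetric])
    qed
    ultimately show "(\<integral>u. ?h (t i) u * ?h (t j) u \<partial>lborel) =
        (\<integral>u. f i u * f j u \<partial>lborel) - regr f (?g T) i * (\<integral>u. f j u * ?g T u \<partial>lborel)"
      by (simp only: right_diff_distrib)
  qed
  finally have U: "gauss_law {1..n} (\<lambda>k. m k + regr f (?g T) k * (b - mean_fun q r a 0 T))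
      (\<lambda>i j. (\<integral>u. f i u * f j u \<partial>lborel) - regr f (?g T) i * (\<integral>u. f j u * ?g T u \<partial>lborel))
      (law M {1..n} (\<lambda>k. U (t k)))" .
  have fin: "finite {1..n}" by simp
  have "\<exists>!\<kappa>. gauss_cond_distr M {1..n} X (Z T) \<kappa>"
    by (rule ex1_gauss_cond_distr[OF W fin f wZ[OF T] pos])
  moreover have "\<kappa> b = law M {1..n} (\<lambda>k. U (t k))" if "gauss_cond_distr M {1..n} X (Z T) \<kappa>" for \<kappa>
  proof -
    have "gauss_cond_distr M {1..n} X (Z T) \<kappa> \<longleftrightarrow> regular_cond_distr M {1..n} X (Z T) \<kappa> \<and>
     (\<forall>w. gauss_law {1..n} (\<lambda>i. m i + regr f (?g T) i * (w - mean_fun q r a 0 T))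
       (\<lambda>i j. (\<integral>u. f i u * f j u \<partial>lborel) - regr f (?g T) i * (\<integral>u. f j u * ?g T u \<partial>lborel)) (\<kappa> w))"
      by (rule gauss_cond_distr_iff[OF W fin f wZ[OF T] pos])
    with that have "gauss_law {1..n} (\<lambda>i. m i + regr f (?g T) i * (b - mean_fun q r a 0 T))
       (\<lambda>i j. (\<integral>u. f i u * f j u \<partial>lborel) - regr f (?g T) i * (\<integral>u. f j u * ?g T u \<partial>lborel)) (\<kappa> b)"
      by blast
    then show ?thesis using U by (rule gauss_law_unique[OF fin])
  qed
  ultimately show ?thesis unfolding X_def[abs_def] by blast
qed

end
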